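(* Let $M$ be a closed manifold and let $g_1$ and $g_2$ be two Riemannian metrics on $M$. Let $\beta_{g_i}\colon H_1(M;\mathbb{R})\to\mathbb{R}$ be the Mather's $\beta$-function associated to $g_i$, $i=1,2$, and let $\mathcal C_{g_1}(g_2)=\max_{x\in M}\max_{v\in T_xM,\ g_{1,x}(v,v)=1} g_{2,x}(v,v)$. Then: (i) $\beta_{g_2}(h)\le \mathcal C_{g_1}(g_2)\,\beta_{g_1}(h)$ for all $h\in H_1(M;\mathbb{R})$. (ii) Let $h\in H_1(M;\mathbb{R})\setminus\{0\}$. Then $\beta_{g_2}(h)=\mathcal C_{g_1}(g_2)\,\beta_{g_1}(h)$ if and only if $\mathfrak M_{g_1}^h\subseteq \mathfrak M_{g_2}^h$ and $g_2=\mathcal C_{g_1}(g_2)\,g_1$ on $\widetilde{\mathcal M}_{g_1}^h\subseteq\widetilde{\mathcal M}_{g_2}^h$ (that is, $\widetilde{\mathcal M}_{g_1}^h\subseteq\widetilde{\mathcal M}_{g_2}^h$ and $g_{2,x}(v,v)=\mathcal C_{g_1}(g_2)\,g_{1,x}(v,v)$ for every $(x,v)\in\widetilde{\mathcal M}_{g_1}^h$). (iii) Assume that $g_1$ and $g_2$ are conformally equivalent, i.e., $g_2=\varphi\cdot g_1$ for some positive function $\varphi\in C^\infty(M)$, and let $m:=\max_M\varphi$. Then $\beta_{g_2}(h)\le m\,\beta_{g_1}(h)$ for all $h\in H_1(M;\mathbb{R})$. Moreover, for $h\in H_1(M;\mathbb{R})\setminus\{0\}$, we have $\beta_{g_2}(h)=m\,\beta_{g_1}(h)$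 if and only if $\mathfrak M_{g_1}^h\subseteq\mathfrak M_{g_2}^h$ and $\varphi\equiv m$ on $\mathcal M_{g_1}^h\subseteq\mathcal M_{g_2}^h$ (that is, $\mathcal M_{g_1}^h\subseteq\mathcal M_{g_2}^h$ and $\varphi(x)=m$ for every $x\in\mathcal M_{g_1}^h$).
   Context: Let $M$ be a closed (compact, without boundary) manifold and $g$ a Riemannian metric on $M$; $\|v\|_x=\sqrt{g_x(v,v)}$ for $v\in T_xM$, and $L_g(x,v)=\tfrac12\|v\|_x^2=\tfrac12 g_x(v,v)$. $\mathcal M(TM)$ denotes the set of Borel probability measures $\mu$ on $TM$ that are closed, i.e. $\int_{TM} df_x(v)\,d\mu(x,v)=0$ for every $f\in C^1(M)$, and have finite first momentum, i.e. $\int_{TM}\|v\|_x\,d\mu<\infty$ (since $M$ is compact this does not depend on the metric). The rotation vector (Schwartzman asymptotic cycle) of $\mu\in\mathcal M(TM)$ is the class $\rho(\mu)\in H_1(M;\mathbb{R})$ determined by $\langle[\eta],\rho(\mu)\rangle=\int_{TM}\eta_x(v)\,d\mu(x,v)$ for every closed smooth 1-form $\eta$ on $M$, where $\langle\cdot,\cdot\rangle$ is the pairing between $H^1(M;\mathbb{R})$ and $H_1(M;\mathbb{R})$. The map $\rho\colon\mathcal M(TM)\to H_1(M;\mathbb{R})$ is surjective. Mather's $\beta$-function of $g$ is $\beta_g(h):=\min_{\mu\in\rho^{-1}(h)}\int_{TM}L_g(x,v)\,d\mu$, $h\in H_1(M;\mathbb{R})$ (the minimum is attained). The set of Mather measures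 of rotation vector $h$, i.e. the measures $\mu\in\rho^{-1}(h)$ achieving the minimum, is denoted $\mathfrak M_g^h$. The Mather set of homology class $h$ is $\widetilde{\mathcal M}_g^h:=\bigcup_{\mu\in\mathfrak M_g^h}\operatorname{supp}(\mu)\subset TM$, and the projected Mather set is $\mathcal M_g^h:=\pi(\widetilde{\mathcal M}_g^h)\subset M$, where $\pi\colon TM\to M$ is the canonical projection. *)

theory Defs
  imports "HOL-Probability.Probability" "HOL-Homology.Homology"
begin

section \<open>Smooth functions on open subsets of a Euclidean space\<close>

primrec Ck_on :: "nat \<Rightarrow> 'e::euclidean_space set \<Rightarrow> ('e \<Rightarrow> 'f::euclidean_space) \<Rightarrow> bool" where
  "Ck_on 0 S f \<longleftrightarrow> continuous_on S f"
| "Ck_on (Suc k) S f \<longleftrightarrow>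
     (\<forall>x\<in>S. f differentiable (at x)) \<and> (\<forall>u. Ck_on k S (\<lambda>x. frechet_derivative f (at x) u))"

definition smooth_on :: "'e::euclidean_space set \<Rightarrow> ('e \<Rightarrow> 'f::euclidean_space) \<Rightarrow> bool" where
  "smooth_on S f \<longleftrightarrow> (\<forall>k. Ck_on k S f)"


section \<open>Closed manifolds\<close>

text \<open>The points of the manifold are the elements of a Hausdorff type; the smooth structure is
  given by an arbitrary (not necessarily maximal) smooth atlas modelled on a Euclidean space
  \<open>'e\<close>. The class \<open>euclidean_space\<close> forces the dimension to be at least 1. Second countability
  follows from compactness.\<close>

type_synonym ('a, 'e) chart = "'a set \<times> ('a \<Rightarrow> 'e)"

definition chart_image :: "('a, 'e) chart \<Rightarrow> 'e set" where
  "chart_image c = snd c ` fst c"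

definition chart_inv :: "('a, 'e) chart \<Rightarrow> 'e \<Rightarrow> 'a" where
  "chart_inv c = inv_into (fst c) (snd c)"

definition is_chart :: "('a::t2_space, 'e::euclidean_space) chart \<Rightarrow> bool" where
  "is_chart c \<longleftrightarrow> open (fst c) \<and> open (chart_image c) \<and>
     homeomorphism (fst c) (chart_image c) (snd c) (chart_inv c)"

definition smooth_atlas :: "('a::t2_space, 'e::euclidean_space) chart set \<Rightarrow> bool" where
  "smooth_atlas A \<longleftrightarrow>
     (\<forall>c\<in>A. is_chart c) \<and> (\<Union>c\<in>A. fst c) = UNIV \<and>
     (\<forall>c\<in>A. \<forall>d\<in>A. smooth_on (snd c ` (fst c \<inter> fst d)) (snd d \<circ> chart_inv c))"

definition closed_manifold :: "('a::t2_space, 'e::euclidean_space) chart set \<Rightarrow> bool" where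
  "closed_manifold A \<longleftrightarrow> compact (UNIV :: 'a set) \<and> smooth_atlas A"

definition manifold_Ck ::
    "('a::t2_space, 'e::euclidean_space) chart set \<Rightarrow> nat \<Rightarrow> 'a set \<Rightarrow> ('a \<Rightarrow> real) \<Rightarrow> bool" where
  "manifold_Ck A k U f \<longleftrightarrow> (\<forall>c\<in>A. Ck_on k (snd c ` (fst c \<inter> U)) (f \<circ> chart_inv c))"

definition manifold_smooth ::
    "('a::t2_space, 'e::euclidean_space) chart set \<Rightarrow> 'a set \<Rightarrow> ('a \<Rightarrow> real) \<Rightarrow> bool" where
  "manifold_smooth A U f \<longleftrightarrow> (\<forall>k. manifold_Ck A k U f)"


section \<open>The tangent bundle\<close>

text \<open>A tangent vector at \<open>x\<close> is the family of its coordinate representations in the charts of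
  the atlas around \<open>x\<close>, subject to the usual transformation law, and extended by 0 to all other
  charts. The vector operations are pointwise.\<close>

type_synonym ('a, 'e) tvec = "('a, 'e) chart \<Rightarrow> 'e"

definition tangent_space ::
    "('a::t2_space, 'e::euclidean_space) chart set \<Rightarrow> 'a \<Rightarrow> ('a, 'e) tvec set" where
  "tangent_space A x = {v.
     (\<forall>c. c \<notin> A \<or> x \<notin> fst c \<longrightarrow> v c = 0) \<and>
     (\<forall>c\<in>A. \<forall>d\<in>A. x \<in> fst c \<and> x \<in> fst d \<longrightarrow>
        v d = frechet_derivative (snd d \<circ> chart_inv c) (at (snd c x)) (v c))}"

text \<open>The tangent vector at \<open>x\<close> whose coordinates in the chart \<open>c\<close> are \<open>w\<close>.\<close>

definition coord_vec ::
    "('a::t2_space, 'e::euclidean_space) chart set \<Rightarrow> ('a, 'e) chart \<Rightarrow> 'a \<Rightarrow> 'e \<Rightarrow> ('a, 'e) tvec"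
  where
  "coord_vec A c x w = (\<lambda>d. if d \<in> A \<and> x \<in> fst d
     then frechet_derivative (snd d \<circ> chart_inv c) (at (snd c x)) w else 0)"

definition tangent_bundle ::
    "('a::t2_space, 'e::euclidean_space) chart set \<Rightarrow> ('a \<times> ('a, 'e) tvec) set" where
  "tangent_bundle A = Sigma UNIV (tangent_space A)"

definition bundle_param ::
    "('a::t2_space, 'e::euclidean_space) chart set \<Rightarrow> ('a, 'e) chart \<Rightarrow> 'e \<times> 'e \<Rightarrow> 'a \<times> ('a, 'e) tvec"
  where
  "bundle_param A c = (\<lambda>(p, w). (chart_inv c p, coord_vec A c (chart_inv c p) w))"

text \<open>A set is open in the tangent bundle iff it is open in all the bundle charts.\<close>

definition tangent_topology ::
    "('a::t2_space, 'e::euclidean_space) chart set \<Rightarrow> ('a \<times> ('a, 'e) tvec) topology" where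
  "tangent_topology A = topology (\<lambda>W. W \<subseteq> tangent_bundle A \<and>
     (\<forall>c\<in>A. open {q \<in> chart_image c \<times> UNIV. bundle_param A c q \<in> W}))"

lemma openin_tangent_topology:
  "openin (tangent_topology A) W \<longleftrightarrow> W \<subseteq> tangent_bundle A \<and>
     (\<forall>c\<in>A. open {q \<in> chart_image c \<times> UNIV. bundle_param A c q \<in> W})"
proof -
  have "istopology (\<lambda>W. W \<subseteq> tangent_bundle A \<and>
     (\<forall>c\<in>A. open {q \<in> chart_image c \<times> UNIV. bundle_param A c q \<in> W}))"
    (is "istopology ?P")
  proof (unfold istopology_def, intro conjI allI impI)
    fix S T assume *: "?P S" "?P T"
    show "S \<inter> T \<subseteq> tangent_bundle A" using * by blast
    show "\<forall>c\<in>A. open {q \<in> chart_image c \<times> UNIV. bundle_param A c q \<in> S \<inter> T}"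
    proof
      fix c assume "c \<in> A"
      then have "open ({q \<in> chart_image c \<times> UNIV. bundle_param A c q \<in> S} \<inter>
          {q \<in> chart_image c \<times> UNIV. bundle_param A c q \<in> T})"
        using * by (intro open_Int) auto
      then show "open {q \<in> chart_image c \<times> UNIV. bundle_param A c q \<in> S \<inter> T}"
        by (rule back_subst[where P="open"]) blast
    qed
  next
    fix K assume *: "\<forall>S\<in>K. ?P S"
    show "\<Union>K \<subseteq> tangent_bundle A" using * by blast
    show "\<forall>c\<in>A. open {q \<in> chart_image c \<times> UNIV. bundle_param A c q \<in> \<Union>K}"
    proof
      fix c assume "c \<in> A"
      then have "open (\<Union>S\<in>K. {q \<in> chart_image c \<times> UNIV. bundle_param A c q \<in> S})"
        using * by (intro open_UN) auto
      then show "open {q \<in> chart_image c \<times> UNIV. bundle_param A c q \<in> \<Union>K}"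
        by (rule back_subst[where P="open"]) blast
    qed
  qed
  then show ?thesis
    unfolding tangent_topology_def by (simp add: topology_inverse')
qed


section \<open>Differentials, 1-forms and Riemannian metrics\<close>

text \<open>The value does not depend on the chart chosen if \<open>f\<close> is differentiable and \<open>v\<close> is a
  tangent vector at \<open>x\<close>.\<close>

definition differential ::
    "('a::t2_space, 'e::euclidean_space) chart set \<Rightarrow> ('a \<Rightarrow> real) \<Rightarrow> 'a \<Rightarrow> ('a, 'e) tvec \<Rightarrow> real"
  where
  "differential A f x v =
     (let c = (SOME c. c \<in> A \<and> x \<in> fst c)
      in frechet_derivative (f \<circ> chart_inv c) (at (snd c x)) (v c))"

text \<open>Forms and metrics are only relevant on tangent vectors; their values elsewhere are
  arbitrary.\<close>

definition form_coord ::
    "('a::t2_space, 'e::euclidean_space) chart set \<Rightarrow> ('a \<Rightarrow> ('a, 'e) tvec \<Rightarrow> real) \<Rightarrow>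
     ('a, 'e) chart \<Rightarrow> 'e \<Rightarrow> 'e \<Rightarrow> real" where
  "form_coord A \<eta> c w = (\<lambda>p. \<eta> (chart_inv c p) (coord_vec A c (chart_inv c p) w))"

definition smooth_1form ::
    "('a::t2_space, 'e::euclidean_space) chart set \<Rightarrow> ('a \<Rightarrow> ('a, 'e) tvec \<Rightarrow> real) \<Rightarrow> bool" where
  "smooth_1form A \<eta> \<longleftrightarrow>
     (\<forall>x. \<forall>v\<in>tangent_space A x. \<forall>w\<in>tangent_space A x. \<forall>a b.
        \<eta> x (\<lambda>c. a *\<^sub>R v c + b *\<^sub>R w c) = a * \<eta> x v + b * \<eta> x w) \<and>
     (\<forall>c\<in>A. \<forall>w. smooth_on (chart_image c) (form_coord A \<eta> c w))"

definition closed_1form ::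
    "('a::t2_space, 'e::euclidean_space) chart set \<Rightarrow> ('a \<Rightarrow> ('a, 'e) tvec \<Rightarrow> real) \<Rightarrow> bool" where
  "closed_1form A \<eta> \<longleftrightarrow> smooth_1form A \<eta> \<and>
     (\<forall>c\<in>A. \<forall>p\<in>chart_image c. \<forall>u w.
        frechet_derivative (form_coord A \<eta> c w) (at p) u =
        frechet_derivative (form_coord A \<eta> c u) (at p) w)"

definition riemannian_metric ::
    "('a::t2_space, 'e::euclidean_space) chart set \<Rightarrow>
     ('a \<Rightarrow> ('a, 'e) tvec \<Rightarrow> ('a, 'e) tvec \<Rightarrow> real) \<Rightarrow> bool" where
  "riemannian_metric A g \<longleftrightarrow>
     (\<forall>x. \<forall>u\<in>tangent_space A x. \<forall>v\<in>tangent_space A x. \<forall>w\<in>tangent_space A x. \<forall>a b.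
        g x (\<lambda>c. a *\<^sub>R u c + b *\<^sub>R v c) w = a * g x u w + b * g x v w) \<and>
     (\<forall>x. \<forall>v\<in>tangent_space A x. \<forall>w\<in>tangent_space A x. g x v w = g x w v) \<and>
     (\<forall>x. \<forall>v\<in>tangent_space A x. v \<noteq> (\<lambda>c. 0) \<longrightarrow> g x v v > 0) \<and>
     (\<forall>c\<in>A. \<forall>u w. smooth_on (chart_image c)
        (\<lambda>p. g (chart_inv c p) (coord_vec A c (chart_inv c p) u) (coord_vec A c (chart_inv c p) w)))"


section \<open>First real singular homology and its pairing with closed 1-forms\<close>

text \<open>The singular chains of HOL-Homology have integer coefficients; the following is the same
  construction with real coefficients.\<close>

type_synonym 'a real_chain = "((nat \<Rightarrow> real) \<Rightarrow> 'a) \<Rightarrow>\<^sub>0 real"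

definition real_singular_chain :: "nat \<Rightarrow> 'a topology \<Rightarrow> 'a real_chain \<Rightarrow> bool" where
  "real_singular_chain p X c \<longleftrightarrow> Poly_Mapping.keys c \<subseteq> singular_simplex_set p X"

definition real_chain_boundary :: "nat \<Rightarrow> 'a real_chain \<Rightarrow> 'a real_chain" where
  "real_chain_boundary p c = (if p = 0 then 0 else
     (\<Sum>\<sigma>\<in>Poly_Mapping.keys c. \<Sum>k\<le>p.
        Poly_Mapping.single (singular_face p k \<sigma>) ((-1) ^ k * Poly_Mapping.lookup c \<sigma>)))"

definition real_cycles :: "nat \<Rightarrow> 'a topology \<Rightarrow> 'a real_chain set" where
  "real_cycles p X = {c. real_singular_chain p X c \<and> real_chain_boundary p c = 0}"

definition real_boundaries :: "nat \<Rightarrow> 'a topology \<Rightarrow> 'a real_chain set" where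
  "real_boundaries p X = real_chain_boundary (Suc p) ` {d. real_singular_chain (Suc p) X d}"

text \<open>Homology classes are cosets of the space of boundaries; that space is the zero class.\<close>

definition real_homology :: "nat \<Rightarrow> 'a topology \<Rightarrow> 'a real_chain set set" where
  "real_homology p X = real_cycles p X //
     {(c, d). c \<in> real_cycles p X \<and> d \<in> real_cycles p X \<and> c - d \<in> real_boundaries p X}"

abbreviation H1 :: "'a::t2_space real_chain set set" where
  "H1 \<equiv> real_homology 1 (euclidean :: 'a topology)"

abbreviation H1_zero :: "'a::t2_space real_chain set" where
  "H1_zero \<equiv> real_boundaries 1 (euclidean :: 'a topology)"

definition simplex_path :: "((nat \<Rightarrow> real) \<Rightarrow> 'a) \<Rightarrow> real \<Rightarrow> 'a" where
  "simplex_path \<sigma> t = \<sigma> (\<lambda>i. if i = 0 then 1 - t else if i = 1 then t else 0)"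

text \<open>Singular simplices are merely continuous, so a closed form is integrated along a path by
  means of local primitives. For a closed form, and a continuous path, such a value exists and is
  unique; for a piecewise smooth path it is the usual line integral.\<close>

definition has_path_integral_value ::
    "('a::t2_space, 'e::euclidean_space) chart set \<Rightarrow> ('a \<Rightarrow> ('a, 'e) tvec \<Rightarrow> real) \<Rightarrow>
     (real \<Rightarrow> 'a) \<Rightarrow> real \<Rightarrow> bool" where
  "has_path_integral_value A \<eta> \<gamma> r \<longleftrightarrow>
     (\<exists>(n::nat) (t :: nat \<Rightarrow> real) (U :: nat \<Rightarrow> 'a set) (f :: nat \<Rightarrow> 'a \<Rightarrow> real).
        t 0 = 0 \<and> t n = 1 \<and>
        (\<forall>i<n. t i \<le> t (Suc i) \<and> open (U i) \<and> \<gamma> ` {t i..t (Suc i)} \<subseteq> U i \<and>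
           manifold_smooth A (U i) (f i) \<and>
           (\<forall>x\<in>U i. \<forall>v\<in>tangent_space A x. \<eta> x v = differential A (f i) x v)) \<and>
        r = (\<Sum>i<n. f i (\<gamma> (t (Suc i))) - f i (\<gamma> (t i))))"

definition closed_form_integral ::
    "('a::t2_space, 'e::euclidean_space) chart set \<Rightarrow> ('a \<Rightarrow> ('a, 'e) tvec \<Rightarrow> real) \<Rightarrow>
     (real \<Rightarrow> 'a) \<Rightarrow> real" where
  "closed_form_integral A \<eta> \<gamma> = (THE r. has_path_integral_value A \<eta> \<gamma> r)"

definition chain_integral ::
    "('a::t2_space, 'e::euclidean_space) chart set \<Rightarrow> ('a \<Rightarrow> ('a, 'e) tvec \<Rightarrow> real) \<Rightarrow>
     'a real_chain \<Rightarrow> real" where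
  "chain_integral A \<eta> c =
     (\<Sum>\<sigma>\<in>Poly_Mapping.keys c.
        Poly_Mapping.lookup c \<sigma> * closed_form_integral A \<eta> (simplex_path \<sigma>))"

text \<open>The de Rham pairing of the cohomology class of \<open>\<eta>\<close> with \<open>h\<close>; by Stokes, any cycle
  representing \<open>h\<close> gives the same value.\<close>

definition pairing ::
    "('a::t2_space, 'e::euclidean_space) chart set \<Rightarrow> ('a \<Rightarrow> ('a, 'e) tvec \<Rightarrow> real) \<Rightarrow>
     'a real_chain set \<Rightarrow> real" where
  "pairing A \<eta> h = chain_integral A \<eta> (SOME c. c \<in> h)"


section \<open>Closed measures, rotation vectors and Mather measures\<close>

definition tangent_borel ::
    "('a::t2_space, 'e::euclidean_space) chart set \<Rightarrow> ('a \<times> ('a, 'e) tvec) measure" where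
  "tangent_borel A = sigma (tangent_bundle A) {W. openin (tangent_topology A) W}"

text \<open>The metric only enters through the first momentum; on a compact manifold, the set of
  measures does not depend on it.\<close>

definition closed_measures ::
    "('a::t2_space, 'e::euclidean_space) chart set \<Rightarrow>
     ('a \<Rightarrow> ('a, 'e) tvec \<Rightarrow> ('a, 'e) tvec \<Rightarrow> real) \<Rightarrow> ('a \<times> ('a, 'e) tvec) measure set" where
  "closed_measures A g = {\<mu>.
     prob_space \<mu> \<and> sets \<mu> = sets (tangent_borel A) \<and>
     (\<integral>\<^sup>+ (x, v). ennreal (sqrt (g x v v)) \<partial>\<mu>) < \<infinity> \<and>
     (\<forall>f. manifold_Ck A 1 UNIV f \<longrightarrow> (LINT (x, v)|\<mu>. differential A f x v) = 0)}"

text \<open>\<open>has_rotation_vector A \<mu> h\<close> expresses that \<open>\<rho>(\<mu>) = h\<close>.\<close>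

definition has_rotation_vector ::
    "('a::t2_space, 'e::euclidean_space) chart set \<Rightarrow> ('a \<times> ('a, 'e) tvec) measure \<Rightarrow>
     'a real_chain set \<Rightarrow> bool" where
  "has_rotation_vector A \<mu> h \<longleftrightarrow> h \<in> H1 \<and>
     (\<forall>\<eta>. closed_1form A \<eta> \<longrightarrow> pairing A \<eta> h = (LINT (x, v)|\<mu>. \<eta> x v))"

definition measures_with_rotation ::
    "('a::t2_space, 'e::euclidean_space) chart set \<Rightarrow>
     ('a \<Rightarrow> ('a, 'e) tvec \<Rightarrow> ('a, 'e) tvec \<Rightarrow> real) \<Rightarrow> 'a real_chain set \<Rightarrow>
     ('a \<times> ('a, 'e) tvec) measure set" where
  "measures_with_rotation A g h = {\<mu> \<in> closed_measures A g. has_rotation_vector A \<mu> h}"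

definition lagrangian ::
    "('a \<Rightarrow> ('a, 'e) tvec \<Rightarrow> ('a, 'e) tvec \<Rightarrow> real) \<Rightarrow> 'a \<times> ('a, 'e) tvec \<Rightarrow> real" where
  "lagrangian g = (\<lambda>(x, v). g x v v / 2)"

text \<open>The action may be infinite, hence the extended nonnegative integral. The infimum below is
  a finite minimum.\<close>

definition action ::
    "('a \<Rightarrow> ('a, 'e) tvec \<Rightarrow> ('a, 'e) tvec \<Rightarrow> real) \<Rightarrow> ('a \<times> ('a, 'e) tvec) measure \<Rightarrow> ennreal"
  where
  "action g \<mu> = (\<integral>\<^sup>+ z. ennreal (lagrangian g z) \<partial>\<mu>)"

definition mather_beta ::
    "('a::t2_space, 'e::euclidean_space) chart set \<Rightarrow>
     ('a \<Rightarrow> ('a, 'e) tvec \<Rightarrow> ('a, 'e) tvec \<Rightarrow> real) \<Rightarrow> 'a real_chain set \<Rightarrow> real" where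
  "mather_beta A g h = enn2real (INF \<mu>\<in>measures_with_rotation A g h. action g \<mu>)"

definition mather_measures ::
    "('a::t2_space, 'e::euclidean_space) chart set \<Rightarrow>
     ('a \<Rightarrow> ('a, 'e) tvec \<Rightarrow> ('a, 'e) tvec \<Rightarrow> real) \<Rightarrow> 'a real_chain set \<Rightarrow>
     ('a \<times> ('a, 'e) tvec) measure set" where
  "mather_measures A g h =
     {\<mu> \<in> measures_with_rotation A g h. action g \<mu> = ennreal (mather_beta A g h)}"

definition measure_supp ::
    "('a::t2_space, 'e::euclidean_space) chart set \<Rightarrow> ('a \<times> ('a, 'e) tvec) measure \<Rightarrow>
     ('a \<times> ('a, 'e) tvec) set" where
  "measure_supp A \<mu> = {z \<in> tangent_bundle A.
     \<forall>W. openin (tangent_topology A) W \<and> z \<in> W \<longrightarrow> emeasure \<mu> W > 0}"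

definition mather_set ::
    "('a::t2_space, 'e::euclidean_space) chart set \<Rightarrow>
     ('a \<Rightarrow> ('a, 'e) tvec \<Rightarrow> ('a, 'e) tvec \<Rightarrow> real) \<Rightarrow> 'a real_chain set \<Rightarrow>
     ('a \<times> ('a, 'e) tvec) set" where
  "mather_set A g h = (\<Union>\<mu>\<in>mather_measures A g h. measure_supp A \<mu>)"

definition projected_mather_set ::
    "('a::t2_space, 'e::euclidean_space) chart set \<Rightarrow>
     ('a \<Rightarrow> ('a, 'e) tvec \<Rightarrow> ('a, 'e) tvec \<Rightarrow> real) \<Rightarrow> 'a real_chain set \<Rightarrow> 'a set" where
  "projected_mather_set A g h = fst ` mather_set A g h"

text \<open>The supremum is attained, since the unit sphere bundle is compact and nonempty.\<close>

definition metric_ratio ::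
    "('a::t2_space, 'e::euclidean_space) chart set \<Rightarrow>
     ('a \<Rightarrow> ('a, 'e) tvec \<Rightarrow> ('a, 'e) tvec \<Rightarrow> real) \<Rightarrow>
     ('a \<Rightarrow> ('a, 'e) tvec \<Rightarrow> ('a, 'e) tvec \<Rightarrow> real) \<Rightarrow> real" where
  "metric_ratio A g1 g2 = Sup {g2 x v v | x v. v \<in> tangent_space A x \<and> g1 x v v = 1}"

end

theory Submission
  imports Defs
begin

text \<open>All estimates come from the pointwise bound of \<open>g2\<close> by \<open>metric_ratio A g1 g2\<close> times \<open>g1\<close>; in the case of
  equality of the \<open>\<beta>\<close>-functions the nonnegative continuous difference of the two sides has integral 0
  against every minimizer for \<open>g1\<close>, hence vanishes on its support. The converse needs a minimizer to exist.
  Weighting the measures of a minimizing sequence by \<open>1 + g(v, v)\<close> and compactifying the fibres to closed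
  balls, one gets a limit that respects all functions of linear growth; weak compactness on a compact subset
  of a Euclidean space is pulled back from Helly's theorem on the line by a Borel injection into the line whose
  inverse is uniformly continuous.

  In the conformal case one also needs that a minimizer of nonzero class does not charge the zero section.
  A reparametrization argument shows that its speed is almost everywhere constant. The constant is not 0,
  because a nonzero class pairs nontrivially with some closed 1-form: a real singular cocycle that separates
  the class from 0 has local potentials on chart balls, whose differences are locally constant, and
  subtracting their mean with respect to a smooth partition of unity turns them into smooth local primitives
  of a closed 1-form that represents the cocycle.\<close>

subsection \<open>Functions of class C^k\<close>

text \<open>The tangent bundle is not compact, and the constraints on a measure are integrals of
  unbounded functions, so plain weak convergence can lose them. With the weight
  \<open>1 + g(v, v)\<close> the integral of \<open>q\<close> becomes that of
  \<open>q / (1 + g(v, v))\<close>, which tends to 0 at infinity because differentials and 1-forms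
  grow only linearly. The action grows quadratically: part of its weighted mass may end on the
  sphere at infinity, so only one inequality survives for it, the one that a minimum needs. A
  nonzero class matters in the conformal case because on a zero vector \<open>g2 = m g1\<close> says
  nothing about the conformal factor. That almost every velocity is nonzero would not suffice, since
  the support is closed and might still meet the zero section; the constant speed gives a positive
  lower bound, and such a bound passes to the support. The cocycle is produced by linear algebra on
  an infinite-dimensional chain space and carries no regularity, so the smoothness of the closed
  form must come entirely from the partition of unity.\<close>

lemma Ck_on_cong:
  assumes "open S" "\<And>x. x \<in> S \<Longrightarrow> f x = g x" "Ck_on k S f"
  shows "Ck_on k S g"
  using assms(2,3)
proof (induction k arbitrary: f g)
  case 0
  then show ?case using continuous_on_cong[of S S f g] by simp
next
  case (Suc k)
  have d: "(g has_derivative frechet_derivative f (at x)) (at x)" if x: "x \<in> S" for x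
  proof (rule has_derivative_transform_within_open[OF _ assms(1) x])
    show "(f has_derivative frechet_derivative f (at x)) (at x)"
      using Suc.prems(2) x by (simp add: frechet_derivative_works[symmetric])
  qed (use Suc.prems(1) in auto)
  have "frechet_derivative g (at x) = frechet_derivative f (at x)" if "x \<in> S" for x
    using frechet_derivative_at[OF d[OF that]] by simp
  moreover have "Ck_on k S (\<lambda>x. frechet_derivative g (at x) u)" for u
  proof (rule Suc.IH)
    show "Ck_on k S (\<lambda>x. frechet_derivative f (at x) u)" using Suc.prems(2) by simp
  qed (use calculation in simp)
  moreover have "g differentiable (at x)" if "x \<in> S" for x
    using d[OF that] by (auto simp: differentiable_def)
  ultimately show ?case by simp
qed

text \<open>Frees the inductions below from the choice operator in
  \<open>frechet_derivative\<close>: a derivative \<open>D\<close> found by the usual rules may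
  stand for it.\<close>

lemma Ck_on_Suc_deriv:
  assumes "\<And>x. x \<in> S \<Longrightarrow> (f has_derivative D x) (at x)"
    and "\<And>u. Ck_on k S (\<lambda>x. D x u)" and "open S"
  shows "Ck_on (Suc k) S f"
  unfolding Ck_on.simps
proof (intro conjI ballI allI)
  fix x assume "x \<in> S" then show "f differentiable at x"
    using assms(1) unfolding differentiable_def by blast
next
  fix u
  show "Ck_on k S (\<lambda>x. frechet_derivative f (at x) u)"
  proof (rule Ck_on_cong[OF assms(3) _ assms(2)[of u]])
    fix x assume "x \<in> S"
    from frechet_derivative_at[OF assms(1)[OF this]]
    show "D x u = frechet_derivative f (at x) u" by simp
  qed
qed

lemma Ck_on_subset: "Ck_on k S f \<Longrightarrow> T \<subseteq> S \<Longrightarrow> Ck_on k T f"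
  by (induction k arbitrary: f) (auto intro: continuous_on_subset)

lemma Ck_on_Suc_imp: "Ck_on (Suc k) S f \<Longrightarrow> Ck_on k S f"
proof (induction k arbitrary: f)
  case 0
  then show ?case
    by (auto intro!: continuous_at_imp_continuous_on differentiable_imp_continuous_within)
qed auto

lemma Ck_on_le: "Ck_on k S f \<Longrightarrow> j \<le> k \<Longrightarrow> Ck_on j S f"
  by (induction k) (auto simp: le_Suc_eq dest: Ck_on_Suc_imp simp del: Ck_on.simps)

lemma Ck_on_continuous: "Ck_on k S f \<Longrightarrow> continuous_on S f"
  using Ck_on_le[of k S f 0] by simp

lemma Ck_on_local:
  assumes "\<And>x. x \<in> S \<Longrightarrow> \<exists>T. open T \<and> x \<in> T \<and> Ck_on k T f"
  shows "Ck_on k S f"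
  using assms
proof (induction k arbitrary: f)
  case 0
  then show ?case
    by (auto intro!: continuous_at_imp_continuous_on simp: continuous_on_eq_continuous_at) 
       (metis continuous_on_eq_continuous_at)
next
  case (Suc k)
  then show ?case
    by (auto intro!: Suc.IH) (meson+)
qed

lemma Ck_on_has_derivative:
  "Ck_on (Suc k) S f \<Longrightarrow> x \<in> S \<Longrightarrow> (f has_derivative frechet_derivative f (at x)) (at x)"
  by (auto simp: frechet_derivative_works[symmetric])

lemma Ck_on_const: "Ck_on k S (\<lambda>x. c)"
  by (induction k arbitrary: c) (auto simp: frechet_derivative_const)

lemma Ck_on_bounded_linear:
  assumes "bounded_linear L" "open S"
  shows "Ck_on k S L"
proof (cases k)
  case 0
  then show ?thesis using assms by (simp add: linear_continuous_on)
next
  case (Suc j)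
  have "Ck_on (Suc j) S L"
    by (rule Ck_on_Suc_deriv[where D = "\<lambda>x. L"])
       (auto intro: bounded_linear.has_derivative[OF assms(1) has_derivative_ident, unfolded o_def] Ck_on_const assms)
  with Suc show ?thesis by simp
qed

lemma Ck_on_linear_compose:
  assumes "bounded_linear L" "open S" "Ck_on k S f"
  shows "Ck_on k S (\<lambda>x. L (f x))"
  using assms(3)
proof (induction k arbitrary: f)
  case 0
  then show ?case using assms(1)
    by (simp add: bounded_linear.continuous_on)
next
  case (Suc k)
  show ?case
  proof (rule Ck_on_Suc_deriv[OF _ _ assms(2)])
    show "((\<lambda>x. L (f x)) has_derivative (\<lambda>u. L (frechet_derivative f (at x) u))) (at x)" if "x \<in> S" for x
      by (rule bounded_linear.has_derivative[OF assms(1) Ck_on_has_derivative[OF Suc.prems that]])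
    show "Ck_on k S (\<lambda>x. L (frechet_derivative f (at x) u))" for u
      using Suc.prems by (intro Suc.IH) auto
  qed
qed

lemma Ck_on_add:
  assumes "open S" "Ck_on k S f" "Ck_on k S g"
  shows "Ck_on k S (\<lambda>x. f x + g x)"
  using assms(2,3)
proof (induction k arbitrary: f g)
  case 0
  then show ?case by (simp add: continuous_on_add)
next
  case (Suc k)
  show ?case
  proof (rule Ck_on_Suc_deriv[OF _ _ assms(1)])
    show "((\<lambda>x. f x + g x) has_derivative (\<lambda>u. frechet_derivative f (at x) u + frechet_derivative g (at x) u)) (at x)" if "x \<in> S" for x
      using Suc.prems that by (intro has_derivative_add Ck_on_has_derivative)
    show "Ck_on k S (\<lambda>x. frechet_derivative f (at x) u + frechet_derivative g (at x) u)" for u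
      using Suc.prems by (intro Suc.IH) auto
  qed
qed

lemma Ck_on_sum:
  assumes "open S" "\<And>i. i \<in> I \<Longrightarrow> Ck_on k S (f i)"
  shows "Ck_on k S (\<lambda>x. \<Sum>i\<in>I. f i x)"
  using assms by (induction I rule: infinite_finite_induct) (auto intro: Ck_on_const Ck_on_add)

lemma Ck_on_mult:
  fixes f g :: "'e::euclidean_space \<Rightarrow> real"
  assumes "open S" "Ck_on k S f" "Ck_on k S g"
  shows "Ck_on k S (\<lambda>x. f x * g x)"
  using assms(2,3)
proof (induction k arbitrary: f g)
  case 0
  then show ?case by (simp add: continuous_on_mult)
next
  case (Suc k)
  show ?case
  proof (rule Ck_on_Suc_deriv[OF _ _ assms(1)])
    show "((\<lambda>x. f x * g x) has_derivative (\<lambda>u. f x * frechet_derivative g (at x) u + frechet_derivative f (at x) u * g x)) (at x)" if "x \<in> S" for x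
      using Suc.prems that by (intro has_derivative_mult Ck_on_has_derivative)
    have "Ck_on k S f" "Ck_on k S g" using Suc.prems by (auto dest: Ck_on_Suc_imp simp del: Ck_on.simps)
    then show "Ck_on k S (\<lambda>x. f x * frechet_derivative g (at x) u + frechet_derivative f (at x) u * g x)" for u
      using Suc.prems by (intro Ck_on_add assms Suc.IH) auto
  qed
qed

lemma Ck_on_diff:
  fixes f g :: "'e::euclidean_space \<Rightarrow> real"
  assumes "open S" "Ck_on k S f" "Ck_on k S g"
  shows "Ck_on k S (\<lambda>x. f x - g x)"
  using Ck_on_add[OF assms(1,2) Ck_on_mult[OF assms(1) Ck_on_const[of k S "-1"] assms(3)]] by simp

text \<open>Expansion in the standard basis reduces continuity or smoothness in base point and
  vector jointly to that of finitely many coefficients.\<close>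

lemma linear_euclidean_sum:
  fixes L :: "'e::euclidean_space \<Rightarrow> 'v::real_vector"
  assumes "linear L"
  shows "L u = (\<Sum>b\<in>Basis. (u \<bullet> b) *\<^sub>R L b)"
  by (metis (no_types, lifting) assms euclidean_representation linear_scale linear_sum sum.cong)

text \<open>With the outer derivative expanded in the basis, the chain rule yields sums of products
  of coordinates of the derivative of \<open>g\<close> and of functions that are again compositions
  with \<open>g\<close>. Hence the induction varies \<open>f\<close> and keeps \<open>g\<close>
  fixed.\<close>

lemma Ck_on_compose:
  fixes f :: "'e2::euclidean_space \<Rightarrow> real" and g :: "'e::euclidean_space \<Rightarrow> 'e2"
  assumes "open S" "open T" "g ` S \<subseteq> T" "Ck_on k T f" "Ck_on k S g"
  shows "Ck_on k S (\<lambda>x. f (g x))"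
  using assms(4,5)
proof (induction k arbitrary: f)
  case 0
  then show ?case using assms(3) by (auto intro: continuous_on_compose2)
next
  case (Suc k)
  have gk: "Ck_on k S g" using Suc.prems by (auto dest: Ck_on_Suc_imp simp del: Ck_on.simps)
  let ?D = "\<lambda>x u. \<Sum>b\<in>Basis. (frechet_derivative g (at x) u \<bullet> b) * frechet_derivative f (at (g x)) b"
  show ?case
  proof (rule Ck_on_Suc_deriv[OF _ _ assms(1)])
    fix x assume x: "x \<in> S"
    then have gx: "g x \<in> T" using assms(3) by blast
    note df = Ck_on_has_derivative[OF Suc.prems(1) gx]
    have *: "((\<lambda>x. f (g x)) has_derivative (\<lambda>u. frechet_derivative f (at (g x)) (frechet_derivative g (at x) u))) (at x)"
      by (rule has_derivative_compose[OF Ck_on_has_derivative[OF Suc.prems(2) x] df])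
    have "frechet_derivative f (at (g x)) v = (\<Sum>b\<in>Basis. (v \<bullet> b) * frechet_derivative f (at (g x)) b)" for v
      using linear_euclidean_sum[OF has_derivative_linear[OF df], of v] by simp
    then show "((\<lambda>x. f (g x)) has_derivative ?D x) (at x)"
      by (intro has_derivative_eq_rhs[OF *] ext)
  next
    fix u
    show "Ck_on k S (\<lambda>x. ?D x u)"
    proof (intro Ck_on_sum Ck_on_mult assms)
      fix b :: 'e2
      show "Ck_on k S (\<lambda>x. frechet_derivative g (at x) u \<bullet> b)"
        using Suc.prems by (intro Ck_on_linear_compose[OF bounded_linear_inner_left assms(1)]) auto
      show "Ck_on k S (\<lambda>x. frechet_derivative f (at (g x)) b)"
        using Suc.prems gk by (intro Suc.IH) auto
    qed
  qed
qed

section \<open>Smooth functions of one real variable\<close>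

lemma Ck_on_real_deriv:
  fixes f :: "real \<Rightarrow> real"
  assumes "open S" "\<And>x. x \<in> S \<Longrightarrow> (f has_real_derivative f' x) (at x)" "Ck_on k S f'"
  shows "Ck_on (Suc k) S f"
proof (rule Ck_on_Suc_deriv[OF _ _ assms(1)])
  show "(f has_derivative (*) (f' x)) (at x)" if "x \<in> S" for x
    using assms(2)[OF that] by (simp add: has_field_derivative_def)
  show "Ck_on k S (\<lambda>x. f' x * u)" for u
    using assms(1,3) by (intro Ck_on_mult Ck_on_const)
qed

lemma Ck_on_inverse: "Ck_on k (- {0}) (inverse :: real \<Rightarrow> real)"
proof (induction k)
  case 0
  then show ?case by (auto intro!: continuous_intros)
next
  case (Suc k)
  show ?case
  proof (rule Ck_on_real_deriv)
    show "(inverse has_real_derivative (-1) * (inverse x * inverse x)) (at x)" if "x \<in> -{0}" for x :: real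
      using DERIV_inverse[of x UNIV] that by (auto simp: power2_eq_square)
    show "Ck_on k (- {0}) (\<lambda>x::real. (-1) * (inverse x * inverse x))"
      using Suc by (intro Ck_on_mult Ck_on_const) auto
  qed auto
qed

text \<open>For \<open>n = 0\<close> this is the classical flat function exp(-1/x). The powers of
  \<open>inverse x\<close> close the family under differentiation up to linear combinations, so one
  induction settles all orders.\<close>

definition bump_exp :: "nat \<Rightarrow> real \<Rightarrow> real" where
  "bump_exp n x = (if x > 0 then inverse x ^ n * exp (- inverse x) else 0)"

lemma bump_exp_at_0: "(bump_exp n \<longlongrightarrow> 0) (at 0)"
proof -
  have "((\<lambda>x::real. inverse x ^ n * exp (- inverse x)) \<longlongrightarrow> 0) (at_right 0)"
  proof -
    have "((\<lambda>y::real. y ^ n / exp y) \<longlongrightarrow> 0) at_top"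
      by (rule tendsto_power_div_exp_0)
    from filterlim_compose[OF this filterlim_inverse_at_top_right]
    show ?thesis by (simp add: exp_minus divide_inverse)
  qed
  then have "(bump_exp n \<longlongrightarrow> 0) (at_right 0)"
    by (rule Lim_transform_eventually) (auto simp: bump_exp_def eventually_at_right_less eventually_mono[OF eventually_at_right_less])
  moreover have "(bump_exp n \<longlongrightarrow> 0) (at_left 0)"
    by (rule Lim_transform_eventually[of "\<lambda>_. 0"])
       (auto simp: bump_exp_def eventually_at_filter)
  ultimately show ?thesis by (simp add: filterlim_at_split)
qed

lemma bump_exp_deriv:
  "(bump_exp n has_real_derivative bump_exp (n + 2) x - of_nat n * bump_exp (Suc n) x) (at x)"
proof -
  consider "x > 0" | "x < 0" | "x = 0" by linarith
  then show ?thesis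
  proof cases
    case 1
    have i: "(inverse has_real_derivative - (inverse x * inverse x)) (at x)"
      using DERIV_inverse[of x UNIV] 1 by (simp add: power2_eq_square)
    have e: "((\<lambda>x. exp (- inverse x)) has_real_derivative exp (- inverse x) * (inverse x * inverse x)) (at x)"
      using DERIV_fun_exp[OF DERIV_minus[OF i]] by simp
    have "((\<lambda>x. inverse x ^ n * exp (- inverse x)) has_real_derivative
       bump_exp (n + 2) x - of_nat n * bump_exp (Suc n) x) (at x)"
      by (rule DERIV_cong[OF DERIV_mult[OF DERIV_power[OF i, of n] e]])
         (use 1 in \<open>cases n; simp add: bump_exp_def algebra_simps\<close>)
    then show ?thesis
      by (rule has_field_derivative_transform_within_open[of _ _ _ "{0<..}"]) (use 1 in \<open>auto simp: bump_exp_def\<close>)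
  next
    case 2
    have "((\<lambda>x. 0) has_real_derivative 0) (at x)" by simp
    then have "(bump_exp n has_real_derivative 0) (at x)"
      by (rule has_field_derivative_transform_within_open[of _ _ _ "{..<0}"]) (use 2 in \<open>auto simp: bump_exp_def\<close>)
    then show ?thesis using 2 by (simp add: bump_exp_def)
  next
    case 3
    \<comment> \<open>The difference quotient of member \<open>n\<close> at 0 is member
      \<open>n + 1\<close>, whose limit is already known.\<close>
    have "((\<lambda>y. (bump_exp n y - bump_exp n 0) / (y - 0)) \<longlongrightarrow> 0) (at 0)"
      by (rule Lim_transform_eventually[OF bump_exp_at_0[of "Suc n"]])
         (auto simp: bump_exp_def eventually_at_filter field_simps)
    then have "(bump_exp n has_real_derivative 0) (at 0)"
      by (simp add: has_field_derivative_iff)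
    then show ?thesis using 3 by (simp add: bump_exp_def)
  qed
qed

lemma Ck_on_bump_exp: "Ck_on k UNIV (bump_exp n)"
proof (induction k arbitrary: n)
  case 0
  then show ?case
    by (auto intro!: continuous_at_imp_continuous_on intro: DERIV_isCont[OF bump_exp_deriv])
next
  case (Suc k)
  show ?case
    by (rule Ck_on_real_deriv[OF _ bump_exp_deriv])
       (auto intro!: Ck_on_diff Ck_on_mult Ck_on_const Suc)
qed

lemma Ck_on_dist_square:
  fixes z :: "'e::euclidean_space"
  shows "Ck_on k UNIV (\<lambda>x. (norm (x - z))\<^sup>2)"
proof -
  have "(norm (x - z))\<^sup>2 = (\<Sum>b\<in>Basis. (x \<bullet> b - z \<bullet> b) * (x \<bullet> b - z \<bullet> b))" for x
    by (subst power2_norm_eq_inner, subst euclidean_inner) (simp add: inner_diff_left)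
  moreover have "Ck_on k UNIV (\<lambda>x. \<Sum>b\<in>Basis. (x \<bullet> b - z \<bullet> b) * (x \<bullet> b - z \<bullet> b))"
    by (intro Ck_on_sum Ck_on_mult Ck_on_diff Ck_on_const Ck_on_bounded_linear bounded_linear_inner_left open_UNIV)
  ultimately show ?thesis by simp
qed

text \<open>The mean value theorem is used twice: along \<open>u\<close> for the increment in the
  direction \<open>w\<close>, then along \<open>w\<close> for the derivative in the direction
  \<open>u\<close>. The second difference is symmetric in \<open>u\<close> and \<open>w\<close>; the
  right-hand side remembers the order of differentiation.\<close>

lemma second_difference_mean_value:
  fixes F :: "'e::euclidean_space \<Rightarrow> real"
  assumes F: "Ck_on 2 S F" and t: "0 < t"
    and sub: "\<And>a b. 0 \<le> a \<Longrightarrow> a \<le> t \<Longrightarrow> 0 \<le> b \<Longrightarrow> b \<le> t \<Longrightarrow> p + a *\<^sub>R u + b *\<^sub>R w \<in> S"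
  obtains a b where "0 < a" "a < t" "0 < b" "b < t"
    "F (p + t *\<^sub>R u + t *\<^sub>R w) - F (p + t *\<^sub>R u) - F (p + t *\<^sub>R w) + F p =
     t * t * frechet_derivative (\<lambda>q. frechet_derivative F (at q) u) (at (p + a *\<^sub>R u + b *\<^sub>R w)) w"
proof -
  let ?A = "\<lambda>q. frechet_derivative F (at q) u"
  have dF: "(F has_derivative frechet_derivative F (at q)) (at q)" if "q \<in> S" for q
    using F that by (auto simp: numeral_2_eq_2 frechet_derivative_works[symmetric])
  have dA: "(?A has_derivative frechet_derivative ?A (at q)) (at q)" if "q \<in> S" for q
    using F that by (auto simp: numeral_2_eq_2 frechet_derivative_works[symmetric])
  have d1: "((\<lambda>a. F (p + a *\<^sub>R u + b *\<^sub>R w)) has_real_derivative ?A (p + a *\<^sub>R u + b *\<^sub>R w)) (at a)"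
    if "p + a *\<^sub>R u + b *\<^sub>R w \<in> S" for a b
  proof -
    have "((\<lambda>a. p + a *\<^sub>R u + b *\<^sub>R w) has_derivative (\<lambda>h. h *\<^sub>R u)) (at a)"
      by (auto intro!: derivative_eq_intros)
    from has_derivative_compose[OF this dF[OF that]]
    show ?thesis unfolding has_field_derivative_def
      by (rule has_derivative_eq_rhs)
         (auto simp: fun_eq_iff linear_scale[OF has_derivative_linear[OF dF[OF that]]])
  qed
  have d2: "((\<lambda>b. ?A (p + a *\<^sub>R u + b *\<^sub>R w)) has_real_derivative
      frechet_derivative ?A (at (p + a *\<^sub>R u + b *\<^sub>R w)) w) (at b)"
    if "p + a *\<^sub>R u + b *\<^sub>R w \<in> S" for a b
  proof -
    have "((\<lambda>b. p + a *\<^sub>R u + b *\<^sub>R w) has_derivative (\<lambda>h. h *\<^sub>R w)) (at b)"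
      by (auto intro!: derivative_eq_intros)
    from has_derivative_compose[OF this dA[OF that]]
    show ?thesis unfolding has_field_derivative_def
      by (rule has_derivative_eq_rhs)
         (auto simp: fun_eq_iff linear_scale[OF has_derivative_linear[OF dA[OF that]]])
  qed
  let ?g = "\<lambda>a. F (p + a *\<^sub>R u + t *\<^sub>R w) - F (p + a *\<^sub>R u + 0 *\<^sub>R w)"
  have "\<exists>a>0. a < t \<and> ?g t - ?g 0 = (t - 0) * (?A (p + a *\<^sub>R u + t *\<^sub>R w) - ?A (p + a *\<^sub>R u + 0 *\<^sub>R w))"
    using t by (intro MVT2 DERIV_diff d1 sub) auto
  then obtain a where a: "0 < a" "a < t"
    "?g t - ?g 0 = t * (?A (p + a *\<^sub>R u + t *\<^sub>R w) - ?A (p + a *\<^sub>R u + 0 *\<^sub>R w))" by auto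
  have "\<exists>b>0. b < t \<and> ?A (p + a *\<^sub>R u + t *\<^sub>R w) - ?A (p + a *\<^sub>R u + 0 *\<^sub>R w) =
     (t - 0) * frechet_derivative ?A (at (p + a *\<^sub>R u + b *\<^sub>R w)) w"
    using t a by (intro MVT2 d2 sub) auto
  then obtain b where b: "0 < b" "b < t"
    "?A (p + a *\<^sub>R u + t *\<^sub>R w) - ?A (p + a *\<^sub>R u + 0 *\<^sub>R w) =
     t * frechet_derivative ?A (at (p + a *\<^sub>R u + b *\<^sub>R w)) w" by auto
  show ?thesis
    by (rule that[OF a(1,2) b(1,2)]) (use a(3) b(3) in \<open>simp add: algebra_simps\<close>)
qed

lemma symmetric_second_derivative:
  fixes F :: "'e::euclidean_space \<Rightarrow> real"
  assumes F: "Ck_on 2 S F" and S: "open S" "p \<in> S"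
  shows "frechet_derivative (\<lambda>q. frechet_derivative F (at q) u) (at p) w =
         frechet_derivative (\<lambda>q. frechet_derivative F (at q) w) (at p) u"
    (is "?H u w p = ?H w u p")
proof (rule ccontr)
  assume ne: "?H u w p \<noteq> ?H w u p"
  \<comment> \<open>Half the gap: if both mixed derivatives stay within \<open>e\<close> of their
    values at \<open>p\<close>, they cannot coincide.\<close>
  define e where "e = \<bar>?H u w p - ?H w u p\<bar> / 2"
  have e: "e > 0" using ne by (simp add: e_def)
  have cont: "continuous_on S (\<lambda>q. ?H u w q)" for u w
    using F by (simp add: numeral_2_eq_2)
  have "\<exists>d>0. \<forall>q. dist q p < d \<longrightarrow> q \<in> S \<and> dist (?H u w q) (?H u w p) < e" for u w
  proof -
    obtain d1 where d1: "d1 > 0" "ball p d1 \<subseteq> S" using S openE by blast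
    obtain d2 where d2: "d2 > 0" "\<forall>q\<in>S. dist q p < d2 \<longrightarrow> dist (?H u w q) (?H u w p) < e"
      using cont[of u w] S e unfolding continuous_on_iff by blast
    show ?thesis
      by (rule exI[of _ "min d1 d2"]) (use d1 d2 in \<open>auto simp: subset_eq dist_commute\<close>)
  qed
  then obtain d1 d2 where d: "d1 > 0" "\<And>q. dist q p < d1 \<Longrightarrow> q \<in> S \<and> dist (?H u w q) (?H u w p) < e"
     "d2 > 0" "\<And>q. dist q p < d2 \<Longrightarrow> dist (?H w u q) (?H w u p) < e" by metis
  \<comment> \<open>Small enough to keep the whole parallelogram within \<open>min d1 d2\<close> of
    \<open>p\<close>; the summand 1 keeps the denominator positive when both vectors vanish.\<close>
  define t where "t = min d1 d2 / (norm u + norm w + 1)"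
  have t: "t > 0" unfolding t_def using d by (intro divide_pos_pos) (auto intro: add_nonneg_pos)
  have near: "dist (p + a *\<^sub>R u + b *\<^sub>R w) p < min d1 d2" if "0 \<le> a" "a \<le> t" "0 \<le> b" "b \<le> t" for a b
  proof -
    have "dist (p + a *\<^sub>R u + b *\<^sub>R w) p \<le> a * norm u + b * norm w"
      using norm_triangle_ineq[of "a *\<^sub>R u" "b *\<^sub>R w"] that by (simp add: dist_norm algebra_simps)
    also have "\<dots> \<le> t * norm u + t * norm w"
      using that by (intro add_mono mult_right_mono) auto
    also have "\<dots> < t * (norm u + norm w + 1)" using t by (simp add: algebra_simps)
    also have "\<dots> = min d1 d2"
      unfolding t_def using norm_ge_zero[of u] norm_ge_zero[of w]
      by (smt (verit, best) nonzero_eq_divide_eq)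
    finally show ?thesis .
  qed
  have near': "p + (a *\<^sub>R u + b *\<^sub>R w) \<in> S" if "0 \<le> a" "a \<le> t" "0 \<le> b" "b \<le> t" for a b
    using near[OF that] d(2) by (simp add: add_ac)
  obtain a b where ab: "0 < a" "a < t" "0 < b" "b < t"
    "F (p + t *\<^sub>R u + t *\<^sub>R w) - F (p + t *\<^sub>R u) - F (p + t *\<^sub>R w) + F p =
     t * t * ?H u w (p + a *\<^sub>R u + b *\<^sub>R w)"
    by (rule second_difference_mean_value[OF F t, of p u w]) (use near d(2) in auto)
  obtain a' b' where ab': "0 < a'" "a' < t" "0 < b'" "b' < t"
    "F (p + t *\<^sub>R w + t *\<^sub>R u) - F (p + t *\<^sub>R w) - F (p + t *\<^sub>R u) + F p =
     t * t * ?H w u (p + a' *\<^sub>R w + b' *\<^sub>R u)"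
  proof (rule second_difference_mean_value[OF F t, of p w u])
    show "p + a *\<^sub>R w + b *\<^sub>R u \<in> S" if "0 \<le> a" "a \<le> t" "0 \<le> b" "b \<le> t" for a b
      using near'[of b a] that by (simp add: add_ac)
  qed blast
  have "?H u w (p + a *\<^sub>R u + b *\<^sub>R w) = ?H w u (p + a' *\<^sub>R w + b' *\<^sub>R u)"
  proof -
    have comm: "p + t *\<^sub>R w + t *\<^sub>R u = p + t *\<^sub>R u + t *\<^sub>R w" by simp
    have "t * t * ?H u w (p + a *\<^sub>R u + b *\<^sub>R w) =
        t * t * ?H w u (p + a' *\<^sub>R w + b' *\<^sub>R u)"
      using ab(5) ab'(5)[unfolded comm] by linarith
    then show ?thesis using t by simp
  qed
  moreover have "dist (?H u w (p + a *\<^sub>R u + b *\<^sub>R w)) (?H u w p) < e"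
    using near[of a b] ab d(2) by auto
  moreover have "dist (?H w u (p + a' *\<^sub>R w + b' *\<^sub>R u)) (?H w u p) < e"
    using near[of b' a'] ab' d(4) by (auto simp: add_ac)
  ultimately show False unfolding e_def dist_real_def by argo
qed

subsection \<open>Weak compactness of measures on a compact set\<close>

text \<open>The digits are 0 and 1 in base 3: the tail after the first differing digit is too small to
  compensate for it, so close codes agree on a long initial segment.\<close>

definition ternary_code :: "(nat \<Rightarrow> 'b set) \<Rightarrow> 'b \<Rightarrow> real" where
  "ternary_code B x = (suminf (\<lambda>m. indicator (B m) x * (1/3) ^ m :: real))"

lemma summable_ternary_code: "summable (\<lambda>m. indicator (B m) x * (1/3) ^ m :: real)"
  by (rule summable_comparison_test'[of "\<lambda>m. (1/3)^m" 0]) (auto simp: indicator_def)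

lemma ternary_code_bounds: "0 \<le> ternary_code B x" "ternary_code B x \<le> 3/2"
proof -
  show "0 \<le> ternary_code B x"
    unfolding ternary_code_def by (intro suminf_nonneg summable_ternary_code) auto
  have "ternary_code B x \<le> (suminf (\<lambda>m. (1/3) ^ m))"
    unfolding ternary_code_def
    by (intro suminf_le summable_ternary_code) (auto simp: indicator_def)
  also have "\<dots> = 3/2" by (simp add: suminf_geometric)
  finally show "ternary_code B x \<le> 3/2" .
qed

lemma ternary_code_separates:
  assumes m: "x \<in> B m" "y \<notin> B m" and eq: "\<And>j. j < m \<Longrightarrow> x \<in> B j \<longleftrightarrow> y \<in> B j"
  shows "ternary_code B x - ternary_code B y \<ge> (1/3) ^ m / 2"
proof -
  have split: "ternary_code B z = (suminf (\<lambda>n. indicator (B (n + Suc m)) z * (1/3) ^ (n + Suc m)))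
      + (\<Sum>j<m. indicator (B j) z * (1/3) ^ j) + indicator (B m) z * (1/3) ^ m" for z
    unfolding ternary_code_def
    by (subst suminf_split_initial_segment[OF summable_ternary_code, of _ _ "Suc m"]) simp
  have "(\<Sum>j<m. indicator (B j) x * (1/3) ^ j) = (\<Sum>j<m. indicator (B j) y * (1/3 :: real) ^ j)"
    using eq by (intro sum.cong) (auto simp: indicator_def)
  moreover have "0 \<le> (suminf (\<lambda>n. indicator (B (n + Suc m)) x * (1/3 :: real) ^ (n + Suc m)))"
    by (intro suminf_nonneg summable_ignore_initial_segment[OF summable_ternary_code]) auto
  moreover have "(suminf (\<lambda>n. indicator (B (n + Suc m)) y * (1/3 :: real) ^ (n + Suc m))) \<le> (1/3)^m / 2"
  proof -
    have s: "(\<lambda>n. (1/3 :: real) ^ (n + Suc m)) sums ((1/3)^m / 2)"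
      using sums_mult2[OF geometric_sums[of "1/3 :: real"], of "(1/3) ^ Suc m"]
      by (simp add: power_add)
    have "(suminf (\<lambda>n. indicator (B (n + Suc m)) y * (1/3 :: real) ^ (n + Suc m))) \<le> (suminf (\<lambda>n. (1/3) ^ (n + Suc m)))"
      by (rule suminf_le[OF _ summable_ignore_initial_segment[OF summable_ternary_code] sums_summable[OF s]])
         (auto simp: indicator_def)
    then show ?thesis using sums_unique[OF s] by simp
  qed
  ultimately show ?thesis
    unfolding split[of x] split[of y] using m by simp
qed

lemma ternary_code_close:
  assumes "\<bar>ternary_code B x - ternary_code B y\<bar> < (1/3) ^ M / 2" and "m \<le> M"
  shows "x \<in> B m \<longleftrightarrow> y \<in> B m"
proof (rule ccontr)
  assume "\<not> (x \<in> B m \<longleftrightarrow> y \<in> B m)"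
  define l where "l = (LEAST j. \<not> (x \<in> B j \<longleftrightarrow> y \<in> B j))"
  have l: "\<not> (x \<in> B l \<longleftrightarrow> y \<in> B l)" "l \<le> m"
    unfolding l_def using \<open>\<not> (x \<in> B m \<longleftrightarrow> y \<in> B m)\<close> by (rule LeastI, rule Least_le)
  have less: "x \<in> B j \<longleftrightarrow> y \<in> B j" if "j < l" for j
    using not_less_Least[of j "\<lambda>j. \<not> (x \<in> B j \<longleftrightarrow> y \<in> B j)"] that unfolding l_def by blast
  have "(1/3 :: real) ^ M \<le> (1/3) ^ l"
    using l assms(2) by (intro power_decreasing) auto
  moreover have "(1/3) ^ l / 2 \<le> \<bar>ternary_code B x - ternary_code B y\<bar>"
  proof (cases "x \<in> B l")
    case True
    then have "(1/3) ^ l / 2 \<le> ternary_code B x - ternary_code B y"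
      using l(1) less by (intro ternary_code_separates) auto
    then show ?thesis by linarith
  next
    case False
    then have "(1/3) ^ l / 2 \<le> ternary_code B y - ternary_code B x"
      using l(1) less by (intro ternary_code_separates) auto
    then show ?thesis by linarith
  qed
  ultimately show False using assms(1) by linarith
qed

lemma ternary_code_measurable [measurable]:
  "(\<And>m. B m \<in> sets N) \<Longrightarrow> ternary_code B \<in> borel_measurable N"
  unfolding ternary_code_def[abs_def]
  by (intro borel_measurable_suminf borel_measurable_times borel_measurable_indicator borel_measurable_const)

text \<open>The code \<open>s\<close> may jump at the boundaries of the basic sets. This is
  harmless: a continuous test function is transported to the line by composition with the continuous
  left inverse \<open>\<phi>\<close>, never with \<open>s\<close>.\<close>

lemma compact_image_of_real_code:
  fixes K :: "'e::euclidean_space set"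
  assumes "compact K"
  obtains s :: "'e \<Rightarrow> real" and \<phi> where "s \<in> borel_measurable borel" "\<And>x. s x \<in> {0..3/2}"
    "continuous_on UNIV \<phi>" "\<And>x. x \<in> K \<Longrightarrow> \<phi> (s x) = x"
proof -
  obtain \<B> :: "'e set set" where \<B>: "countable \<B>" "topological_basis \<B>"
    using ex_countable_basis by blast
  define B where "B = from_nat_into \<B>"
  have ne: "\<B> \<noteq> {}" using topological_basisE[OF \<B>(2) open_UNIV, of undefined] by blast
  have rng: "range B = \<B>" unfolding B_def using \<B>(1) ne by (rule range_from_nat_into[rotated])
  have opn: "open (B m)" for m
    using rng \<B>(2) by (metis rangeI topological_basis_open)
  let ?s = "ternary_code B"
  have unif: "\<exists>\<delta>>0. \<forall>x\<in>K. \<forall>y\<in>K. \<bar>?s x - ?s y\<bar> < \<delta> \<longrightarrow> dist x y < \<epsilon>" if \<epsilon>: "\<epsilon> > 0" for \<epsilon>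
  proof -
    \<comment> \<open>Finitely many basic sets of small diameter cover \<open>K\<close>. If
      \<open>M\<close> bounds their indices, agreement of the digits up to \<open>M\<close> puts two
      points into a common one.\<close>
    define J where "J = {m. \<exists>z. B m \<subseteq> ball z (\<epsilon>/2)}"
    have "K \<subseteq> (\<Union>m\<in>J. B m)"
    proof
      fix x assume "x \<in> K"
      obtain W where "W \<in> \<B>" "x \<in> W" "W \<subseteq> ball x (\<epsilon>/2)"
        using topological_basisE[OF \<B>(2) open_ball, of x x "\<epsilon>/2"] \<epsilon> by auto
      moreover from this obtain m where "W = B m" using rng by auto
      ultimately show "x \<in> (\<Union>m\<in>J. B m)" unfolding J_def by blast
    qed
    then obtain J' where J': "J' \<subseteq> J" "finite J'" "K \<subseteq> (\<Union>m\<in>J'. B m)"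
      using compactE_image[OF assms, of J B] opn by metis
    obtain M where M: "\<And>m. m \<in> J' \<Longrightarrow> m \<le> M" using J'(2) by (meson finite_nat_set_iff_bounded_le)
    show ?thesis
    proof (intro exI[of _ "(1/3)^M/2"] conjI ballI impI)
      fix x y assume xy: "x \<in> K" "y \<in> K" "\<bar>?s x - ?s y\<bar> < (1/3)^M/2"
      then obtain m where m: "m \<in> J'" "x \<in> B m" using J' by blast
      then have "y \<in> B m" using ternary_code_close[OF xy(3) M[OF m(1)]] by simp
      moreover obtain z where "B m \<subseteq> ball z (\<epsilon>/2)" using m J' unfolding J_def by blast
      ultimately have "dist z x < \<epsilon>/2" "dist z y < \<epsilon>/2" using m(2) by auto
      then show "dist x y < \<epsilon>" using dist_triangle_half_r by blast
    qed simp
  qed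
  have inj: "inj_on ?s K"
  proof (rule inj_onI, rule ccontr)
    fix x y assume xy: "x \<in> K" "y \<in> K" "?s x = ?s y" "x \<noteq> y"
    from unif[of "dist x y"] xy(4) obtain \<delta> where "\<delta> > 0"
      "\<forall>z\<in>K. \<forall>w\<in>K. \<bar>?s z - ?s w\<bar> < \<delta> \<longrightarrow> dist z w < dist x y" by auto
    from this(1) this(2)[rule_format, OF xy(1,2)] xy(3) show False by simp
  qed
  have "uniformly_continuous_on (?s ` K) (inv_into K ?s)"
    unfolding uniformly_continuous_on_def
  proof (intro allI impI)
    fix \<epsilon> :: real assume "\<epsilon> > 0"
    then obtain \<delta> where d: "\<delta> > 0" "\<forall>x\<in>K. \<forall>y\<in>K. \<bar>?s x - ?s y\<bar> < \<delta> \<longrightarrow> dist x y < \<epsilon>" using unif by blast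
    show "\<exists>d>0. \<forall>x\<in>?s ` K. \<forall>x'\<in>?s ` K. dist x' x < d \<longrightarrow> dist (inv_into K ?s x') (inv_into K ?s x) < \<epsilon>"
      using d by (intro exI[of _ \<delta>]) (auto simp: inv_into_f_f[OF inj] dist_real_def)
  qed
  \<comment> \<open>The image of \<open>K\<close> need not be closed, so the inverse is extended
    first to the closure by uniform continuity and then to the line by Tietze.\<close>
  then obtain g where g: "uniformly_continuous_on (closure (?s ` K)) g" "\<And>t. t \<in> ?s ` K \<Longrightarrow> inv_into K ?s t = g t"
    using uniformly_continuous_on_extension_on_closure[of "?s ` K" "inv_into K ?s"] by metis
  obtain \<phi> where \<phi>: "continuous_on UNIV \<phi>" "\<And>t. t \<in> closure (?s ` K) \<Longrightarrow> \<phi> t = g t"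
    using Tietze_unbounded[OF uniformly_continuous_imp_continuous[OF g(1)], of UNIV] by auto
  show ?thesis
  proof (rule that[of ?s \<phi>])
    show "?s \<in> borel_measurable borel" using opn by (intro ternary_code_measurable) auto
    show "\<phi> (?s x) = x" if "x \<in> K" for x
      using \<phi>(2)[of "?s x"] g(2)[of "?s x"] closure_subset[of "?s ` K"] that by (auto simp: inv_into_f_f[OF inj])
  qed (use \<phi> ternary_code_bounds in auto)
qed

text \<open>Serves to show that a weak limit still lives on \<open>K\<close>: the truncated distance
  is a bounded continuous test function that vanishes precisely on \<open>K\<close>.\<close>

lemma AE_in_closed_if_integral_infdist:
  fixes K :: "'e::euclidean_space set"
  assumes "prob_space M" "sets M = sets borel" "closed K" "K \<noteq> {}"
    "(\<integral>x. min 1 (infdist x K) \<partial>M) = 0"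
  shows "AE x in M. x \<in> K"
proof -
  interpret prob_space M by fact
  have [measurable]: "(\<lambda>x. min 1 (infdist x K)) \<in> borel_measurable M"
    unfolding measurable_cong_sets[OF assms(2) refl]
    by (intro borel_measurable_continuous_onI continuous_intros)
  have "integrable M (\<lambda>x. min 1 (infdist x K))"
    by (rule integrable_const_bound[where B=1]) (auto simp: infdist_nonneg)
  then have "AE x in M. min 1 (infdist x K) = 0"
    using assms(5) by (subst (asm) integral_nonneg_eq_0_iff_AE) (auto simp: infdist_nonneg)
  then show ?thesis
    by eventually_elim (use in_closed_iff_infdist_zero[OF assms(3,4)] in \<open>auto simp: min_def split: if_splits\<close>)
qed

lemma weakly_convergent_subsequence_on_compact:
  fixes K :: "'e::euclidean_space set" and \<nu> :: "nat \<Rightarrow> 'e measure"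
  assumes K: "compact K" and \<nu>: "\<And>n. prob_space (\<nu> n)" "\<And>n. sets (\<nu> n) = sets borel"
    "\<And>n. AE x in \<nu> n. x \<in> K"
  obtains r M where "strict_mono (r :: nat \<Rightarrow> nat)" "prob_space M" "sets M = sets borel"
    "AE x in M. x \<in> K"
    "\<And>f :: 'e \<Rightarrow> real. continuous_on K f \<Longrightarrow>
       (\<lambda>n. LINT x:K|\<nu> (r n). f x) \<longlonglongrightarrow> (LINT x:K|M. f x)"
proof -
  obtain s :: "'e \<Rightarrow> real" and \<phi> where s: "s \<in> borel_measurable borel" "\<And>x. s x \<in> {0..3/2}"
    and \<phi>: "continuous_on UNIV \<phi>" "\<And>x. x \<in> K \<Longrightarrow> \<phi> (s x) = x"
    by (rule compact_image_of_real_code[OF K]) blast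
  have s'[measurable]: "s \<in> borel_measurable (\<nu> n)" for n
    using s(1) by (simp add: measurable_cong_sets[OF \<nu>(2) refl])
  define \<kappa> where "\<kappa> n = distr (\<nu> n) borel s" for n
  have rd: "real_distribution (\<kappa> n)" for n
    unfolding \<kappa>_def using prob_space.real_distribution_distr[OF \<nu>(1) s'] .
  have "tight \<kappa>"
    unfolding tight_def
  proof (intro conjI allI impI rd)
    fix \<epsilon> :: real assume "\<epsilon> > 0"
    \<comment> \<open>All codes lie in [0, 3/2], where 3/2 is the sum of the geometric series with
      ratio 1/3, so this interval carries the whole mass.\<close>
    have "measure (\<kappa> n) {-1<..2} = 1" for n
    proof -
      have "measure (\<kappa> n) {-1<..2} = measure (\<nu> n) (s -` {-1<..2} \<inter> space (\<nu> n))"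
        unfolding \<kappa>_def by (rule measure_distr) auto
      also have "s x \<in> {-1<..2}" for x using s(2)[of x] by auto
      then have "s -` {-1<..2} \<inter> space (\<nu> n) = space (\<nu> n)" by auto
      finally show ?thesis using prob_space.prob_space[OF \<nu>(1)] by simp
    qed
    then show "\<exists>a b. a < b \<and> (\<forall>n. 1 - \<epsilon> < measure (\<kappa> n) {a<..b})"
      using \<open>\<epsilon> > 0\<close> by (intro exI[of _ "-1"] exI[of _ 2]) auto
  qed
  from tight_imp_convergent_subsubsequence[OF this strict_mono_id]
  obtain r L where r: "strict_mono (r :: nat \<Rightarrow> nat)" and L: "real_distribution L" "weak_conv_m (\<kappa> \<circ> id \<circ> r) L"
    by blast
  interpret L: real_distribution L by fact
  have \<phi>b: "\<phi> \<in> borel_measurable borel" using \<phi>(1) by (rule borel_measurable_continuous_onI)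
  have \<phi>L[measurable]: "\<phi> \<in> borel_measurable L"
    using \<phi>b by (simp add: measurable_cong_sets[OF L.events_eq_borel refl])
  \<comment> \<open>The limit on the line is sent back by the continuous left inverse of the
    code.\<close>
  define M where "M = distr L borel \<phi>"
  have M: "prob_space M" "sets M = sets borel"
    unfolding M_def by (auto intro!: L.prob_space_distr)
  have conv: "(\<lambda>n. \<integral>x. f x \<partial>\<nu> (r n)) \<longlonglongrightarrow> (\<integral>x. f x \<partial>M)"
    if f: "continuous_on UNIV f" and B: "\<And>x. \<bar>f x\<bar> \<le> B" for f :: "'e \<Rightarrow> real" and B
  proof -
    have fb: "f \<in> borel_measurable borel" using f by (rule borel_measurable_continuous_onI)
    have fv: "f \<in> borel_measurable (\<nu> n)" for n using fb by (simp add: measurable_cong_sets[OF \<nu>(2) refl])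
    have c: "isCont (\<lambda>t. f (\<phi> t)) t" for t
      using continuous_on_compose2[OF f \<phi>(1)] by (simp add: continuous_on_eq_continuous_at)
    have cb: "(\<lambda>t. f (\<phi> t)) \<in> borel_measurable borel" using fb \<phi>b by simp
    have "(\<lambda>n. integral\<^sup>L ((\<kappa> \<circ> id \<circ> r) n) (\<lambda>t. f (\<phi> t))) \<longlonglongrightarrow> integral\<^sup>L L (\<lambda>t. f (\<phi> t))"
      using weak_conv_imp_integral_bdd_continuous_conv[of "\<kappa> \<circ> id \<circ> r" L "\<lambda>t. f (\<phi> t)" B] rd L c B by simp
    \<comment> \<open>The identity \<open>\<phi> (s x) = x\<close> holds on \<open>K\<close>, which
      carries each \<open>\<nu> n\<close>.\<close>
    moreover have "integral\<^sup>L (\<kappa> n) (\<lambda>t. f (\<phi> t)) = (\<integral>x. f x \<partial>\<nu> n)" for n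
      unfolding \<kappa>_def
      by (subst integral_distr[OF s' cb], rule integral_cong_AE)
         (use \<nu>(3)[of n] \<phi>(2) fv s' measurable_compose[OF s' cb] in auto)
    moreover have "integral\<^sup>L L (\<lambda>t. f (\<phi> t)) = (\<integral>x. f x \<partial>M)"
      unfolding M_def by (rule integral_distr[symmetric]) (use fb in auto)
    ultimately show ?thesis by simp
  qed
  have ne: "K \<noteq> {}" using \<nu>(3)[of 0] prob_space.AE_False[OF \<nu>(1)] by auto
  have cl: "closed K" using K compact_imp_closed by blast
  have inK: "AE x in M. x \<in> K"
  proof (rule AE_in_closed_if_integral_infdist[OF M cl ne])
    have "(\<integral>x. min 1 (infdist x K) \<partial>\<nu> n) = 0" for n
      by (rule integral_eq_zero_AE) (use \<nu>(3)[of n] in \<open>auto elim!: eventually_mono\<close>)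
    moreover have "(\<lambda>n. \<integral>x. min 1 (infdist x K) \<partial>\<nu> (r n)) \<longlonglongrightarrow> (\<integral>x. min 1 (infdist x K) \<partial>M)"
      by (rule conv[of _ 1]) (auto intro!: continuous_intros simp: infdist_nonneg)
    ultimately show "(\<integral>x. min 1 (infdist x K) \<partial>M) = 0"
      using LIMSEQ_unique[OF _ tendsto_const] by fastforce
  qed
  show ?thesis
  proof (rule that[OF r M inK])
    fix f :: "'e \<Rightarrow> real" assume f: "continuous_on K f"
    obtain B where B: "\<And>x. x \<in> K \<Longrightarrow> norm (f x) \<le> B"
      using compact_imp_bounded[OF compact_continuous_image[OF f K]] unfolding bounded_iff by auto
    have "0 \<le> B" using ne B norm_ge_zero order_trans by blast
    \<comment> \<open>A bounded continuous extension to the whole space; it leaves all integrals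
      unchanged because the measures live on \<open>K\<close>.\<close>
    obtain g where g: "continuous_on UNIV g" "\<And>x. x \<in> K \<Longrightarrow> g x = f x" "\<And>x. norm (g x) \<le> B"
      using Tietze[OF f _ \<open>0 \<le> B\<close> B, of UNIV] cl by auto
    have gb: "g \<in> borel_measurable borel" using g(1) by (rule borel_measurable_continuous_onI)
    have fb: "(\<lambda>x. indicator K x *\<^sub>R f x) \<in> borel_measurable borel"
    proof -
      have "(\<lambda>x. indicator K x *\<^sub>R g x) \<in> borel_measurable borel" using gb cl by (intro borel_measurable_scaleR borel_measurable_indicator) auto
      moreover have "(\<lambda>x. indicator K x *\<^sub>R g x) = (\<lambda>x. indicator K x *\<^sub>R f x)"
        using g(2) by (auto simp: fun_eq_iff indicator_def)
      ultimately show ?thesis by simp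
    qed
    have eq: "(LINT x:K|N. f x) = (\<integral>x. g x \<partial>N)" if "sets N = sets borel" "AE x in N. x \<in> K" for N
      unfolding set_lebesgue_integral_def
      by (rule integral_cong_AE)
         (use that g(2) fb gb in \<open>auto simp: measurable_cong_sets[OF that(1) refl] elim!: eventually_mono\<close>)
    show "(\<lambda>n. LINT x:K|\<nu> (r n). f x) \<longlonglongrightarrow> (LINT x:K|M. f x)"
      unfolding eq[OF \<nu>(2,3)] eq[OF M(2) inK] by (rule conv[OF g(1), of B]) (use g(3) in auto)
  qed
qed

subsection \<open>Charts and tangent vectors\<close>

locale closed_smooth_manifold =
  fixes A :: "('a::t2_space, 'e::euclidean_space) chart set"
  assumes closed_manifold: "closed_manifold A"
begin

abbreviation T where "T \<equiv> tangent_space A"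
abbreviation TM where "TM \<equiv> tangent_bundle A"
abbreviation trans_deriv :: "('a,'e) chart \<Rightarrow> ('a,'e) chart \<Rightarrow> 'a \<Rightarrow> 'e \<Rightarrow> 'e" where
  "trans_deriv c d x \<equiv> frechet_derivative (snd d \<circ> chart_inv c) (at (snd c x))"

lemma atlas: "smooth_atlas A" and compact_space: "compact (UNIV :: 'a set)"
  using closed_manifold by (auto simp: closed_manifold_def)

lemma chart_around: "\<exists>c\<in>A. x \<in> fst c"
  using atlas unfolding smooth_atlas_def by blast

lemma chart: "c \<in> A \<Longrightarrow> is_chart c"
  using atlas unfolding smooth_atlas_def by blast

lemma chart_open: "c \<in> A \<Longrightarrow> open (fst c)" "c \<in> A \<Longrightarrow> open (chart_image c)"
  using chart unfolding is_chart_def by auto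

lemma chart_homeomorphism:
  "c \<in> A \<Longrightarrow> homeomorphism (fst c) (chart_image c) (snd c) (chart_inv c)"
  using chart unfolding is_chart_def by auto

lemma chart_inv_left [simp]: "c \<in> A \<Longrightarrow> x \<in> fst c \<Longrightarrow> chart_inv c (snd c x) = x"
  using chart_homeomorphism by (metis homeomorphism_apply1)

lemma chart_in_image [simp]: "x \<in> fst c \<Longrightarrow> snd c x \<in> chart_image c"
  by (auto simp: chart_image_def)

lemma chart_inv_right [simp]: "c \<in> A \<Longrightarrow> p \<in> chart_image c \<Longrightarrow> snd c (chart_inv c p) = p"
  using chart_homeomorphism by (metis homeomorphism_apply2)

lemma chart_inv_in [simp]: "c \<in> A \<Longrightarrow> p \<in> chart_image c \<Longrightarrow> chart_inv c p \<in> fst c"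
  by (auto simp: chart_image_def)

lemma continuous_on_chart: "c \<in> A \<Longrightarrow> continuous_on (fst c) (snd c)"
  and continuous_on_chart_inv: "c \<in> A \<Longrightarrow> continuous_on (chart_image c) (chart_inv c)"
  using chart_homeomorphism by (auto simp: homeomorphism_def)

lemma chart_image_Int:
  "c \<in> A \<Longrightarrow> snd c ` (fst c \<inter> U) = {p \<in> chart_image c. chart_inv c p \<in> U}"
  by (force simp: chart_image_def)

lemma open_chart_image_Int: "c \<in> A \<Longrightarrow> open U \<Longrightarrow> open (snd c ` (fst c \<inter> U))"
  unfolding chart_image_Int
  using continuous_open_preimage[OF continuous_on_chart_inv chart_open(2), of c U]
  by (simp add: vimage_def Int_def)

lemma open_chart_inv_image:
  assumes "c \<in> A" "open V" "V \<subseteq> chart_image c"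
  shows "open (chart_inv c ` V)"
proof -
  have "chart_inv c ` V = fst c \<inter> snd c -` V"
  proof (intro equalityI subsetI)
    fix x assume "x \<in> fst c \<inter> snd c -` V"
    then show "x \<in> chart_inv c ` V"
      using chart_inv_left[OF assms(1), of x] by (metis IntD1 IntD2 imageI vimageD)
  qed (use assms in auto)
  then show ?thesis
    using continuous_open_preimage[OF continuous_on_chart chart_open(1)] assms by auto
qed

lemma transition_Ck:
  "c \<in> A \<Longrightarrow> d \<in> A \<Longrightarrow> Ck_on k (snd c ` (fst c \<inter> fst d)) (snd d \<circ> chart_inv c)"
  using atlas unfolding smooth_atlas_def smooth_on_def by blast

lemma transition_has_derivative:
  assumes "c \<in> A" "d \<in> A" "x \<in> fst c" "x \<in> fst d"
  shows "((snd d \<circ> chart_inv c) has_derivative trans_deriv c d x) (at (snd c x))"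
  using Ck_on_has_derivative[OF transition_Ck[OF assms(1,2), of "Suc 0"], of "snd c x"] assms by blast

lemma linear_trans_deriv:
  "c \<in> A \<Longrightarrow> d \<in> A \<Longrightarrow> x \<in> fst c \<Longrightarrow> x \<in> fst d \<Longrightarrow> linear (trans_deriv c d x)"
  using transition_has_derivative has_derivative_linear by blast

lemma chart_change_derivative:
  assumes c: "c \<in> A" "d \<in> A" "x \<in> fst c" "x \<in> fst d"
    and f: "((f \<circ> chart_inv d) has_derivative D) (at (snd d x))"
  shows "((f \<circ> chart_inv c) has_derivative (\<lambda>w. D (trans_deriv c d x w))) (at (snd c x))"
proof -
  have "(f \<circ> chart_inv d has_derivative D) (at ((snd d \<circ> chart_inv c) (snd c x)))"
    using f c by simp
  from has_derivative_compose[OF transition_has_derivative[OF c] this]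
  have "((\<lambda>p. (f \<circ> chart_inv d) ((snd d \<circ> chart_inv c) p)) has_derivative (\<lambda>w. D (trans_deriv c d x w)))
      (at (snd c x))" .
  then show ?thesis
    by (rule has_derivative_transform_within_open[OF _ open_chart_image_Int[OF c(1) chart_open(1)[OF c(2)]]])
       (use c in auto)
qed

text \<open>The cocycle identity of the transition derivatives; it is what makes
  \<open>coord_vec\<close> obey the transformation law of tangent vectors.\<close>

lemma trans_deriv_compose:
  assumes "c \<in> A" "d \<in> A" "e \<in> A" "x \<in> fst c" "x \<in> fst d" "x \<in> fst e"
  shows "trans_deriv d e x (trans_deriv c d x w) = trans_deriv c e x w"
proof -
  have "((snd e \<circ> chart_inv c) has_derivative (\<lambda>w. trans_deriv d e x (trans_deriv c d x w))) (at (snd c x))"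
    using assms by (intro chart_change_derivative transition_has_derivative) auto
  from frechet_derivative_at[OF this] show ?thesis by metis
qed

lemma trans_deriv_self:
  assumes "c \<in> A" "x \<in> fst c"
  shows "trans_deriv c c x w = w"
proof -
  have "((\<lambda>p. p) has_derivative (\<lambda>w. w)) (at (snd c x))" by simp
  then have "((snd c \<circ> chart_inv c) has_derivative (\<lambda>w. w)) (at (snd c x))"
    by (rule has_derivative_transform_within_open[OF _ chart_open(2)[OF assms(1)]]) (use assms in auto)
  from frechet_derivative_at[OF this] show ?thesis by metis
qed

lemma coord_vec_apply:
  "coord_vec A c x w = (\<lambda>d. if d \<in> A \<and> x \<in> fst d then trans_deriv c d x w else 0)"
  by (simp add: coord_vec_def)

lemma coord_vec_self [simp]: "c \<in> A \<Longrightarrow> x \<in> fst c \<Longrightarrow> coord_vec A c x w c = w"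
  by (simp add: coord_vec_apply trans_deriv_self)

lemma coord_vec_in_tangent_space [simp]:
  "c \<in> A \<Longrightarrow> x \<in> fst c \<Longrightarrow> coord_vec A c x w \<in> T x"
  unfolding tangent_space_def by (auto simp: coord_vec_apply trans_deriv_compose)

lemma tangent_transform:
  "v \<in> T x \<Longrightarrow> c \<in> A \<Longrightarrow> d \<in> A \<Longrightarrow> x \<in> fst c \<Longrightarrow> x \<in> fst d \<Longrightarrow> trans_deriv c d x (v c) = v d"
proof -
  assume v: "v \<in> T x" and c: "c \<in> A" "d \<in> A" "x \<in> fst c" "x \<in> fst d"
  have "\<forall>c\<in>A. \<forall>d\<in>A. x \<in> fst c \<and> x \<in> fst d \<longrightarrow> v d = trans_deriv c d x (v c)"
    using v unfolding tangent_space_def by blast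
  then have "v d = trans_deriv c d x (v c)" using c by blast
  then show "trans_deriv c d x (v c) = v d" by (rule sym)
qed

lemma tangent_eq_coord_vec:
  assumes "v \<in> T x" "c \<in> A" "x \<in> fst c"
  shows "coord_vec A c x (v c) = v"
proof
  fix d
  show "coord_vec A c x (v c) d = v d"
  proof (cases "d \<in> A \<and> x \<in> fst d")
    case True
    then have "trans_deriv c d x (v c) = v d" using tangent_transform[OF assms(1)] assms by blast
    then show ?thesis using True by (simp add: coord_vec_apply)
  next
    case False
    then have "v d = 0" using assms(1) unfolding tangent_space_def by blast
    then show ?thesis using False by (auto simp: coord_vec_apply)
  qed
qed

lemma coord_vec_combination:
  assumes "c \<in> A" "x \<in> fst c"
  shows "coord_vec A c x (a *\<^sub>R u + b *\<^sub>R w) = (\<lambda>d. a *\<^sub>R coord_vec A c x u d + b *\<^sub>R coord_vec A c x w d)"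
proof
  fix d
  show "coord_vec A c x (a *\<^sub>R u + b *\<^sub>R w) d = a *\<^sub>R coord_vec A c x u d + b *\<^sub>R coord_vec A c x w d"
  proof (cases "d \<in> A \<and> x \<in> fst d")
    case True
    then have "linear (trans_deriv c d x)" using linear_trans_deriv assms by blast
    from linear_add[OF this] linear_scale[OF this] True show ?thesis
      by (simp add: coord_vec_apply)
  qed (auto simp: coord_vec_apply)
qed

lemma coord_vec_eq_0_iff: "c \<in> A \<Longrightarrow> x \<in> fst c \<Longrightarrow> coord_vec A c x w = (\<lambda>d. 0) \<longleftrightarrow> w = 0"
  using coord_vec_combination[of c x 0 0 0 0] coord_vec_self[of c x w] by fastforce

lemma scale_tangent:
  assumes "v \<in> T x"
  shows "(\<lambda>c. t *\<^sub>R v c) \<in> T x"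
proof -
  obtain c where c: "c \<in> A" "x \<in> fst c" using chart_around by blast
  have "coord_vec A c x (t *\<^sub>R v c + 0 *\<^sub>R v c) = (\<lambda>d. t *\<^sub>R v d)"
    unfolding coord_vec_combination[OF c] tangent_eq_coord_vec[OF assms c] by simp
  then show ?thesis using coord_vec_in_tangent_space[OF c] by metis
qed

lemma zero_tangent: "(\<lambda>c. 0) \<in> T x"
proof -
  obtain c where c: "c \<in> A" "x \<in> fst c" using chart_around by blast
  then show ?thesis using coord_vec_eq_0_iff[OF c] coord_vec_in_tangent_space[OF c] by metis
qed

lemma nonzero_tangent: "\<exists>v\<in>T x. v \<noteq> (\<lambda>c. 0)"
proof -
  obtain c where c: "c \<in> A" "x \<in> fst c" using chart_around by blast
  then show ?thesis
    using coord_vec_eq_0_iff[OF c] coord_vec_in_tangent_space[OF c] nonzero_Basis SOME_Basis by metis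
qed

lemma bundle_param_in [simp]: "c \<in> A \<Longrightarrow> p \<in> chart_image c \<Longrightarrow> bundle_param A c (p, w) \<in> TM"
  by (auto simp: bundle_param_def tangent_bundle_def)

lemma bundle_param_coordinates:
  "(x, v) \<in> TM \<Longrightarrow> c \<in> A \<Longrightarrow> x \<in> fst c \<Longrightarrow> bundle_param A c (snd c x, v c) = (x, v)"
  by (auto simp: bundle_param_def tangent_bundle_def tangent_eq_coord_vec)

lemma linear_coord_vec:
  assumes "\<And>v w a b. v \<in> T x \<Longrightarrow> w \<in> T x \<Longrightarrow> L (\<lambda>c. a *\<^sub>R v c + b *\<^sub>R w c) = a * L v + b * (L w :: real)"
    and c: "c \<in> A" "x \<in> fst c"
  shows "linear (\<lambda>w. L (coord_vec A c x w))"
proof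
  fix u w r
  show "L (coord_vec A c x (u + w)) = L (coord_vec A c x u) + L (coord_vec A c x w)"
    using coord_vec_combination[OF c, of 1 u 1 w] assms(1)[of "coord_vec A c x u" "coord_vec A c x w" 1 1] c by simp
  show "L (coord_vec A c x (r *\<^sub>R w)) = r *\<^sub>R L (coord_vec A c x w)"
    using coord_vec_combination[OF c, of r w 0 w] assms(1)[of "coord_vec A c x w" "coord_vec A c x w" r 0] c by simp
qed

subsection \<open>Continuous functions on the tangent bundle\<close>

text \<open>Amounts to continuity for \<open>tangent_topology\<close>, which is itself defined by
  the bundle charts. Values off \<open>TM\<close> are left free, as those of forms and metrics are
  arbitrary there.\<close>

definition bundle_continuous :: "('a \<times> ('a, 'e) tvec \<Rightarrow> real) \<Rightarrow> bool" where
  "bundle_continuous q \<longleftrightarrow> (\<forall>c\<in>A. continuous_on (chart_image c \<times> UNIV) (\<lambda>z. q (bundle_param A c z)))"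

text \<open>The factor \<open>t\<close> ranges over all reals; \<open>t = 0\<close> gives the
  vanishing of functions of positive degree on the zero section.\<close>

definition fibre_homogeneous :: "nat \<Rightarrow> ('a \<times> ('a, 'e) tvec \<Rightarrow> real) \<Rightarrow> bool" where
  "fibre_homogeneous k q \<longleftrightarrow> (\<forall>x. \<forall>v\<in>T x. \<forall>t. q (x, \<lambda>c. t *\<^sub>R v c) = t ^ k * q (x, v))"

lemma bundle_continuous_compose:
  assumes "bundle_continuous q" "continuous_on UNIV f"
  shows "bundle_continuous (\<lambda>z. f (q z))"
  using assms unfolding bundle_continuous_def by (auto intro: continuous_on_compose2)

lemma bundle_continuous_const: "bundle_continuous (\<lambda>z. r)"
  unfolding bundle_continuous_def by auto

lemma bundle_continuous_diff:
  "bundle_continuous q \<Longrightarrow> bundle_continuous q' \<Longrightarrow> bundle_continuous (\<lambda>z. q z - q' z)"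
  unfolding bundle_continuous_def by (auto intro: continuous_on_diff)

lemma bundle_continuous_mult:
  "bundle_continuous q \<Longrightarrow> bundle_continuous q' \<Longrightarrow> bundle_continuous (\<lambda>z. q z * q' z)"
  unfolding bundle_continuous_def by (auto intro: continuous_on_mult)

lemma openin_vimage_bundle_continuous:
  assumes "bundle_continuous q" "open U"
  shows "openin (tangent_topology A) {z \<in> TM. q z \<in> U}"
  unfolding openin_tangent_topology
proof (intro conjI ballI)
  fix c assume c: "c \<in> A"
  have "{z \<in> chart_image c \<times> UNIV. bundle_param A c z \<in> {z \<in> TM. q z \<in> U}} =
     (chart_image c \<times> UNIV) \<inter> (\<lambda>z. q (bundle_param A c z)) -` U"
    using c by auto
  moreover have "open ((chart_image c \<times> UNIV) \<inter> (\<lambda>z. q (bundle_param A c z)) -` U)"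
    using assms c chart_open(2)[OF c] unfolding bundle_continuous_def
    by (intro continuous_open_preimage) (auto intro: open_Times)
  ultimately show "open {z \<in> chart_image c \<times> UNIV. bundle_param A c z \<in> {z \<in> TM. q z \<in> U}}" by simp
qed auto

lemma space_tangent_borel [simp]: "space (tangent_borel A) = TM"
  unfolding tangent_borel_def by (auto simp: openin_tangent_topology intro!: space_measure_of)

lemma sets_tangent_borel: "sets (tangent_borel A) = sigma_sets TM {W. openin (tangent_topology A) W}"
  unfolding tangent_borel_def by (rule sets_measure_of) (auto simp: openin_tangent_topology)

lemma sets_openin: "openin (tangent_topology A) W \<Longrightarrow> W \<in> sets (tangent_borel A)"
  by (auto simp: sets_tangent_borel)

lemma bundle_continuous_measurable:
  assumes "bundle_continuous q"
  shows "q \<in> borel_measurable (tangent_borel A)"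
proof (rule borel_measurableI)
  fix U :: "real set" assume "open U"
  from sets_openin[OF openin_vimage_bundle_continuous[OF assms this]]
  show "q -` U \<inter> space (tangent_borel A) \<in> sets (tangent_borel A)"
    by (auto simp: vimage_def Int_def conj_commute)
qed

lemma measurable_into_tangent_borel:
  assumes "f \<in> space N \<rightarrow> TM"
    and "\<And>W. openin (tangent_topology A) W \<Longrightarrow> f -` W \<inter> space N \<in> sets N"
  shows "f \<in> measurable N (tangent_borel A)"
  unfolding tangent_borel_def
  by (rule measurable_measure_of) (use assms in \<open>auto simp: openin_tangent_topology\<close>)

lemma bundle_continuous_fibre_linear:
  assumes lin: "\<And>x v w a b. v \<in> T x \<Longrightarrow> w \<in> T x \<Longrightarrow> L x (\<lambda>c. a *\<^sub>R v c + b *\<^sub>R w c) = a * L x v + b * L x w"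
    and cont: "\<And>c b. c \<in> A \<Longrightarrow> b \<in> Basis \<Longrightarrow> continuous_on (chart_image c) (\<lambda>p. L (chart_inv c p) (coord_vec A c (chart_inv c p) b))"
  shows "bundle_continuous (\<lambda>(x, v). L x v)"
  unfolding bundle_continuous_def
proof (intro ballI)
  fix c assume c: "c \<in> A"
  have "continuous_on (chart_image c \<times> UNIV)
     (\<lambda>z. \<Sum>b\<in>Basis. (snd z \<bullet> b) * L (chart_inv c (fst z)) (coord_vec A c (chart_inv c (fst z)) b))"
    by (intro continuous_intros continuous_on_compose2[OF cont[OF c]]) auto
  then show "continuous_on (chart_image c \<times> UNIV) (\<lambda>z. case bundle_param A c z of (x, v) \<Rightarrow> L x v)"
  proof (rule continuous_on_eq)
    fix z :: "'e \<times> 'e" assume "z \<in> chart_image c \<times> UNIV"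
    then obtain p w where z: "z = (p, w)" "p \<in> chart_image c" by auto
    have "linear (\<lambda>w. L (chart_inv c p) (coord_vec A c (chart_inv c p) w))"
      using c z by (intro linear_coord_vec lin) auto
    from linear_euclidean_sum[OF this, of w]
    show "(\<Sum>b\<in>Basis. (snd z \<bullet> b) * L (chart_inv c (fst z)) (coord_vec A c (chart_inv c (fst z)) b)) =
        (case bundle_param A c z of (x, v) \<Rightarrow> L x v)"
      by (simp add: z bundle_param_def)
  qed
qed

lemma bundle_continuous_metric:
  assumes g: "riemannian_metric A g"
  shows "bundle_continuous (\<lambda>(x, v). g x v v)"
  unfolding bundle_continuous_def
proof (intro ballI)
  fix c assume c: "c \<in> A"
  let ?G = "\<lambda>p u w. g (chart_inv c p) (coord_vec A c (chart_inv c p) u) (coord_vec A c (chart_inv c p) w)"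
  have cont: "continuous_on (chart_image c) (\<lambda>p. ?G p u w)" for u w
    using g c unfolding riemannian_metric_def smooth_on_def by (auto intro: Ck_on_continuous)
  have lin: "linear (\<lambda>u. ?G p u w)" if "p \<in> chart_image c" for p w
    by (rule linear_coord_vec[of _ "\<lambda>v. g (chart_inv c p) v (coord_vec A c (chart_inv c p) w)"])
       (use g c that in \<open>auto simp: riemannian_metric_def\<close>)
  \<comment> \<open>Linearity is assumed in the first slot only; symmetry transfers it to the
    second, so that the quadratic form can be expanded in both.\<close>
  have sym: "?G p u w = ?G p w u" if "p \<in> chart_image c" for p u w
    using g c that by (auto simp: riemannian_metric_def)
  have expand: "?G p w w = (\<Sum>b\<in>Basis. \<Sum>b'\<in>Basis. (w \<bullet> b) * (w \<bullet> b') * ?G p b b')" if p: "p \<in> chart_image c" for p w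
  proof -
    have "?G p w w = (\<Sum>b\<in>Basis. (w \<bullet> b) * ?G p b w)"
      using linear_euclidean_sum[OF lin[OF p], of w w] by simp
    also have "\<dots> = (\<Sum>b\<in>Basis. (w \<bullet> b) * (\<Sum>b'\<in>Basis. (w \<bullet> b') * ?G p b' b))"
    proof (rule sum.cong[OF refl])
      fix b :: 'e
      show "(w \<bullet> b) * ?G p b w = (w \<bullet> b) * (\<Sum>b'\<in>Basis. (w \<bullet> b') * ?G p b' b)"
        unfolding sym[OF p, of b w] using linear_euclidean_sum[OF lin[OF p, of b], of w]
        by (simp only: real_scaleR_def)
    qed
    also have "\<dots> = (\<Sum>b\<in>Basis. \<Sum>b'\<in>Basis. (w \<bullet> b) * (w \<bullet> b') * ?G p b b')"
      by (simp add: sum_distrib_left mult.assoc sym[OF p, of b b' for b b'] cong: sum.cong)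
    finally show ?thesis .
  qed
  have "continuous_on (chart_image c \<times> UNIV)
    (\<lambda>z. \<Sum>b\<in>Basis. \<Sum>b'\<in>Basis. (snd z \<bullet> b) * (snd z \<bullet> b') * ?G (fst z) b b')"
    by (intro continuous_intros continuous_on_compose2[OF cont]) auto
  then show "continuous_on (chart_image c \<times> UNIV) (\<lambda>z. case bundle_param A c z of (x, v) \<Rightarrow> g x v v)"
    by (rule continuous_on_eq) (auto simp: bundle_param_def expand)
qed

lemma metric_scale:
  assumes g: "riemannian_metric A g" and v: "v \<in> T x"
  shows "g x (\<lambda>c. t *\<^sub>R v c) (\<lambda>c. t *\<^sub>R v c) = t\<^sup>2 * g x v v"
proof -
  have *: "g x (\<lambda>c. t *\<^sub>R v c) w = t * g x v w" if "w \<in> T x" for w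
  proof -
    have "g x (\<lambda>c. t *\<^sub>R v c + 0 *\<^sub>R v c) w = t * g x v w + 0 * g x v w"
      using g v that unfolding riemannian_metric_def by blast
    then show ?thesis by simp
  qed
  have "g x (\<lambda>c. t *\<^sub>R v c) (\<lambda>c. t *\<^sub>R v c) = t * g x v (\<lambda>c. t *\<^sub>R v c)"
    by (rule *[OF scale_tangent[OF v]])
  also have "g x v (\<lambda>c. t *\<^sub>R v c) = g x (\<lambda>c. t *\<^sub>R v c) v"
    using g v scale_tangent[OF v] unfolding riemannian_metric_def by blast
  also have "\<dots> = t * g x v v" by (rule *[OF v])
  finally show ?thesis by (simp add: power2_eq_square)
qed

lemma homogeneous_metric: "riemannian_metric A g \<Longrightarrow> fibre_homogeneous 2 (\<lambda>(x, v). g x v v)"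
  unfolding fibre_homogeneous_def using metric_scale by auto

lemma metric_zero: "riemannian_metric A g \<Longrightarrow> g x (\<lambda>c. 0) (\<lambda>c. 0) = 0"
  using metric_scale[OF _ zero_tangent, of g x 0] by simp

lemma metric_pos: "riemannian_metric A g \<Longrightarrow> v \<in> T x \<Longrightarrow> v \<noteq> (\<lambda>c. 0) \<Longrightarrow> g x v v > 0"
  unfolding riemannian_metric_def by blast

lemma metric_nonneg: "riemannian_metric A g \<Longrightarrow> v \<in> T x \<Longrightarrow> g x v v \<ge> 0"
  using metric_pos[of g v x] metric_zero[of g x] by (cases "v = (\<lambda>c. 0)") auto

lemma homogeneous_fibre_linear:
  assumes "\<And>x v w a b. v \<in> T x \<Longrightarrow> w \<in> T x \<Longrightarrow> L x (\<lambda>c. a *\<^sub>R v c + b *\<^sub>R w c) = a * L x v + b * (L x w :: real)"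
  shows "fibre_homogeneous 1 (\<lambda>(x, v). L x v)"
  unfolding fibre_homogeneous_def
proof (intro allI ballI)
  fix x v t assume "v \<in> T x"
  then show "(case (x, \<lambda>c. t *\<^sub>R v c) of (x, v) \<Rightarrow> L x v) = t ^ 1 * (case (x, v) of (x, v) \<Rightarrow> L x v)"
    using assms[of v x v t 0] by simp
qed

lemma bundle_continuous_form:
  assumes "smooth_1form A \<eta>"
  shows "bundle_continuous (\<lambda>(x, v). \<eta> x v)" "fibre_homogeneous 1 (\<lambda>(x, v). \<eta> x v)"
proof -
  have lin: "\<eta> x (\<lambda>c. a *\<^sub>R v c + b *\<^sub>R w c) = a * \<eta> x v + b * \<eta> x w" if "v \<in> T x" "w \<in> T x" for x v w a b
    using assms that unfolding smooth_1form_def by blast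
  show "bundle_continuous (\<lambda>(x, v). \<eta> x v)"
  proof (rule bundle_continuous_fibre_linear[OF lin])
    fix c and b :: 'e assume "c \<in> A"
    then have "continuous_on (chart_image c) (form_coord A \<eta> c b)"
      using assms unfolding smooth_1form_def smooth_on_def by (auto intro: Ck_on_continuous)
    then show "continuous_on (chart_image c) (\<lambda>p. \<eta> (chart_inv c p) (coord_vec A c (chart_inv c p) b))"
      by (simp add: form_coord_def)
  qed
  show "fibre_homogeneous 1 (\<lambda>(x, v). \<eta> x v)"
    by (rule homogeneous_fibre_linear[OF lin])
qed

subsection \<open>Differentials\<close>

lemma manifold_C1_has_derivative:
  assumes "manifold_Ck A 1 U f" "c \<in> A" "x \<in> fst c" "x \<in> U"
  shows "((f \<circ> chart_inv c) has_derivative frechet_derivative (f \<circ> chart_inv c) (at (snd c x))) (at (snd c x))"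
  using assms Ck_on_has_derivative[of 0 "snd c ` (fst c \<inter> U)" "f \<circ> chart_inv c" "snd c x"]
  unfolding manifold_Ck_def by auto

text \<open>Removes the choice of chart from \<open>differential\<close>: the chain rule through the
  transition map matches the transformation law of \<open>v\<close>.\<close>

lemma differential_in_chart:
  assumes f: "manifold_Ck A 1 U f" and c: "c \<in> A" "x \<in> fst c" and x: "x \<in> U" and v: "v \<in> T x"
  shows "differential A f x v = frechet_derivative (f \<circ> chart_inv c) (at (snd c x)) (v c)"
proof -
  define d where "d = (SOME d. d \<in> A \<and> x \<in> fst d)"
  have d: "d \<in> A" "x \<in> fst d"
    using someI_ex[of "\<lambda>d. d \<in> A \<and> x \<in> fst d"] chart_around[of x] unfolding d_def by blast+
  have "((f \<circ> chart_inv c) has_derivative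
     (\<lambda>w. frechet_derivative (f \<circ> chart_inv d) (at (snd d x)) (trans_deriv c d x w))) (at (snd c x))"
    using c d f x by (intro chart_change_derivative manifold_C1_has_derivative)
  from frechet_derivative_at[OF this]
  have "frechet_derivative (f \<circ> chart_inv c) (at (snd c x)) (v c) =
      frechet_derivative (f \<circ> chart_inv d) (at (snd d x)) (trans_deriv c d x (v c))" by metis
  also have "trans_deriv c d x (v c) = v d"
    using tangent_transform[OF v c(1) d(1) c(2) d(2)] .
  finally show ?thesis unfolding differential_def d_def[symmetric] by (simp only: Let_def)
qed

lemma differential_linear:
  assumes f: "manifold_Ck A 1 U f" and x: "x \<in> U" and v: "v \<in> T x" "w \<in> T x"
  shows "differential A f x (\<lambda>c. a *\<^sub>R v c + b *\<^sub>R w c) = a * differential A f x v + b * differential A f x w"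
proof -
  define d where "d = (SOME d. d \<in> A \<and> x \<in> fst d)"
  have d: "d \<in> A" "x \<in> fst d"
    using someI_ex[of "\<lambda>d. d \<in> A \<and> x \<in> fst d"] chart_around[of x] unfolding d_def by blast+
  have lin: "linear (frechet_derivative (f \<circ> chart_inv d) (at (snd d x)))"
    using has_derivative_linear[OF manifold_C1_has_derivative[OF f d x]] .
  show ?thesis unfolding differential_def d_def[symmetric] Let_def
    by (simp only: linear_add[OF lin] linear_scale[OF lin] real_scaleR_def)
qed

lemma bundle_continuous_differential:
  assumes f: "manifold_Ck A 1 UNIV f"
  shows "bundle_continuous (\<lambda>(x, v). differential A f x v)" "fibre_homogeneous 1 (\<lambda>(x, v). differential A f x v)"
proof -
  show "bundle_continuous (\<lambda>(x, v). differential A f x v)"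
  proof (rule bundle_continuous_fibre_linear[OF differential_linear[OF f UNIV_I]])
    fix c and b :: 'e assume c: "c \<in> A"
    have "continuous_on (chart_image c) (\<lambda>p. frechet_derivative (f \<circ> chart_inv c) (at p) b)"
      using f c unfolding manifold_Ck_def by (auto simp: chart_image_def)
    then show "continuous_on (chart_image c) (\<lambda>p. differential A f (chart_inv c p) (coord_vec A c (chart_inv c p) b))"
      by (rule continuous_on_eq) (use c in \<open>simp add: differential_in_chart[OF f c]\<close>)
  qed auto
  show "fibre_homogeneous 1 (\<lambda>(x, v). differential A f x v)"
    by (rule homogeneous_fibre_linear[OF differential_linear[OF f UNIV_I]])
qed

subsection \<open>Compactness\<close>

text \<open>The balls of radius \<open>r i\<close> already cover, while the doubled ones still fit
  into the charts. The margin leaves room for closed supports inside open domains in the partition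
  of unity; the numbering allows a least index to be chosen.\<close>

lemma finite_ball_cover:
  obtains N :: nat and cs z r where
    "\<And>i. i < N \<Longrightarrow> cs i \<in> A \<and> 0 < (r i :: real) \<and> cball (z i) (2 * r i) \<subseteq> chart_image (cs i)"
    "\<And>x. \<exists>i<N. x \<in> chart_inv (cs i) ` ball (z i) (r i)"
proof -
  define \<I> where "\<I> = {(c, p, s). c \<in> A \<and> 0 < (s::real) \<and> cball p (2 * s) \<subseteq> chart_image c}"
  let ?V = "\<lambda>(c, p, s). chart_inv c ` ball p s"
  have "\<exists>i\<in>\<I>. x \<in> ?V i" for x
  proof -
    obtain c where c: "c \<in> A" "x \<in> fst c" using chart_around by blast
    obtain s where "s > 0" "cball (snd c x) s \<subseteq> chart_image c"
      using open_contains_cball chart_open(2)[OF c(1)] chart_in_image[OF c(2)] by blast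
    moreover have "x \<in> chart_inv c ` ball (snd c x) (s/2)"
      using c \<open>s > 0\<close> by (intro image_eqI[of _ _ "snd c x"]) auto
    ultimately show ?thesis using c unfolding \<I>_def by (intro bexI[of _ "(c, snd c x, s/2)"]) auto
  qed
  then have cov: "UNIV \<subseteq> (\<Union>i\<in>\<I>. ?V i)" by blast
  have opn: "open (?V i)" if "i \<in> \<I>" for i
  proof -
    obtain c p s where i: "i = (c, p, s)" by (metis surj_pair)
    then have "ball p s \<subseteq> chart_image c"
      using that unfolding \<I>_def by (auto simp: subset_eq)
    then show ?thesis using that unfolding \<I>_def i by (auto intro!: open_chart_inv_image)
  qed
  obtain J where J: "J \<subseteq> \<I>" "finite J" "UNIV \<subseteq> (\<Union>i\<in>J. ?V i)"
    using compactE_image[OF compact_space opn cov] by blast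
  obtain N and e :: "nat \<Rightarrow> ('a, 'e) chart \<times> 'e \<times> real" where e: "J = e ` {i. i < N}"
    using finite_imp_nat_seg_image_inj_on[OF J(2)] by blast
  show ?thesis
  proof (rule that[of N "\<lambda>i. fst (e i)" "\<lambda>i. snd (snd (e i))" "\<lambda>i. fst (snd (e i))"])
    fix i assume "i < N"
    then have "e i \<in> \<I>" using J(1) e by auto
    then show "fst (e i) \<in> A \<and> 0 < snd (snd (e i)) \<and> cball (fst (snd (e i))) (2 * snd (snd (e i))) \<subseteq> chart_image (fst (e i))"
      unfolding \<I>_def by auto
  next
    fix x
    have "x \<in> (\<Union>i\<in>J. ?V i)" using J(3) by (rule subsetD) simp
    then obtain j where j: "j \<in> J" "x \<in> ?V j" by (rule UN_E)
    from j(1) obtain i where i: "i < N" "j = e i" unfolding e by auto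
    then show "\<exists>i<N. x \<in> chart_inv (fst (e i)) ` ball (fst (snd (e i))) (snd (snd (e i)))"
      using j(2) by (intro exI[of _ i]) (simp add: case_prod_beta)
  qed
qed

text \<open>The metric norm has a positive minimum on the compact set of coordinate unit vectors
  over \<open>K\<close>, and homogeneity extends the bound to all vectors.\<close>

lemma metric_lower_bound:
  assumes g: "riemannian_metric A g" and c: "c \<in> A" and K: "compact K" "K \<subseteq> chart_image c"
  obtains a where "a > 0" "\<And>p w x v. p \<in> K \<Longrightarrow> (x, v) = bundle_param A c (p, w) \<Longrightarrow> a * norm w \<le> sqrt (g x v v)"
proof -
  let ?q = "\<lambda>z. case bundle_param A c z of (x, v) \<Rightarrow> sqrt (g x v v)"
  have cont: "continuous_on (K \<times> sphere 0 1) ?q"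
  proof -
    have "bundle_continuous (\<lambda>z. sqrt (case z of (x, v) \<Rightarrow> g x v v))"
      by (rule bundle_continuous_compose[OF bundle_continuous_metric[OF g]]) (intro continuous_intros)
    then have "continuous_on (chart_image c \<times> UNIV) ?q"
      using c unfolding bundle_continuous_def by (auto simp: case_prod_beta)
    then show ?thesis by (rule continuous_on_subset) (use K in auto)
  qed
  have pos: "?q (p, w) > 0" if "p \<in> K" "w \<noteq> 0" for p w
    using that K c metric_pos[OF g coord_vec_in_tangent_space[OF c], of "chart_inv c p" w]
    by (auto simp: bundle_param_def coord_vec_eq_0_iff subset_eq)
  obtain a where a: "a > 0" "\<And>p w. p \<in> K \<Longrightarrow> norm w = 1 \<Longrightarrow> a \<le> ?q (p, w)"
  proof (cases "K = {}")
    case False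
    obtain b :: 'e where "b \<in> Basis" using nonempty_Basis by blast
    then have "(K \<times> sphere 0 1 :: ('e \<times> 'e) set) \<noteq> {}" using False by (auto intro!: exI[of _ b])
    then obtain z where z: "z \<in> K \<times> sphere 0 1" "\<forall>y\<in>K \<times> sphere 0 1. ?q z \<le> ?q y"
      using continuous_attains_inf[OF compact_Times[OF K(1) compact_sphere] _ cont] by auto
    have "?q z > 0" using z(1) pos[of "fst z" "snd z"] by force
    then show ?thesis using that[of "?q z"] z(2) by auto
  qed (use that[of 1] in auto)
  show ?thesis
  proof (rule that[OF a(1)])
    fix p w x v assume p: "p \<in> K" and xv: "(x, v) = bundle_param A c (p, w)"
    have pc: "chart_inv c p \<in> fst c" using p K c by auto
    show "a * norm w \<le> sqrt (g x v v)"
    proof (cases "w = 0")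
      case False
      define u where "u = (1 / norm w) *\<^sub>R w"
      have "coord_vec A c (chart_inv c p) (norm w *\<^sub>R u + 0 *\<^sub>R u) = (\<lambda>d. norm w *\<^sub>R coord_vec A c (chart_inv c p) u d)"
        unfolding coord_vec_combination[OF c pc] by simp
      then have v: "v = (\<lambda>d. norm w *\<^sub>R coord_vec A c (chart_inv c p) u d)" and x: "x = chart_inv c p"
        using xv False by (auto simp: bundle_param_def u_def)
      have "g x v v = (norm w)\<^sup>2 * g x (coord_vec A c x u) (coord_vec A c x u)"
        unfolding v x by (rule metric_scale[OF g]) (use c pc in simp)
      then have "sqrt (g x v v) = norm w * ?q (p, u)"
        by (simp add: real_sqrt_mult x bundle_param_def)
      moreover have "a \<le> ?q (p, u)" using a(2)[OF p, of u] False by (simp add: u_def)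
      ultimately show ?thesis using mult_right_mono[of a "?q (p, u)" "norm w"] by (simp only: mult.commute norm_ge_zero)
    qed (use metric_nonneg[OF g, of v x] xv pc c in \<open>auto simp: bundle_param_def\<close>)
  qed
qed

text \<open>Over a compact coordinate ball, \<open>q\<close> is bounded on coordinate vectors of
  norm at most 1, and the coordinate norm is controlled by the metric. Homogeneity and a finite
  cover do the rest. Degree 1 gives the linear growth of forms, degree 2 the comparison of
  metrics.\<close>

lemma homogeneous_growth:
  assumes g: "riemannian_metric A g" and q: "bundle_continuous q" "fibre_homogeneous k q"
  obtains C where "C > 0" "\<And>x v. v \<in> T x \<Longrightarrow> \<bar>q (x, v)\<bar> \<le> C * sqrt (g x v v) ^ k"
proof -
  obtain N :: nat and cs z r where
    cov': "\<And>i. i < N \<Longrightarrow> cs i \<in> A \<and> 0 < (r i :: real) \<and> cball (z i) (2 * r i) \<subseteq> chart_image (cs i)"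
    "\<And>x. \<exists>i<N. x \<in> chart_inv (cs i) ` ball (z i) (r i)"
    by (rule finite_ball_cover) (rule that)
  have cov: "cs i \<in> A \<and> 0 < r i \<and> cball (z i) (r i) \<subseteq> chart_image (cs i)" if "i < N" for i
  proof -
    have "cball (z i) (r i) \<subseteq> cball (z i) (2 * r i)" using cov'(1)[OF that] by (intro subset_cball) simp
    then show ?thesis using cov'(1)[OF that] by blast
  qed
  have "\<exists>C>0. \<forall>p\<in>cball (z i) (r i). \<forall>w x v. (x, v) = bundle_param A (cs i) (p, w) \<longrightarrow> \<bar>q (x, v)\<bar> \<le> C * sqrt (g x v v) ^ k"
    if "i < N" for i
  proof -
    let ?K = "cball (z i) (r i)" and ?c = "cs i"
    have c: "?c \<in> A" "?K \<subseteq> chart_image ?c" using cov[OF that] by auto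
    obtain a where a: "a > 0" "\<And>p w x v. p \<in> ?K \<Longrightarrow> (x, v) = bundle_param A ?c (p, w) \<Longrightarrow> a * norm w \<le> sqrt (g x v v)"
      using metric_lower_bound[OF g c(1) compact_cball c(2)] by metis
    have "continuous_on (?K \<times> cball 0 1) (\<lambda>z. q (bundle_param A ?c z))"
      using q(1) c unfolding bundle_continuous_def by (auto intro: continuous_on_subset)
    from compact_imp_bounded[OF compact_continuous_image[OF this compact_Times[OF compact_cball compact_cball]]]
    obtain B where B: "B > 0" "\<forall>y\<in>(\<lambda>z. q (bundle_param A ?c z)) ` (?K \<times> cball 0 1). norm y \<le> B"
      unfolding bounded_pos by blast
    have B': "\<bar>q (bundle_param A ?c (p, w))\<bar> \<le> B" if "p \<in> ?K" "norm w \<le> 1" for p w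
      using B(2)[rule_format, OF imageI, of "(p, w)"] that by simp
    show ?thesis
    proof (intro exI[of _ "B / a ^ k"] conjI ballI allI impI)
      show "B / a ^ k > 0" using a(1) B(1) by simp
      fix p w x v assume p: "p \<in> ?K" and xv: "(x, v) = bundle_param A ?c (p, w)"
      have pc: "chart_inv ?c p \<in> fst ?c" using p c by auto
      define u where "u = (if w = 0 then 0 else (1 / norm w) *\<^sub>R w)"
      have u: "norm u \<le> 1" "w = norm w *\<^sub>R u" by (auto simp: u_def)
      have "coord_vec A ?c (chart_inv ?c p) (norm w *\<^sub>R u + 0 *\<^sub>R u) =
          (\<lambda>d. norm w *\<^sub>R coord_vec A ?c (chart_inv ?c p) u d)"
        unfolding coord_vec_combination[OF c(1) pc] by simp
      then have v: "v = (\<lambda>d. norm w *\<^sub>R coord_vec A ?c (chart_inv ?c p) u d)" and x: "x = chart_inv ?c p"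
        using xv u(2) by (auto simp: bundle_param_def)
      have "q (x, v) = norm w ^ k * q (bundle_param A ?c (p, u))"
        using q(2) c pc unfolding fibre_homogeneous_def v x by (auto simp: bundle_param_def)
      then have "\<bar>q (x, v)\<bar> \<le> norm w ^ k * B"
        using B'[OF p u(1)] by (simp add: abs_mult mult_left_mono)
      also have "\<dots> \<le> (sqrt (g x v v) / a) ^ k * B"
        using a(2)[OF p xv] a(1) B(1) by (intro mult_right_mono power_mono) (auto simp: field_simps)
      finally show "\<bar>q (x, v)\<bar> \<le> B / a ^ k * sqrt (g x v v) ^ k" by (simp add: power_divide mult.commute)
    qed
  qed
  then obtain C where C: "\<And>i. i < N \<Longrightarrow> C i > 0"
     "\<And>i p w x v. i < N \<Longrightarrow> p \<in> cball (z i) (r i) \<Longrightarrow> (x, v) = bundle_param A (cs i) (p, w) \<Longrightarrow> \<bar>q (x, v)\<bar> \<le> C i * sqrt (g x v v) ^ k"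
    by metis
  show ?thesis
  \<comment> \<open>The sum dominates each local constant; the summand 1 makes positivity
    immediate.\<close>
  proof (rule that[of "1 + (\<Sum>i<N. C i)"])
    show "1 + (\<Sum>i<N. C i) > 0" using C(1) by (intro add_pos_nonneg sum_nonneg) (auto intro: less_imp_le)
    fix x v assume v: "v \<in> T x"
    obtain i p where i: "i < N" "p \<in> ball (z i) (r i)" "x = chart_inv (cs i) p" using cov'(2) by blast
    have ci: "cs i \<in> A" "p \<in> chart_image (cs i)" "p \<in> cball (z i) (r i)"
      using cov[OF i(1)] i(2) by auto
    have "(x, v) = bundle_param A (cs i) (p, v (cs i))"
      using bundle_param_coordinates[of x v "cs i"] v ci i(3) by (auto simp: tangent_bundle_def)
    from C(2)[OF i(1) ci(3) this] have "\<bar>q (x, v)\<bar> \<le> C i * sqrt (g x v v) ^ k" .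
    also have "C i \<le> (\<Sum>i<N. C i)" using C(1) i(1) by (intro member_le_sum) (auto intro: less_imp_le)
    then have "C i * sqrt (g x v v) ^ k \<le> (1 + (\<Sum>i<N. C i)) * sqrt (g x v v) ^ k"
      using metric_nonneg[OF g v] by (intro mult_right_mono) auto
    finally show "\<bar>q (x, v)\<bar> \<le> (1 + (\<Sum>i<N. C i)) * sqrt (g x v v) ^ k" .
  qed
qed

end

subsection \<open>Limits of measures on the tangent bundle\<close>

text \<open>Compactifies a fibre: a homeomorphism onto the open unit ball, with the unit sphere as
  the directions at infinity. This normalization makes \<open>1 - (norm (shrink w))\<^sup>2\<close>
  the reciprocal of \<open>1 + (norm w)\<^sup>2\<close>.\<close>

definition shrink :: "'e::euclidean_space \<Rightarrow> 'e" where
  "shrink w = w /\<^sub>R sqrt (1 + (norm w)\<^sup>2)"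

definition expand :: "'e::euclidean_space \<Rightarrow> 'e" where
  "expand u = u /\<^sub>R sqrt (1 - (norm u)\<^sup>2)"

lemma norm_shrink_less_1: "norm (shrink w) < 1"
proof -
  have gen: "inverse s * n < 1" if "n < s" "0 < s" for s n :: real
    using that by (simp add: field_simps)
  have "norm w < sqrt (1 + (norm w)\<^sup>2)" by (rule real_less_rsqrt) simp
  moreover from this have "0 < sqrt (1 + (norm w)\<^sup>2)" by (rule le_less_trans[OF norm_ge_zero])
  ultimately show ?thesis
    using gen by (simp only: shrink_def norm_scaleR abs_inverse abs_of_pos)
qed

lemma one_minus_norm_shrink: "1 - (norm (shrink w))\<^sup>2 = 1 / (1 + (norm w)\<^sup>2)"
proof -
  have "1 + (norm w)\<^sup>2 > 0" by (simp add: add_pos_nonneg)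
  then show ?thesis
    by (simp add: shrink_def power_mult_distrib power_inverse divide_simps abs_of_nonneg)
qed

lemma expand_shrink [simp]: "expand (shrink w) = w"
proof -
  have "1 + (norm w)\<^sup>2 > 0" by (simp add: add_pos_nonneg)
  then show ?thesis
    unfolding expand_def one_minus_norm_shrink by (simp add: shrink_def real_sqrt_divide)
qed

lemma continuous_on_shrink: "continuous_on S shrink"
proof -
  have "sqrt (1 + (norm w)\<^sup>2) \<noteq> 0" for w :: 'a
    using add_pos_nonneg[of 1 "(norm w)\<^sup>2"] by (simp del: real_sqrt_eq_zero_cancel_iff add: less_imp_neq[symmetric])
  then show ?thesis unfolding shrink_def[abs_def] by (intro continuous_intros) auto
qed

lemma norm_less_1_square: "norm u < 1 \<Longrightarrow> 1 - (norm u)\<^sup>2 > 0"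
  using power_strict_mono[of "norm u" 1 2] by simp

lemma continuous_on_expand: "continuous_on (ball 0 1) expand"
  unfolding expand_def[abs_def]
  by (intro continuous_intros) (use norm_less_1_square in \<open>force simp: dist_norm\<close>)

text \<open>Read as an upper bound for \<open>1 / (1 + norm (expand u))\<close>: decay along the
  fibre becomes decay towards the sphere, at a rate that is continuous up to the boundary.\<close>

lemma norm_expand:
  assumes "norm u < 1"
  shows "sqrt (1 - (norm u)\<^sup>2) * (1 + norm (expand u)) \<ge> 1"
proof -
  let ?s = "sqrt (1 - (norm u)\<^sup>2)"
  have s: "?s > 0" using norm_less_1_square[OF assms] by simp
  have "?s * (1 + norm (expand u)) = ?s + norm u"
    using s by (simp add: expand_def field_simps)
  moreover have "(?s + norm u)\<^sup>2 = 1 + 2 * ?s * norm u"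
    using norm_less_1_square[OF assms] by (simp add: power2_sum)
  then have "1\<^sup>2 \<le> (?s + norm u)\<^sup>2" using s by simp
  then have "1 \<le> ?s + norm u" by (rule power2_le_imp_le) (use s in auto)
  ultimately show ?thesis by simp
qed

text \<open>Where \<open>b\<close> is positive, a relatively open condition, continuity is local;
  where \<open>b\<close> vanishes, \<open>f\<close> is squeezed to 0. Used with the zero set of
  \<open>b\<close> as the sphere at infinity.\<close>

lemma continuous_on_squeeze:
  fixes f b :: "'b::topological_space \<Rightarrow> real"
  assumes b: "continuous_on S b" and f: "continuous_on (S \<inter> {x. b x > 0}) f"
    and le: "\<And>x. x \<in> S \<Longrightarrow> \<bar>f x\<bar> \<le> b x"
  shows "continuous_on S f"
  unfolding continuous_on_def
proof
  fix x assume x: "x \<in> S"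
  have bx: "(b \<longlongrightarrow> b x) (at x within S)" using b x unfolding continuous_on_def by blast
  show "(f \<longlongrightarrow> f x) (at x within S)"
  proof (cases "b x > 0")
    case True
    obtain U where U: "open U" "S \<inter> {x. b x > 0} = S \<inter> U"
    proof -
      from b open_greaterThan[of 0] obtain U where "open U" "U \<inter> S = b -` {0<..} \<inter> S"
        unfolding continuous_on_open_invariant by blast
      then show ?thesis by (intro that[of U]) auto
    qed
    have "x \<in> S \<inter> U" using True x U(2) by blast
    then have "(f \<longlongrightarrow> f x) (at x within S \<inter> U)"
      using f unfolding U(2) continuous_on_def by blast
    moreover have "at x within S \<inter> U = at x within S"
      by (rule at_within_nhd[of _ U]) (use U(1) \<open>x \<in> S \<inter> U\<close> in auto)
    ultimately show ?thesis by simp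
  next
    case False
    then have "b x = 0" "f x = 0" using le[OF x] by auto
    then have "(b \<longlongrightarrow> 0) (at x within S)" using bx by simp
    then have "(f \<longlongrightarrow> 0) (at x within S)"
      by (rule Lim_null_comparison[rotated]) (use le in \<open>auto simp: eventually_at_filter\<close>)
    then show ?thesis using \<open>f x = 0\<close> by simp
  qed
qed

section \<open>Open sets of the tangent bundle in charts\<close>

context closed_smooth_manifold
begin

lemma openin_vimage_fst:
  assumes "open U"
  shows "openin (tangent_topology A) {z \<in> TM. fst z \<in> U}"
  unfolding openin_tangent_topology
proof (intro conjI ballI)
  fix c assume c: "c \<in> A"
  have "{z \<in> chart_image c \<times> UNIV. bundle_param A c z \<in> {z \<in> TM. fst z \<in> U}} =
     (snd c ` (fst c \<inter> U)) \<times> UNIV"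
    unfolding chart_image_Int[OF c] using c by (auto simp: bundle_param_def tangent_bundle_def)
  then show "open {z \<in> chart_image c \<times> UNIV. bundle_param A c z \<in> {z \<in> TM. fst z \<in> U}}"
    using open_Times[OF open_chart_image_Int[OF c assms] open_UNIV] by simp
qed auto

lemma continuous_on_trans_deriv:
  assumes "c \<in> A" "d \<in> A"
  shows "continuous_on (snd d ` (fst d \<inter> fst c) \<times> UNIV)
    (\<lambda>z. frechet_derivative (snd c \<circ> chart_inv d) (at (fst z)) (snd z))"
proof -
  let ?S = "snd d ` (fst d \<inter> fst c)"
  have C1: "Ck_on (Suc 0) ?S (snd c \<circ> chart_inv d)" using transition_Ck assms by blast
  have cont: "continuous_on ?S (\<lambda>p. frechet_derivative (snd c \<circ> chart_inv d) (at p) b)" for b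
    using C1 by simp
  have "continuous_on (?S \<times> UNIV)
    (\<lambda>z. \<Sum>b\<in>Basis. (snd z \<bullet> b) *\<^sub>R frechet_derivative (snd c \<circ> chart_inv d) (at (fst z)) b)"
    by (intro continuous_on_sum continuous_on_scaleR continuous_on_inner continuous_on_snd continuous_on_id
        continuous_on_const continuous_on_compose2[OF cont] continuous_on_fst) auto
  then show ?thesis
  proof (rule continuous_on_eq)
    fix z :: "'e \<times> 'e" assume "z \<in> ?S \<times> UNIV"
    then have "((snd c \<circ> chart_inv d) has_derivative frechet_derivative (snd c \<circ> chart_inv d) (at (fst z))) (at (fst z))"
      by (intro Ck_on_has_derivative[OF C1]) auto
    from linear_euclidean_sum[OF has_derivative_linear[OF this], of "snd z"]
    show "(\<Sum>b\<in>Basis. (snd z \<bullet> b) *\<^sub>R frechet_derivative (snd c \<circ> chart_inv d) (at (fst z)) b) =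
        frechet_derivative (snd c \<circ> chart_inv d) (at (fst z)) (snd z)" by (rule sym)
  qed
qed

lemma coord_vec_at: "d \<in> A \<Longrightarrow> x \<in> fst d \<Longrightarrow> coord_vec A c x w d = trans_deriv c d x w"
  by (simp add: coord_vec_apply)

lemma openin_bundle_chart:
  assumes c: "c \<in> A" and V: "open V"
  shows "openin (tangent_topology A) {z \<in> TM. fst z \<in> fst c \<and> (snd c (fst z), snd z c) \<in> V}"
  unfolding openin_tangent_topology
proof (intro conjI ballI)
  fix d assume d: "d \<in> A"
  let ?S = "snd d ` (fst d \<inter> fst c)"
  let ?f = "\<lambda>z. (snd c (chart_inv d (fst z)), frechet_derivative (snd c \<circ> chart_inv d) (at (fst z)) (snd z))"
  have S: "?S = {p \<in> chart_image d. chart_inv d p \<in> fst c}" by (rule chart_image_Int[OF d])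
  have "continuous_on ?S (snd c \<circ> chart_inv d)"
    using Ck_on_continuous[OF transition_Ck[OF d c]] .
  then have "continuous_on (?S \<times> UNIV) (\<lambda>z. (snd c \<circ> chart_inv d) (fst z))"
    by (rule continuous_on_compose2) (auto intro: continuous_on_fst continuous_on_id)
  then have "continuous_on (?S \<times> UNIV) ?f"
    using continuous_on_trans_deriv[OF c d] by (intro continuous_on_Pair) simp_all
  then have "open ((?S \<times> UNIV) \<inter> ?f -` V)"
    by (rule continuous_open_preimage) (use open_chart_image_Int[OF d chart_open(1)[OF c]] V in \<open>auto intro: open_Times\<close>)
  moreover have "{z \<in> chart_image d \<times> UNIV. bundle_param A d z \<in> {z \<in> TM. fst z \<in> fst c \<and> (snd c (fst z), snd z c) \<in> V}}
      = (?S \<times> UNIV) \<inter> ?f -` V"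
    unfolding S using c d by (auto simp: bundle_param_def tangent_bundle_def coord_vec_at)
  ultimately show "open {z \<in> chart_image d \<times> UNIV. bundle_param A d z \<in> {z \<in> TM. fst z \<in> fst c \<and> (snd c (fst z), snd z c) \<in> V}}"
    by simp
qed auto

end

section \<open>Coding the tangent bundle in a compact Euclidean set\<close>

locale closed_manifold_cover = closed_smooth_manifold A
  for A :: "('a::t2_space, 'e::euclidean_space) chart set" +
  fixes N :: nat and cs :: "nat \<Rightarrow> ('a, 'e) chart" and ctr :: "nat \<Rightarrow> 'e" and rad :: "nat \<Rightarrow> real"
  assumes cover_chart: "i < N \<Longrightarrow> cs i \<in> A" and cover_rad: "i < N \<Longrightarrow> 0 < rad i"
    and cover_cball2: "i < N \<Longrightarrow> cball (ctr i) (2 * rad i) \<subseteq> chart_image (cs i)"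
    and cover: "\<exists>i<N. x \<in> chart_inv (cs i) ` ball (ctr i) (rad i)"
begin

lemma cover_cball: "i < N \<Longrightarrow> cball (ctr i) (rad i) \<subseteq> chart_image (cs i)"
  using cover_cball2 cover_rad subset_cball[of "rad i" "2 * rad i" "ctr i"] by fastforce

definition "piece i = chart_inv (cs i) ` cball (ctr i) (rad i)"

text \<open>Taking the least index makes the choice of chart measurable: index \<open>i\<close>
  means lying in \<open>piece i\<close> and in no earlier piece.\<close>

definition "index x = (LEAST i. i < N \<and> x \<in> piece i)"

lemma index: "index x < N" "x \<in> piece (index x)"
proof -
  have "\<exists>i. i < N \<and> x \<in> piece i" using cover[of x] ball_subset_cball unfolding piece_def by blast
  from LeastI_ex[OF this] show "index x < N" "x \<in> piece (index x)" unfolding index_def by auto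
qed

lemma piece_subset: "i < N \<Longrightarrow> piece i \<subseteq> fst (cs i)"
  unfolding piece_def using cover_chart cover_cball chart_inv_in by blast

lemma closed_piece: "i < N \<Longrightarrow> closed (piece i)"
  unfolding piece_def
  by (intro compact_imp_closed compact_continuous_image compact_cball
      continuous_on_subset[OF continuous_on_chart_inv] cover_chart cover_cball)

lemma chart_piece: "i < N \<Longrightarrow> x \<in> piece i \<Longrightarrow> snd (cs i) x \<in> cball (ctr i) (rad i)"
proof -
  assume i: "i < N" and "x \<in> piece i"
  then obtain p where p: "p \<in> cball (ctr i) (rad i)" "x = chart_inv (cs i) p" unfolding piece_def by blast
  then have "p \<in> chart_image (cs i)" using cover_cball[OF i] by blast
  then show ?thesis using p chart_inv_right[OF cover_chart[OF i]] by (simp only:)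
qed

text \<open>The real coordinate records the chart, which keeps the finitely many local pictures
  disjoint inside one Euclidean space; the others are the base point and the compactified
  vector.\<close>

definition encode :: "'a \<times> ('a, 'e) tvec \<Rightarrow> real \<times> 'e \<times> 'e" where
  "encode = (\<lambda>(x, v). let c = cs (index x) in (real (index x), snd c x, shrink (v c)))"

definition decode :: "real \<times> 'e \<times> 'e \<Rightarrow> 'a \<times> ('a, 'e) tvec" where
  "decode = (\<lambda>(t, p, u). bundle_param A (cs (nat \<lfloor>t\<rfloor>)) (p, expand u))"

definition "codes = (\<Union>i<N. {real i} \<times> cball (ctr i) (rad i) \<times> cball (0 :: 'e) 1)"

definition "inner_codes = (\<Union>i<N. {real i} \<times> cball (ctr i) (rad i) \<times> ball (0 :: 'e) 1)"

lemma compact_codes: "compact codes"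
  unfolding codes_def by (intro compact_UN compact_Times) auto

lemma inner_codes_subset: "inner_codes \<subseteq> codes"
  unfolding codes_def inner_codes_def using ball_subset_cball by blast

lemma encode_apply:
  "encode (x, v) = (real (index x), snd (cs (index x)) x, shrink (v (cs (index x))))"
  unfolding encode_def by (simp only: prod.case Let_def)

lemma encode_in: "encode z \<in> inner_codes"
proof -
  obtain x v where z: "z = (x, v)" by fastforce
  have "shrink (v (cs (index x))) \<in> ball 0 1" using norm_shrink_less_1 by (simp add: dist_norm)
  then have "encode z \<in> {real (index x)} \<times> cball (ctr (index x)) (rad (index x)) \<times> ball 0 1"
    unfolding z encode_apply by (intro SigmaI singletonI chart_piece index)
  then show ?thesis unfolding inner_codes_def by (rule UN_I[rotated]) (simp add: index(1))
qed

lemma decode_encode: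
  assumes "z \<in> TM"
  shows "decode (encode z) = z"
proof -
  obtain x v where z: "z = (x, v)" by fastforce
  have "x \<in> fst (cs (index x))" using index piece_subset by blast
  from bundle_param_coordinates[OF assms[unfolded z] cover_chart[OF index(1)] this]
  show ?thesis unfolding z encode_apply decode_def by simp
qed

lemma decode_in:
  assumes "y \<in> inner_codes"
  shows "decode y \<in> TM"
proof -
  obtain i p u where y: "y = (real i, p, u)" "i < N" "p \<in> cball (ctr i) (rad i)"
    using assms unfolding inner_codes_def by blast
  then have "p \<in> chart_image (cs i)" using cover_cball by blast
  then show ?thesis using cover_chart[OF y(2)] by (simp add: y(1) decode_def)
qed

lemma encode_measurable [measurable]: "encode \<in> borel_measurable (tangent_borel A)"
proof (rule borel_measurableI)
  fix B :: "(real \<times> 'e \<times> 'e) set" assume B: "open B"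
  define D where "D i = {z \<in> TM. fst z \<in> piece i}" for i
  have D: "D i \<in> sets (tangent_borel A)" if "i < N" for i
  proof -
    have "D i = space (tangent_borel A) - {z \<in> TM. fst z \<in> - piece i}" unfolding D_def by auto
    also have "\<dots> \<in> sets (tangent_borel A)"
      by (intro sets.compl_sets sets_openin openin_vimage_fst open_Compl closed_piece that)
    finally show ?thesis .
  qed
  define V where "V i = {z \<in> TM. fst z \<in> fst (cs i) \<and>
     (snd (cs i) (fst z), snd z (cs i)) \<in> {(p, w). (real i, p, shrink w) \<in> B}}" for i
  have V: "V i \<in> sets (tangent_borel A)" if "i < N" for i
  proof -
    have "open ((\<lambda>y. (real i, fst y, shrink (snd y))) -` B)"
      by (intro open_vimage B continuous_intros continuous_on_compose2[OF continuous_on_shrink]) auto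
    moreover have "(\<lambda>y. (real i, fst y, shrink (snd y))) -` B = {(p, w). (real i, p, shrink w) \<in> B}"
      by auto
    ultimately have "open {(p, w). (real i, p, shrink w) \<in> B}" by simp
    then show ?thesis unfolding V_def by (intro sets_openin openin_bundle_chart cover_chart that)
  qed
  have "encode -` B \<inter> space (tangent_borel A) = (\<Union>i<N. (D i - (\<Union>j<i. D j)) \<inter> V i)"
  proof (intro equalityI subsetI)
    fix z assume z: "z \<in> encode -` B \<inter> space (tangent_borel A)"
    have "fst z \<notin> piece j" if "j < index (fst z)" for j
      using not_less_Least[of j "\<lambda>i. i < N \<and> fst z \<in> piece i"] that index(1)[of "fst z"] unfolding index_def by auto
    then have "z \<in> (D (index (fst z)) - (\<Union>j<index (fst z). D j)) \<inter> V (index (fst z))"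
      using z index[of "fst z"] piece_subset
      by (cases z) (auto simp: D_def V_def encode_apply)
    then show "z \<in> (\<Union>i<N. (D i - (\<Union>j<i. D j)) \<inter> V i)"
      using index(1)[of "fst z"] by blast
  next
    fix z assume "z \<in> (\<Union>i<N. (D i - (\<Union>j<i. D j)) \<inter> V i)"
    then obtain i where i: "i < N" "z \<in> D i" "z \<notin> (\<Union>j<i. D j)" "z \<in> V i" by auto
    have "index (fst z) = i"
      unfolding index_def by (rule Least_equality) (use i in \<open>auto simp: D_def not_less[symmetric]\<close>)
    then show "z \<in> encode -` B \<inter> space (tangent_borel A)"
      using i by (cases z) (auto simp: V_def encode_apply)
  qed
  also have "\<dots> \<in> sets (tangent_borel A)"
    using D V by (intro sets.finite_UN sets.Int sets.Diff) auto
  finally show "encode -` B \<inter> space (tangent_borel A) \<in> sets (tangent_borel A)" .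
qed

text \<open>Outside \<open>inner_codes\<close> the value is an arbitrary point of the bundle, chosen
  to have a measurable map into \<open>TM\<close>; the density used with this map later vanishes
  there.\<close>

definition decode_total :: "real \<times> 'e \<times> 'e \<Rightarrow> 'a \<times> ('a, 'e) tvec" where
  "decode_total y = (if y \<in> inner_codes then decode y else (undefined, \<lambda>c. 0))"

lemma inner_codes_sets [measurable]: "inner_codes \<in> sets borel"
proof -
  have "inner_codes = (\<Union>i<N. ({real i} \<times> UNIV) \<inter> (UNIV \<times> cball (ctr i) (rad i) \<times> UNIV) \<inter> (UNIV \<times> UNIV \<times> ball 0 1))"
    unfolding inner_codes_def by auto
  also have "\<dots> \<in> sets borel"
    by (intro sets.finite_UN sets.Int borel_closed borel_open open_Times closed_Times) auto
  finally show ?thesis .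
qed

lemma decode_total_measurable: "decode_total \<in> measurable borel (tangent_borel A)"
proof (rule measurable_into_tangent_borel)
  show "decode_total \<in> space borel \<rightarrow> TM"
    using decode_in zero_tangent by (auto simp: decode_total_def tangent_bundle_def)
  fix W assume W: "openin (tangent_topology A) W"
  define O' where "O' i = {q \<in> chart_image (cs i) \<times> ball 0 1. bundle_param A (cs i) (fst q, expand (snd q)) \<in> W}" for i
  have O': "open (O' i)" if i: "i < N" for i
  proof -
    have 1: "open {q \<in> chart_image (cs i) \<times> UNIV. bundle_param A (cs i) q \<in> W}"
      using W cover_chart[OF i] unfolding openin_tangent_topology by blast
    have 2: "continuous_on (chart_image (cs i) \<times> ball 0 1) (\<lambda>q. (fst q, expand (snd q)))"
      by (intro continuous_on_Pair continuous_on_fst continuous_on_id continuous_on_compose2[OF continuous_on_expand] continuous_on_snd) auto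
    have "open ((chart_image (cs i) \<times> ball 0 1) \<inter> (\<lambda>q. (fst q, expand (snd q))) -` {q \<in> chart_image (cs i) \<times> UNIV. bundle_param A (cs i) q \<in> W})"
      using chart_open(2)[OF cover_chart[OF i]] by (intro continuous_open_preimage[OF 2 _ 1] open_Times) auto
    also have "\<dots> = O' i" unfolding O'_def by auto
    finally show ?thesis .
  qed
  have "decode_total -` W \<inter> space borel =
     (\<Union>i<N. ({real i} \<times> UNIV) \<inter> (UNIV \<times> cball (ctr i) (rad i) \<times> UNIV) \<inter> (UNIV \<times> O' i)) \<union>
     (if (undefined, \<lambda>c. 0) \<in> W then - inner_codes else {})" (is "?L = ?R1 \<union> ?R2")
  proof -
    have gen: "L = R1 \<union> R2" if "\<And>y. y \<in> S \<Longrightarrow> y \<in> L \<longleftrightarrow> y \<in> R1" "R1 \<subseteq> S"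
      "\<And>y. y \<notin> S \<Longrightarrow> y \<in> L \<longleftrightarrow> y \<in> R2" "R2 \<inter> S = {}" for L R1 R2 S :: "(real \<times> 'e \<times> 'e) set"
      using that by blast
    show ?thesis
    proof (rule gen[of inner_codes])
      show "y \<in> decode_total -` W \<inter> space borel \<longleftrightarrow> y \<in> ?R1" if y: "y \<in> inner_codes" for y
      proof -
        obtain i p u where i: "y = (real i, p, u)" "i < N" "p \<in> cball (ctr i) (rad i)" "u \<in> ball 0 1"
          using y unfolding inner_codes_def by blast
        then have "p \<in> chart_image (cs i)" using cover_cball by blast
        then have "y \<in> decode_total -` W \<inter> space borel \<longleftrightarrow> (p, u) \<in> O' i"
          using y i by (simp add: decode_total_def decode_def O'_def)
        moreover have "y \<in> ?R1 \<longleftrightarrow> (p, u) \<in> O' i" using i by auto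
        ultimately show ?thesis by (simp only:)
      qed
      show "?R1 \<subseteq> inner_codes" unfolding inner_codes_def O'_def by auto
      show "y \<in> decode_total -` W \<inter> space borel \<longleftrightarrow> y \<in> ?R2" if "y \<notin> inner_codes" for y
        using that by (simp add: decode_total_def)
      show "?R2 \<inter> inner_codes = {}" by auto
    qed
  qed
  also have "\<dots> \<in> sets borel"
  proof (intro sets.Un sets.finite_UN)
    show "({real i} \<times> UNIV) \<inter> (UNIV \<times> cball (ctr i) (rad i) \<times> UNIV) \<inter> (UNIV \<times> O' i) \<in> sets borel"
      if "i \<in> {..<N}" for i
      using O' that by (intro sets.Int borel_closed[of "_ \<times> UNIV"] borel_closed[of "UNIV \<times> cball _ _ \<times> UNIV"]
          borel_open[of "UNIV \<times> O' i"] open_Times closed_Times) auto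
    show "?R2 \<in> sets borel" by (simp add: sets.compl_sets Compl_eq_Diff_UNIV)
  qed simp
  finally show "decode_total -` W \<inter> space borel \<in> sets borel" .
qed

lemma decode_total_encode: "z \<in> TM \<Longrightarrow> decode_total (encode z) = z"
  by (simp add: decode_total_def encode_in decode_encode)

text \<open>Here \<open>s\<close> is a metric norm and \<open>b\<close> a coordinate norm. Linear
  over quadratic growth decays like the inverse of the norm; the 2 comes from
  \<open>(1 + s)\<^sup>2 \<le> 2 * (1 + s\<^sup>2)\<close>.\<close>

lemma fraction_bound:
  fixes s b :: real
  assumes "0 \<le> s" "0 \<le> b" "0 < a" "a * b \<le> s"
  shows "(1 + s) / (1 + s\<^sup>2) \<le> 2 / (min 1 a * (1 + b))"
proof -
  have "(1 + s) / (1 + s\<^sup>2) \<le> 2 / (1 + s)"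
  proof -
    have "(1 + s) * (1 + s) \<le> 2 * (1 + s\<^sup>2)"
      using sum_squares_bound[of 1 s] by (simp add: power2_eq_square algebra_simps)
    moreover have "0 < 1 + s\<^sup>2" by (intro add_pos_nonneg) auto
    ultimately show ?thesis using assms(1) by (simp add: divide_le_eq pos_le_divide_eq mult.commute)
  qed
  also have "\<dots> \<le> 2 / (min 1 a * (1 + b))"
  proof (intro divide_left_mono)
    have "min 1 a * (1 + b) = min 1 a + min 1 a * b" by (simp add: algebra_simps)
    also have "\<dots> \<le> 1 + a * b" using assms by (intro add_mono mult_right_mono) auto
    finally show "min 1 a * (1 + b) \<le> 1 + s" using assms by simp
  qed (use assms in \<open>auto intro!: mult_pos_pos\<close>)
  finally show ?thesis .
qed

text \<open>The point of the compactification: linear growth divided by a quadratic weight tends to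
  0 uniformly at infinity over each compact piece, so the extension by 0 to the sphere is
  continuous.\<close>

lemma continuous_on_codes_weighted:
  assumes g: "riemannian_metric A g" and q: "bundle_continuous q"
    and growth: "\<And>x v. v \<in> T x \<Longrightarrow> \<bar>q (x, v)\<bar> \<le> C * (1 + sqrt (g x v v))"
  shows "continuous_on codes (\<lambda>y. if y \<in> inner_codes
     then q (decode y) / (1 + (case decode y of (x, v) \<Rightarrow> g x v v)) else 0)"
    (is "continuous_on codes ?f")
  unfolding codes_def
proof (rule continuous_on_closed_Union)
  fix i assume "i \<in> {..<N}"
  then have i: "i < N" by simp
  let ?c = "cs i" and ?K = "cball (ctr i) (rad i)"
  let ?P = "{real i} \<times> ?K \<times> cball (0::'e) 1"
  have c: "?c \<in> A" "?K \<subseteq> chart_image ?c" using cover_chart cover_cball i by auto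
  obtain a where a: "a > 0" "\<And>p w x v. p \<in> ?K \<Longrightarrow> (x, v) = bundle_param A ?c (p, w) \<Longrightarrow> a * norm w \<le> sqrt (g x v v)"
    using metric_lower_bound[OF g c(1) compact_cball c(2)] by metis
  have "C \<ge> 0"
  proof -
    have "0 \<le> C * (1 + sqrt (g undefined (\<lambda>c. 0) (\<lambda>c. 0)))"
      using growth[OF zero_tangent] abs_ge_zero order_trans by blast
    then show ?thesis by (simp add: metric_zero[OF g])
  qed
  \<comment> \<open>The product of the constants in \<open>growth\<close> and in
    \<open>fraction_bound\<close>.\<close>
  define B where "B = 2 * C / min 1 a"
  have B: "B \<ge> 0" using \<open>C \<ge> 0\<close> a(1) by (simp add: B_def)
  let ?h = "\<lambda>z. q z / (1 + (case z of (x, v) \<Rightarrow> g x v v))"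
  have dec: "decode (real i, p, u) = bundle_param A ?c (p, expand u)" for p u
    by (simp add: decode_def)
  have inner: "(real i, p, u) \<in> inner_codes \<longleftrightarrow> norm u < 1" if "p \<in> ?K" for p u
    using that i unfolding inner_codes_def by auto
  show "continuous_on ?P ?f"
  \<comment> \<open>The bound is positive only over the open unit ball, where continuity comes from
    the bundle chart; on the sphere it vanishes and forces the limit 0.\<close>
  proof (rule continuous_on_squeeze[where b = "\<lambda>y. B * sqrt (1 - (norm (snd (snd y)))\<^sup>2)"])
    show "continuous_on ?P (\<lambda>y. B * sqrt (1 - (norm (snd (snd y)))\<^sup>2))"
      by (intro continuous_intros)
    have "?P \<inter> {y. B * sqrt (1 - (norm (snd (snd y)))\<^sup>2) > 0} \<subseteq> {real i} \<times> ?K \<times> ball 0 1"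
    proof
      fix y assume y: "y \<in> ?P \<inter> {y. B * sqrt (1 - (norm (snd (snd y)))\<^sup>2) > 0}"
      then have "sqrt (1 - (norm (snd (snd y)))\<^sup>2) > 0" using B by (auto simp: zero_less_mult_iff)
      then have "(norm (snd (snd y)))\<^sup>2 < 1\<^sup>2" by simp
      then have "norm (snd (snd y)) < 1" by (rule power2_less_imp_less) simp
      then show "y \<in> {real i} \<times> ?K \<times> ball 0 1" using y by (auto simp: dist_norm)
    qed
    moreover have "continuous_on ({real i} \<times> ?K \<times> ball 0 1) ?f"
    proof (rule continuous_on_eq)
      have 1: "continuous_on (chart_image ?c \<times> UNIV) (\<lambda>z. ?h (bundle_param A ?c z))"
      proof (intro continuous_on_divide)
        show "continuous_on (chart_image ?c \<times> UNIV) (\<lambda>z. q (bundle_param A ?c z))"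
          using q c unfolding bundle_continuous_def by blast
        show "continuous_on (chart_image ?c \<times> UNIV) (\<lambda>z. 1 + (case bundle_param A ?c z of (x, v) \<Rightarrow> g x v v))"
          using bundle_continuous_metric[OF g] c unfolding bundle_continuous_def by (intro continuous_on_add continuous_on_const) blast
        show "\<forall>z\<in>chart_image ?c \<times> UNIV. 1 + (case bundle_param A ?c z of (x, v) \<Rightarrow> g x v v) \<noteq> 0"
        proof
          fix z :: "'e \<times> 'e" assume "z \<in> chart_image ?c \<times> UNIV"
          then have "bundle_param A ?c z \<in> TM" using c by auto
          then have "(case bundle_param A ?c z of (x, v) \<Rightarrow> g x v v) \<ge> 0"
            using metric_nonneg[OF g] by (auto simp: tangent_bundle_def)
          then show "1 + (case bundle_param A ?c z of (x, v) \<Rightarrow> g x v v) \<noteq> 0" by linarith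
        qed
      qed
      show "continuous_on ({real i} \<times> ?K \<times> ball 0 1) (\<lambda>y. ?h (bundle_param A ?c (fst (snd y), expand (snd (snd y)))))"
        by (rule continuous_on_compose2[OF 1])
           (use c(2) in \<open>auto intro!: continuous_intros continuous_on_compose2[OF continuous_on_expand]\<close>)
      show "\<And>y. y \<in> {real i} \<times> ?K \<times> ball 0 1 \<Longrightarrow> ?h (bundle_param A ?c (fst (snd y), expand (snd (snd y)))) = ?f y"
        using dec inner by auto
    qed
    ultimately show "continuous_on (?P \<inter> {y. B * sqrt (1 - (norm (snd (snd y)))\<^sup>2) > 0}) ?f"
      by (rule continuous_on_subset[rotated])
    fix y assume "y \<in> ?P"
    then obtain p u where y: "y = (real i, p, u)" "p \<in> ?K" "norm u \<le> 1" by auto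
    show "\<bar>?f y\<bar> \<le> B * sqrt (1 - (norm (snd (snd y)))\<^sup>2)"
    proof (cases "norm u < 1")
      case True
      obtain x v where xv: "(x, v) = bundle_param A ?c (p, expand u)" by (metis surj_pair)
      have v: "v \<in> T x"
        using bundle_param_in[OF c(1), of p "expand u"] c(2) y(2) unfolding xv[symmetric] by (auto simp: tangent_bundle_def)
      let ?s = "sqrt (g x v v)"
      have s: "?s\<^sup>2 = g x v v" "?s \<ge> 0" using metric_nonneg[OF g v] by auto
      have "?f y = q (x, v) / (1 + ?s\<^sup>2)"
        using True inner[OF y(2)] s(1) by (simp add: y(1) dec xv[symmetric])
      then have "\<bar>?f y\<bar> = \<bar>q (x, v)\<bar> / (1 + ?s\<^sup>2)"
        using s by (simp add: abs_of_nonneg)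
      also have "\<dots> \<le> C * (1 + ?s) / (1 + ?s\<^sup>2)"
        using growth[OF v] by (intro divide_right_mono) auto
      also have "\<dots> = C * ((1 + ?s) / (1 + ?s\<^sup>2))" by simp
      also have "\<dots> \<le> C * (2 / (min 1 a * (1 + norm (expand u))))"
        using a(2)[OF y(2) xv] a(1) s(2) \<open>C \<ge> 0\<close> by (intro mult_left_mono fraction_bound) auto
      also have "\<dots> = B * (1 / (1 + norm (expand u)))" by (simp add: B_def)
      also have "\<dots> \<le> B * sqrt (1 - (norm u)\<^sup>2)"
      proof -
        have "1 + norm (expand u) > 0" by (intro add_pos_nonneg) auto
        then have "1 / (1 + norm (expand u)) \<le> sqrt (1 - (norm u)\<^sup>2)"
          using norm_expand[OF True] by (simp only: pos_divide_le_eq)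
        then show ?thesis using B by (rule mult_left_mono)
      qed
      finally show ?thesis by (simp add: y(1))
    next
      case False
      then have "?f y = 0" using inner[OF y(2)] by (simp add: y(1))
      moreover have "0 \<le> B * sqrt (1 - (norm u)\<^sup>2)"
        using B y(3) by (intro mult_nonneg_nonneg) (auto simp: abs_square_le_1)
      ultimately show ?thesis by (simp add: y(1))
    qed
  qed
qed (auto intro!: closed_Times)

end

section \<open>Compactness of measures with bounded action\<close>

context closed_smooth_manifold
begin

lemma nn_integral_one_plus_metric:
  assumes g: "riemannian_metric A g" and M: "sets M = sets (tangent_borel A)"
  shows "(\<integral>\<^sup>+z. ennreal (1 + (case z of (x, v) \<Rightarrow> g x v v)) \<partial>M) =
    emeasure M (space M) + (\<integral>\<^sup>+z. ennreal (case z of (x, v) \<Rightarrow> g x v v) \<partial>M)"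
proof -
  have sp: "space M = TM" using sets_eq_imp_space_eq[OF M] by simp
  have gm: "(\<lambda>z. case z of (x, v) \<Rightarrow> g x v v) \<in> borel_measurable M"
    unfolding measurable_cong_sets[OF M refl] by (rule bundle_continuous_measurable[OF bundle_continuous_metric[OF g]])
  have "(\<integral>\<^sup>+z. ennreal (1 + (case z of (x, v) \<Rightarrow> g x v v)) \<partial>M) =
      (\<integral>\<^sup>+z. 1 + ennreal (case z of (x, v) \<Rightarrow> g x v v) \<partial>M)"
  proof (rule nn_integral_cong)
    fix z assume "z \<in> space M"
    then have "0 \<le> (case z of (x, v) \<Rightarrow> g x v v)"
      using metric_nonneg[OF g] unfolding sp by (auto simp: tangent_bundle_def)
    then show "ennreal (1 + (case z of (x, v) \<Rightarrow> g x v v)) = 1 + ennreal (case z of (x, v) \<Rightarrow> g x v v)"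
      by simp
  qed
  also have "\<dots> = (\<integral>\<^sup>+z. 1 \<partial>M) + (\<integral>\<^sup>+z. ennreal (case z of (x, v) \<Rightarrow> g x v v) \<partial>M)"
    using gm by (intro nn_integral_add) auto
  finally show ?thesis by simp
qed

end

context closed_manifold_cover
begin

text \<open>The probability measures with density \<open>\<Lambda> z / Z k\<close> are carried to
  the compact set of codes, where a subsequence converges. The limit may charge the sphere at
  infinity, a trace of escaping action. Dropping that part and dividing the weight out gives
  \<open>M\<close>: an inequality for the action, but convergence for every \<open>q\<close> of
  linear growth, whose weighted version vanishes on the sphere.\<close>

lemma tangent_measures_compact:
  assumes g: "riemannian_metric A g"
    and \<mu>: "\<And>k. prob_space (\<mu> k)" "\<And>k. sets (\<mu> k) = sets (tangent_borel A)"
    and e: "\<And>k. (\<integral>\<^sup>+z. ennreal (case z of (x, v) \<Rightarrow> g x v v) \<partial>\<mu> k) = ennreal (e k)" "\<And>k. 0 \<le> e k" "e \<longlonglongrightarrow> l"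
  obtains r M where "strict_mono (r :: nat \<Rightarrow> nat)" "prob_space M" "sets M = sets (tangent_borel A)"
    "(\<integral>\<^sup>+z. ennreal (case z of (x, v) \<Rightarrow> g x v v) \<partial>M) \<le> ennreal l"
    "\<forall>q C. bundle_continuous q \<longrightarrow> (\<forall>x. \<forall>v\<in>T x. \<bar>q (x, v)\<bar> \<le> C * (1 + sqrt (g x v v))) \<longrightarrow>
       (\<lambda>k. LINT z|\<mu> (r k). q z) \<longlonglongrightarrow> (LINT z|M. q z)"
proof -
  define \<Lambda> where "\<Lambda> z = 1 + (case z of (x, v) \<Rightarrow> g x v v)" for z :: "'a \<times> ('a, 'e) tvec"
  define Z where "Z k = 1 + e k" for k
  define Zl where "Zl = 1 + l"
  have l: "l \<ge> 0" using LIMSEQ_le_const[OF e(3)] e(2) by blast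
  have Z: "Z k > 0" for k unfolding Z_def using e(2)[of k] by simp
  have Zl: "Zl > 0" "Z \<longlonglongrightarrow> Zl" unfolding Zl_def Z_def[abs_def] using l e(3) by (auto intro: tendsto_intros)
  have gm: "(\<lambda>z. case z of (x, v) \<Rightarrow> g x v v) \<in> borel_measurable (tangent_borel A)"
    by (rule bundle_continuous_measurable[OF bundle_continuous_metric[OF g]])
  have \<Lambda>m: "\<Lambda> \<in> borel_measurable (tangent_borel A)"
    unfolding \<Lambda>_def[abs_def] using gm by measurable
  have \<Lambda>1: "\<Lambda> z \<ge> 1" if "z \<in> TM" for z
    using that metric_nonneg[OF g] unfolding \<Lambda>_def by (auto simp: tangent_bundle_def)
  have sp: "space (\<mu> k) = TM" for k using sets_eq_imp_space_eq[OF \<mu>(2)] by simp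
  have meas: "f \<in> borel_measurable (\<mu> k)" if "f \<in> borel_measurable (tangent_borel A)" for f :: "_ \<Rightarrow> real" and k
    using that by (simp add: measurable_cong_sets[OF \<mu>(2) refl])
  have enc: "encode \<in> borel_measurable (\<mu> k)" for k
    using encode_measurable by (simp add: measurable_cong_sets[OF \<mu>(2) refl])
  have \<Lambda>int: "(\<integral>\<^sup>+z. ennreal (\<Lambda> z) \<partial>\<mu> k) = ennreal (Z k)" for k
    unfolding \<Lambda>_def using nn_integral_one_plus_metric[OF g \<mu>(2)] e(1)[of k] prob_space.emeasure_space_1[OF \<mu>(1)] e(2)[of k]
    by (simp add: Z_def)
  define dens where "dens k = density (\<mu> k) (\<lambda>z. ennreal (\<Lambda> z / Z k))" for k
  define \<nu> where "\<nu> k = distr (dens k) borel encode" for k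
  have encd: "encode \<in> borel_measurable (dens k)" for k
    unfolding dens_def using enc by simp
  have dens_prob: "prob_space (dens k)" for k
  proof
    have "emeasure (dens k) (space (dens k)) = (\<integral>\<^sup>+z. ennreal (\<Lambda> z / Z k) \<partial>\<mu> k)"
      unfolding dens_def using meas[OF \<Lambda>m, of k] by (subst emeasure_density) (auto intro!: nn_integral_cong)
    also have "\<dots> = (\<integral>\<^sup>+z. ennreal (1 / Z k) * ennreal (\<Lambda> z) \<partial>\<mu> k)"
      using Z[of k] by (intro nn_integral_cong) (simp add: ennreal_mult'[symmetric])
    also have "\<dots> = ennreal (1 / Z k) * ennreal (Z k)"
      using meas[OF \<Lambda>m, of k] \<Lambda>int[of k] by (subst nn_integral_cmult) auto
    also have "\<dots> = 1" using Z[of k] by (simp add: ennreal_mult'[symmetric])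
    finally show "emeasure (dens k) (space (dens k)) = 1" .
  qed
  have \<nu>: "prob_space (\<nu> k)" "sets (\<nu> k) = sets borel" "AE y in \<nu> k. y \<in> codes" for k
  proof -
    show "prob_space (\<nu> k)" unfolding \<nu>_def by (rule prob_space.prob_space_distr[OF dens_prob encd])
    show "AE y in \<nu> k. y \<in> codes"
      unfolding \<nu>_def by (subst AE_distr_iff[OF encd])
        (use borel_closed[OF compact_imp_closed[OF compact_codes]] inner_codes_subset encode_in in \<open>auto intro!: AE_I2\<close>)
  qed (simp add: \<nu>_def)
  obtain r \<nu>' where r: "strict_mono (r :: nat \<Rightarrow> nat)" and \<nu>': "prob_space \<nu>'" "sets \<nu>' = sets borel" "AE y in \<nu>'. y \<in> codes"
    and conv: "\<And>f :: _ \<Rightarrow> real. continuous_on codes f \<Longrightarrow> (\<lambda>n. LINT y:codes|\<nu> (r n). f y) \<longlonglongrightarrow> (LINT y:codes|\<nu>'. f y)"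
    by (rule weakly_convergent_subsequence_on_compact[OF compact_codes \<nu>]) (rule that)
  \<comment> \<open>Undoes the weighting in the limit; the indicator removes the sphere at
    infinity.\<close>
  define w where "w y = indicator inner_codes y * (Zl / \<Lambda> (decode_total y))" for y
  have \<Lambda>dm: "(\<lambda>y. \<Lambda> (decode_total y)) \<in> borel_measurable borel"
    by (rule measurable_compose[OF decode_total_measurable \<Lambda>m])
  have dt: "decode_total y \<in> TM" for y
    using measurable_space[OF decode_total_measurable, of y] by simp
  have wm: "w \<in> borel_measurable borel"
    unfolding w_def[abs_def] using \<Lambda>dm inner_codes_sets by measurable
  have w0: "w y \<ge> 0" for y
    using \<Lambda>1[OF dt[of y]] Zl by (auto simp: w_def intro!: mult_nonneg_nonneg divide_nonneg_nonneg)
  have \<nu>'meas: "f \<in> measurable \<nu>' N" if "f \<in> measurable borel N" for f :: "_ \<Rightarrow> 'c" and N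
    using that by (simp add: measurable_cong_sets[OF \<nu>'(2) refl])
  define M where "M = distr (density \<nu>' (\<lambda>y. ennreal (w y))) (tangent_borel A) decode_total"
  have dtm: "decode_total \<in> measurable (density \<nu>' (\<lambda>y. ennreal (w y))) (tangent_borel A)"
    using \<nu>'meas[OF decode_total_measurable] by simp
  have M: "sets M = sets (tangent_borel A)" unfolding M_def by simp
  have \<Lambda>M: "(\<integral>\<^sup>+z. ennreal (\<Lambda> z) \<partial>M) \<le> ennreal Zl"
  proof -
    have "(\<integral>\<^sup>+z. ennreal (\<Lambda> z) \<partial>M) = (\<integral>\<^sup>+y. ennreal (w y) * ennreal (\<Lambda> (decode_total y)) \<partial>\<nu>')"
      unfolding M_def using \<Lambda>m \<nu>'meas[OF wm] \<nu>'meas[OF \<Lambda>dm]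
      by (subst nn_integral_distr[OF dtm]) (auto simp: nn_integral_density)
    \<comment> \<open>Equality may fail here: the right-hand side also counts the mass on the sphere
      at infinity.\<close>
    also have "\<dots> \<le> (\<integral>\<^sup>+y. ennreal Zl \<partial>\<nu>')"
    proof (rule nn_integral_mono)
      fix y
      have "w y * \<Lambda> (decode_total y) \<le> Zl"
        using \<Lambda>1[OF dt[of y]] Zl by (simp add: w_def indicator_def)
      then show "ennreal (w y) * ennreal (\<Lambda> (decode_total y)) \<le> ennreal Zl"
        using w0 \<Lambda>1[OF dt[of y]] by (simp add: ennreal_mult'[symmetric] ennreal_leI)
    qed
    also have "\<dots> = ennreal Zl" using prob_space.emeasure_space_1[OF \<nu>'(1)] by simp
    finally show ?thesis .
  qed
  have lim: "(\<lambda>k. LINT z|\<mu> (r k). q z) \<longlonglongrightarrow> (LINT z|M. q z)"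
    if q: "bundle_continuous q" and growth: "\<And>x v. v \<in> T x \<Longrightarrow> \<bar>q (x, v)\<bar> \<le> C * (1 + sqrt (g x v v))" for q C
  proof -
    define f where "f y = indicator inner_codes y * (q (decode_total y) / \<Lambda> (decode_total y))" for y
    have qm: "q \<in> borel_measurable (tangent_borel A)" by (rule bundle_continuous_measurable[OF q])
    have qdm: "(\<lambda>y. q (decode_total y)) \<in> borel_measurable borel"
      by (rule measurable_compose[OF decode_total_measurable qm])
    have fm: "f \<in> borel_measurable borel"
      unfolding f_def[abs_def] using qdm \<Lambda>dm inner_codes_sets by measurable
    have f_eq: "f = (\<lambda>y. if y \<in> inner_codes then q (decode y) / (1 + (case decode y of (x, v) \<Rightarrow> g x v v)) else 0)"
      by (auto simp: f_def \<Lambda>_def decode_total_def)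
    have "continuous_on codes f"
      unfolding f_eq by (rule continuous_on_codes_weighted[OF g q growth])
    then have "(\<lambda>n. LINT y:codes|\<nu> (r n). f y) \<longlonglongrightarrow> (LINT y:codes|\<nu>'. f y)" by (rule conv)
    moreover have "(LINT y:codes|N. f y) = (LINT y|N. f y)" for N
      unfolding set_lebesgue_integral_def using inner_codes_subset
      by (intro Bochner_Integration.integral_cong) (auto simp: f_def indicator_def)
    moreover have "(LINT y|\<nu> k. f y) = (LINT z|\<mu> k. q z) / Z k" for k
    proof -
      have "(LINT y|\<nu> k. f y) = (LINT z|dens k. f (encode z))"
        unfolding \<nu>_def by (rule integral_distr[OF encd fm])
      also have "\<dots> = (LINT z|\<mu> k. (\<Lambda> z / Z k) *\<^sub>R f (encode z))"
        unfolding dens_def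
        using measurable_compose[OF enc fm, of k] meas[OF \<Lambda>m, of k] order_trans[OF zero_le_one \<Lambda>1] Z[of k]
        by (intro integral_density) (auto simp: sp intro!: AE_I2 divide_nonneg_nonneg)
      also have "\<dots> = (LINT z|\<mu> k. q z / Z k)"
      proof (rule Bochner_Integration.integral_cong[OF refl])
        fix z assume "z \<in> space (\<mu> k)"
        then have z: "z \<in> TM" by (simp add: sp)
        show "(\<Lambda> z / Z k) *\<^sub>R f (encode z) = q z / Z k"
          using \<Lambda>1[OF z] by (simp add: f_def encode_in decode_total_encode[OF z])
      qed
      finally show ?thesis by simp
    qed
    ultimately have "(\<lambda>k. (LINT z|\<mu> (r k). q z) / Z (r k)) \<longlonglongrightarrow> (LINT y|\<nu>'. f y)" by simp
    from tendsto_mult[OF this LIMSEQ_subseq_LIMSEQ[OF Zl(2) r]]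
    have "(\<lambda>k. LINT z|\<mu> (r k). q z) \<longlonglongrightarrow> (LINT y|\<nu>'. f y) * Zl"
      using Z by (simp add: o_def less_imp_neq[symmetric])
    moreover have "(LINT z|M. q z) = (LINT y|\<nu>'. f y) * Zl"
    proof -
      have "(LINT z|M. q z) = (LINT y|density \<nu>' (\<lambda>y. ennreal (w y)). q (decode_total y))"
        unfolding M_def by (rule integral_distr[OF dtm qm])
      also have "\<dots> = (LINT y|\<nu>'. w y *\<^sub>R q (decode_total y))"
        using \<nu>'meas[OF qdm] \<nu>'meas[OF wm] w0 by (intro integral_density) auto
      also have "\<dots> = (LINT y|\<nu>'. f y * Zl)"
        by (intro Bochner_Integration.integral_cong) (auto simp: w_def f_def)
      finally show ?thesis by simp
    qed
    ultimately show ?thesis by simp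
  qed
  have "emeasure M (space M) \<le> (\<integral>\<^sup>+z. ennreal (\<Lambda> z) \<partial>M)"
    using nn_integral_one_plus_metric[OF g M] unfolding \<Lambda>_def by simp
  then have fin: "emeasure M (space M) < \<infinity>" using \<Lambda>M le_less_trans ennreal_less_top by (metis infinity_ennreal_def order_trans)
  have prob: "prob_space M"
  proof
    \<comment> \<open>The constant 1 is a test function of linear growth, so no mass of the
      unweighted measures escapes.\<close>
    have "(\<lambda>k. LINT z|\<mu> (r k). 1 :: real) \<longlonglongrightarrow> (LINT z|M. 1)"
      by (rule lim[OF bundle_continuous_const, of _ 1]) (use metric_nonneg[OF g] in auto)
    then have "(\<lambda>k :: nat. 1 :: real) \<longlonglongrightarrow> measure M (space M)"
      using prob_space.prob_space[OF \<mu>(1)] by simp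
    then have "measure M (space M) = 1" using LIMSEQ_unique tendsto_const by blast
    then show "emeasure M (space M) = 1" using fin by (simp add: emeasure_eq_ennreal_measure)
  qed
  have "1 + (\<integral>\<^sup>+z. ennreal (case z of (x, v) \<Rightarrow> g x v v) \<partial>M) \<le> 1 + ennreal l"
    using \<Lambda>M nn_integral_one_plus_metric[OF g M] prob_space.emeasure_space_1[OF prob] l
    unfolding \<Lambda>_def Zl_def by simp
  then have "(\<integral>\<^sup>+z. ennreal (case z of (x, v) \<Rightarrow> g x v v) \<partial>M) \<le> ennreal l"
    by (simp add: ennreal_add_left_cancel_le)
  then show ?thesis using lim by (intro that[OF r prob M]) blast+
qed

end

subsection \<open>Existence of Mather measures\<close>

context closed_smooth_manifold
begin

lemma action_eq:
  assumes g: "riemannian_metric A g" and M: "sets M = sets (tangent_borel A)"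
  shows "(\<integral>\<^sup>+z. ennreal (case z of (x, v) \<Rightarrow> g x v v) \<partial>M) = 2 * action g M"
proof -
  have sp: "space M = TM" using sets_eq_imp_space_eq[OF M] by simp
  have gm: "(\<lambda>z. case z of (x, v) \<Rightarrow> g x v v) \<in> borel_measurable M"
    unfolding measurable_cong_sets[OF M refl] by (rule bundle_continuous_measurable[OF bundle_continuous_metric[OF g]])
  have "(\<integral>\<^sup>+z. ennreal (case z of (x, v) \<Rightarrow> g x v v) \<partial>M) = (\<integral>\<^sup>+z. 2 * ennreal (lagrangian g z) \<partial>M)"
  proof (rule nn_integral_cong)
    fix z
    have "2 * ennreal (lagrangian g z) = ennreal 2 * ennreal (lagrangian g z)" by simp
    also have "\<dots> = ennreal (2 * lagrangian g z)" by (rule ennreal_mult'[symmetric]) simp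
    finally show "ennreal (case z of (x, v) \<Rightarrow> g x v v) = 2 * ennreal (lagrangian g z)"
      by (simp add: lagrangian_def case_prod_beta)
  qed
  also have "\<dots> = 2 * action g M"
    unfolding action_def using gm
    by (intro nn_integral_cmult) (auto simp: lagrangian_def case_prod_beta)
  finally show ?thesis .
qed

lemma closed_measures_sets: "\<mu> \<in> closed_measures A g \<Longrightarrow> prob_space \<mu> \<and> sets \<mu> = sets (tangent_borel A)"
  unfolding closed_measures_def by blast

lemma sqrt_metric_integral_finite:
  assumes g: "riemannian_metric A g" and M: "sets M = sets (tangent_borel A)" "prob_space M"
    and fin: "(\<integral>\<^sup>+z. ennreal (case z of (x, v) \<Rightarrow> g x v v) \<partial>M) < \<infinity>"
  shows "(\<integral>\<^sup>+(x, v). ennreal (sqrt (g x v v)) \<partial>M) < \<infinity>"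
proof -
  have "(\<integral>\<^sup>+(x, v). ennreal (sqrt (g x v v)) \<partial>M) \<le> (\<integral>\<^sup>+z. ennreal (1 + (case z of (x, v) \<Rightarrow> g x v v)) \<partial>M)"
  proof (rule nn_integral_mono)
    fix z assume "z \<in> space M"
    then obtain x v where z: "z = (x, v)" "v \<in> T x"
      using sets_eq_imp_space_eq[OF M(1)] by (auto simp: tangent_bundle_def)
    have "sqrt (g x v v) \<le> 1 + g x v v"
      using metric_nonneg[OF g z(2)] by (intro real_le_lsqrt) (auto simp: power2_eq_square algebra_simps)
    then show "(case z of (x, v) \<Rightarrow> ennreal (sqrt (g x v v))) \<le> ennreal (1 + (case z of (x, v) \<Rightarrow> g x v v))"
      by (simp add: z ennreal_leI)
  qed
  also have "\<dots> < \<infinity>"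
    using fin prob_space.emeasure_space_1[OF M(2)] by (simp add: nn_integral_one_plus_metric[OF g M(1)])
  finally show ?thesis .
qed

text \<open>The direct method: closedness and the rotation vector are integrals of functions of
  degree 1 in the fibre and survive the limit, while the action can only drop. Finite first momentum
  of the limit follows from its finite action.\<close>

lemma mather_measure_exists:
  assumes g: "riemannian_metric A g"
    and fin: "(INF \<mu>\<in>measures_with_rotation A g h. action g \<mu>) < \<infinity>"
  shows "mather_measures A g h \<noteq> {}"
proof -
  let ?S = "measures_with_rotation A g h"
  define \<beta> where "\<beta> = (INF \<mu>\<in>?S. action g \<mu>)"
  have ne: "?S \<noteq> {}" using fin by auto
  obtain f where f: "\<And>n. f n \<in> ?S" "(\<lambda>n. action g (f n)) \<longlonglongrightarrow> \<beta>"
  proof -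
    obtain u where u: "range u \<subseteq> action g ` ?S" "u \<longlonglongrightarrow> \<beta>"
      using Inf_as_limit[of "action g ` ?S"] ne unfolding \<beta>_def by blast
    have "\<exists>\<mu>. \<mu> \<in> ?S \<and> action g \<mu> = u n" for n using u(1) by (metis imageE rangeI subsetD)
    then obtain f where "\<And>n. f n \<in> ?S \<and> action g (f n) = u n" by metis
    then show ?thesis using u(2) by (intro that[of f]) auto
  qed
  have \<beta>: "\<beta> < \<infinity>" using fin by (simp add: \<beta>_def)
  \<comment> \<open>The first terms of the minimizing sequence may have infinite action; they are
    cut off in order to pass to real numbers.\<close>
  obtain n0 where n0: "\<And>n. n \<ge> n0 \<Longrightarrow> action g (f n) < \<infinity>"
    using order_tendstoD(2)[OF f(2) \<beta>] unfolding eventually_sequentially by blast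
  define \<mu> where "\<mu> n = f (n + n0)" for n
  have \<mu>S: "\<mu> n \<in> ?S" for n unfolding \<mu>_def by (rule f)
  then have \<mu>: "prob_space (\<mu> n)" "sets (\<mu> n) = sets (tangent_borel A)" for n
    unfolding measures_with_rotation_def using closed_measures_sets by auto
  define e where "e n = 2 * enn2real (action g (\<mu> n))" for n
  have act: "action g (\<mu> n) = ennreal (enn2real (action g (\<mu> n)))" for n
    using n0[of "n + n0"] by (simp add: \<mu>_def)
  have e0: "0 \<le> e n" for n by (simp add: e_def)
  have e1: "(\<integral>\<^sup>+z. ennreal (case z of (x, v) \<Rightarrow> g x v v) \<partial>\<mu> n) = ennreal (e n)" for n
    unfolding action_eq[OF g \<mu>(2)] e_def by (subst act) (simp add: ennreal_mult')
  have "(\<lambda>n. action g (\<mu> n)) \<longlonglongrightarrow> \<beta>" unfolding \<mu>_def using f(2) by (rule LIMSEQ_ignore_initial_segment)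
  moreover have "ennreal (enn2real \<beta>) = \<beta>" using \<beta> by simp
  ultimately have "(\<lambda>n. enn2real (action g (\<mu> n))) \<longlonglongrightarrow> enn2real \<beta>"
    by (intro tendsto_enn2real) (simp_all only: enn2real_nonneg)
  then have e2: "e \<longlonglongrightarrow> 2 * enn2real \<beta>" unfolding e_def[abs_def] by (rule tendsto_mult[OF tendsto_const])
  obtain N :: nat and cs z r where cov:
    "\<And>i. i < N \<Longrightarrow> cs i \<in> A \<and> 0 < (r i :: real) \<and> cball (z i) (2 * r i) \<subseteq> chart_image (cs i)"
    "\<And>x. \<exists>i<N. x \<in> chart_inv (cs i) ` ball (z i) (r i)"
    by (rule finite_ball_cover) (rule that)
  interpret closed_manifold_cover A N cs z r
    by unfold_locales (use cov in blast)+
  obtain s M where M: "strict_mono (s :: nat \<Rightarrow> nat)" "prob_space M" "sets M = sets (tangent_borel A)"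
    "(\<integral>\<^sup>+z. ennreal (case z of (x, v) \<Rightarrow> g x v v) \<partial>M) \<le> ennreal (2 * enn2real \<beta>)"
    and lim: "\<forall>q C. bundle_continuous q \<longrightarrow> (\<forall>x. \<forall>v\<in>T x. \<bar>q (x, v)\<bar> \<le> C * (1 + sqrt (g x v v))) \<longrightarrow>
       (\<lambda>k. LINT z|\<mu> (s k). q z) \<longlonglongrightarrow> (LINT z|M. q z)"
    by (rule tangent_measures_compact[OF g \<mu> e1 e0 e2]) (rule that)
  \<comment> \<open>A constraint has the same value along the whole sequence, so convergence
    identifies its value on the limit.\<close>
  have eqI: "(LINT z|M. q z) = a"
    if q: "bundle_continuous q" "fibre_homogeneous 1 q" and a: "\<And>n. (LINT z|\<mu> n. q z) = a" for q a
  proof -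
    obtain C where C: "C > 0" "\<And>x v. v \<in> T x \<Longrightarrow> \<bar>q (x, v)\<bar> \<le> C * sqrt (g x v v) ^ 1"
      using homogeneous_growth[OF g q] by blast
    have "(\<lambda>k. LINT z|\<mu> (s k). q z) \<longlonglongrightarrow> (LINT z|M. q z)"
    proof (rule lim[rule_format, OF q(1)])
      fix x v assume "v \<in> T x"
      from C(2)[OF this] C(1) show "\<bar>q (x, v)\<bar> \<le> C * (1 + sqrt (g x v v))" by (simp add: distrib_left)
    qed
    then show ?thesis using a LIMSEQ_unique[OF _ tendsto_const] by simp
  qed
  have "M \<in> closed_measures A g"
    unfolding closed_measures_def
  proof (intro CollectI conjI allI impI M)
    show "(\<integral>\<^sup>+(x, v). ennreal (sqrt (g x v v)) \<partial>M) < \<infinity>"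
      using M(4) by (intro sqrt_metric_integral_finite[OF g M(3,2)]) (auto intro: le_less_trans)
    fix f assume "manifold_Ck A 1 UNIV f"
    moreover from this have "(LINT (x, v)|\<mu> n. differential A f x v) = 0" for n
      using \<mu>S[of n] unfolding measures_with_rotation_def closed_measures_def by blast
    ultimately show "(LINT (x, v)|M. differential A f x v) = 0"
      by (intro eqI bundle_continuous_differential)
  qed
  moreover have "has_rotation_vector A M h"
    unfolding has_rotation_vector_def
  proof (intro conjI allI impI)
    show "h \<in> H1" using \<mu>S[of 0] unfolding measures_with_rotation_def has_rotation_vector_def by blast
    fix \<eta> assume \<eta>: "closed_1form A \<eta>"
    then have "smooth_1form A \<eta>" by (simp add: closed_1form_def)
    moreover have "(LINT (x, v)|\<mu> n. \<eta> x v) = pairing A \<eta> h" for n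
      using \<mu>S[of n] \<eta> unfolding measures_with_rotation_def has_rotation_vector_def by auto
    ultimately show "pairing A \<eta> h = (LINT (x, v)|M. \<eta> x v)"
      by (intro eqI[symmetric] bundle_continuous_form)
  qed
  ultimately have MS: "M \<in> ?S" unfolding measures_with_rotation_def by blast
  have "2 * action g M \<le> ennreal (2 * enn2real \<beta>)"
    using M(4) unfolding action_eq[OF g M(3)] .
  also have "\<dots> = 2 * ennreal (enn2real \<beta>)" by (simp add: ennreal_mult')
  finally have "action g M \<le> ennreal (enn2real \<beta>)"
    by (simp add: ennreal_mult_le_mult_iff)
  moreover have "ennreal (enn2real \<beta>) = \<beta>" using \<beta> by simp
  moreover have "\<beta> \<le> action g M" unfolding \<beta>_def using MS by (rule INF_lower)
  ultimately have "action g M = ennreal (mather_beta A g h)"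
    unfolding mather_beta_def \<beta>_def[symmetric] by simp
  then show ?thesis using MS unfolding mather_measures_def by blast
qed

end

subsection \<open>Real chains and cocycles\<close>

definition chain_eval :: "('s \<Rightarrow> real) \<Rightarrow> ('s \<Rightarrow>\<^sub>0 real) \<Rightarrow> real" where
  "chain_eval \<theta> c = (\<Sum>\<sigma>\<in>Poly_Mapping.keys c. Poly_Mapping.lookup c \<sigma> * \<theta> \<sigma>)"

definition chain_scale :: "real \<Rightarrow> ('s \<Rightarrow>\<^sub>0 real) \<Rightarrow> ('s \<Rightarrow>\<^sub>0 real)" where
  "chain_scale r c = Poly_Mapping.map ((*) r) c"

lemma lookup_chain_scale [simp]: "Poly_Mapping.lookup (chain_scale r c) \<sigma> = r * Poly_Mapping.lookup c \<sigma>"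
  by (simp add: chain_scale_def map.rep_eq when_def)

lemma keys_chain_scale: "Poly_Mapping.keys (chain_scale r c) \<subseteq> Poly_Mapping.keys c"
  by (auto simp: in_keys_iff)

text \<open>Makes bases and the extension of linear functionals available for real chains.\<close>

interpretation chain_space: vector_space chain_scale
  by unfold_locales (auto intro!: poly_mapping_eqI simp: lookup_add algebra_simps)

interpretation chain_functional: vector_space_pair chain_scale "(*) :: real \<Rightarrow> real \<Rightarrow> real"
  by unfold_locales (auto simp: algebra_simps)

lemma chain_eval_superset:
  "finite S \<Longrightarrow> Poly_Mapping.keys c \<subseteq> S \<Longrightarrow> chain_eval \<theta> c = (\<Sum>\<sigma>\<in>S. Poly_Mapping.lookup c \<sigma> * \<theta> \<sigma>)"
  unfolding chain_eval_def by (rule sum.mono_neutral_left) (auto simp: in_keys_iff)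

lemma chain_eval_zero [simp]: "chain_eval \<theta> 0 = 0"
  by (simp add: chain_eval_def)

lemma chain_eval_add: "chain_eval \<theta> (c + d) = chain_eval \<theta> c + chain_eval \<theta> d"
proof -
  let ?S = "Poly_Mapping.keys c \<union> Poly_Mapping.keys d"
  have "chain_eval \<theta> (c + d) = (\<Sum>\<sigma>\<in>?S. Poly_Mapping.lookup (c + d) \<sigma> * \<theta> \<sigma>)"
    using keys_add[of c d] by (intro chain_eval_superset) auto
  also have "\<dots> = chain_eval \<theta> c + chain_eval \<theta> d"
    by (simp add: chain_eval_superset[of ?S] lookup_add distrib_right sum.distrib)
  finally show ?thesis .
qed

lemma chain_eval_sum: "chain_eval \<theta> (\<Sum>i\<in>I. f i) = (\<Sum>i\<in>I. chain_eval \<theta> (f i))"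
  by (induction I rule: infinite_finite_induct) (auto simp: chain_eval_add)

lemma chain_eval_single [simp]: "chain_eval \<theta> (Poly_Mapping.single \<sigma> r) = r * \<theta> \<sigma>"
  by (simp add: chain_eval_def)

lemma chain_as_sum: "c = (\<Sum>\<sigma>\<in>Poly_Mapping.keys c. chain_scale (Poly_Mapping.lookup c \<sigma>) (Poly_Mapping.single \<sigma> 1))"
proof (rule poly_mapping_eqI)
  fix k
  have "(\<Sum>\<sigma>\<in>Poly_Mapping.keys c. Poly_Mapping.lookup c \<sigma> * (1 when \<sigma> = k)) =
      (\<Sum>\<sigma>\<in>Poly_Mapping.keys c. if \<sigma> = k then Poly_Mapping.lookup c \<sigma> else 0)"
    by (intro sum.cong) (auto simp: when_def)
  then show "Poly_Mapping.lookup c k = Poly_Mapping.lookup (\<Sum>\<sigma>\<in>Poly_Mapping.keys c. chain_scale (Poly_Mapping.lookup c \<sigma>) (Poly_Mapping.single \<sigma> 1)) k"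
    by (simp add: lookup_sum lookup_single in_keys_iff)
qed

lemma chain_functional_eval:
  assumes "Vector_Spaces.linear chain_scale (*) G"
  shows "G c = chain_eval (\<lambda>\<sigma>. G (Poly_Mapping.single \<sigma> 1)) c"
proof -
  interpret G: Vector_Spaces.linear chain_scale "(*) :: real \<Rightarrow> real \<Rightarrow> real" G by fact
  have "G c = G (\<Sum>\<sigma>\<in>Poly_Mapping.keys c. chain_scale (Poly_Mapping.lookup c \<sigma>) (Poly_Mapping.single \<sigma> 1))"
    using chain_as_sum[of c] by simp
  then show ?thesis by (simp add: G.sum G.scale chain_eval_def)
qed

lemma boundary_superset:
  assumes "finite S" "Poly_Mapping.keys c \<subseteq> S" "p > 0"
  shows "real_chain_boundary p c = (\<Sum>\<sigma>\<in>S. \<Sum>k\<le>p. Poly_Mapping.single (singular_face p k \<sigma>) ((-1) ^ k * Poly_Mapping.lookup c \<sigma>))"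
  unfolding real_chain_boundary_def using assms
  by (auto intro!: sum.mono_neutral_left sum.neutral simp: in_keys_iff)

lemma boundary_add: "real_chain_boundary p (c + d) = real_chain_boundary p c + real_chain_boundary p d"
proof (cases "p = 0")
  case False
  let ?S = "Poly_Mapping.keys c \<union> Poly_Mapping.keys d"
  have "real_chain_boundary p (c + d) = (\<Sum>\<sigma>\<in>?S. \<Sum>k\<le>p. Poly_Mapping.single (singular_face p k \<sigma>) ((-1) ^ k * Poly_Mapping.lookup (c + d) \<sigma>))"
    using keys_add[of c d] False by (intro boundary_superset) auto
  also have "\<dots> = real_chain_boundary p c + real_chain_boundary p d"
    using False by (simp add: boundary_superset[of ?S] lookup_add distrib_left single_add sum.distrib)
  finally show ?thesis .
qed (simp add: real_chain_boundary_def)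

lemma boundary_diff: "real_chain_boundary p (c - d) = real_chain_boundary p c - real_chain_boundary p d"
  using boundary_add[of p "c - d" d] by simp

lemma chain_scale_single: "chain_scale r (Poly_Mapping.single \<sigma> a) = Poly_Mapping.single \<sigma> (r * a)"
  by (rule poly_mapping_eqI) (simp add: lookup_single when_def)

lemma boundary_scale: "real_chain_boundary p (chain_scale r c) = chain_scale r (real_chain_boundary p c)"
proof (cases "p = 0")
  case False
  have "real_chain_boundary p (chain_scale r c) = (\<Sum>\<sigma>\<in>Poly_Mapping.keys c. \<Sum>k\<le>p. Poly_Mapping.single (singular_face p k \<sigma>) ((-1) ^ k * Poly_Mapping.lookup (chain_scale r c) \<sigma>))"
    using keys_chain_scale[of r c] False by (intro boundary_superset) auto
  also have "\<dots> = chain_scale r (real_chain_boundary p c)"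
    using False by (simp add: real_chain_boundary_def chain_space.scale_sum_right chain_scale_single mult.left_commute)
  finally show ?thesis .
qed (simp add: real_chain_boundary_def)

lemma boundary_sum: "real_chain_boundary p (\<Sum>i\<in>I. f i) = (\<Sum>i\<in>I. real_chain_boundary p (f i))"
  by (induction I rule: infinite_finite_induct) (auto simp: boundary_add, auto simp: real_chain_boundary_def)

lemma boundary_single:
  "p > 0 \<Longrightarrow> real_chain_boundary p (Poly_Mapping.single \<sigma> r) =
    (\<Sum>k\<le>p. Poly_Mapping.single (singular_face p k \<sigma>) ((-1) ^ k * r))"
  by (subst boundary_superset[of "{\<sigma>}"]) auto

lemma subspace_boundaries: "chain_space.subspace (real_boundaries p X)"
proof (rule chain_space.subspaceI)
  have "real_chain_boundary (Suc p) 0 = 0" by (simp add: real_chain_boundary_def)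
  then show "0 \<in> real_boundaries p X"
    unfolding real_boundaries_def real_singular_chain_def by (intro image_eqI[of _ _ 0]) auto
  fix c d assume "c \<in> real_boundaries p X" "d \<in> real_boundaries p X"
  then obtain c' d' where "real_singular_chain (Suc p) X c'" "c = real_chain_boundary (Suc p) c'"
     "real_singular_chain (Suc p) X d'" "d = real_chain_boundary (Suc p) d'"
    unfolding real_boundaries_def by blast
  then show "c + d \<in> real_boundaries p X"
    unfolding real_boundaries_def real_singular_chain_def using keys_add[of c' d']
    by (intro image_eqI[of _ _ "c' + d'"]) (auto simp: boundary_add)
next
  fix r c assume "c \<in> real_boundaries p X"
  then obtain c' where "real_singular_chain (Suc p) X c'" "c = real_chain_boundary (Suc p) c'"
    unfolding real_boundaries_def by blast
  then show "chain_scale r c \<in> real_boundaries p X"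
    unfolding real_boundaries_def real_singular_chain_def using keys_chain_scale[of r c']
    by (intro image_eqI[of _ _ "chain_scale r c'"]) (auto simp: boundary_scale)
qed

text \<open>The simplicial identity: both sides omit the vertices \<open>j\<close> and
  \<open>i + 1\<close>, and omitting the smaller one first shifts the number of the other by
  one.\<close>

lemma singular_face_face:
  assumes "i \<le> 1" "j \<le> i"
  shows "singular_face 1 i (singular_face 2 j \<sigma>) = singular_face 1 j (singular_face 2 (Suc i) \<sigma>)"
proof -
  have *: "singular_face (Suc 0) m (singular_face 2 n \<sigma>) = restrict (\<lambda>x. \<sigma> (simplical_face n (simplical_face m x))) (standard_simplex 0)"
    if "m \<le> 1" for m n
    unfolding singular_face_def using simplical_face_in_standard_simplex[of "Suc 0" m] that
    by (auto simp: fun_eq_iff restrict_def)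
  have "simplical_face j (simplical_face i x) = simplical_face (Suc i) (simplical_face j x)" for x :: "nat \<Rightarrow> real"
    using assms by (auto simp: simplical_face_def fun_eq_iff)
  then show ?thesis using assms by (simp add: *)
qed

text \<open>By linearity one triangle suffices; its six iterated faces cancel in pairs through three
  instances of the simplicial identity.\<close>

lemma boundary_boundary: "real_chain_boundary 1 (real_chain_boundary 2 c) = 0"
proof -
  have "real_chain_boundary 1 (real_chain_boundary 2 (Poly_Mapping.single \<sigma> 1)) = 0" for \<sigma> :: "(nat \<Rightarrow> real) \<Rightarrow> 'a"
  proof -
    have e: "{..2} = {0, 1, 2::nat}" "{..1} = {0, 1::nat}" by auto
    show ?thesis
      using singular_face_face[of 0 0 \<sigma>] singular_face_face[of 1 0 \<sigma>] singular_face_face[of 1 1 \<sigma>]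
      by (simp add: boundary_single boundary_sum boundary_add boundary_diff e numeral_2_eq_2[symmetric] single_uminus)
  qed
  then have "real_chain_boundary 1 (real_chain_boundary 2 (\<Sum>\<sigma>\<in>Poly_Mapping.keys c. chain_scale (Poly_Mapping.lookup c \<sigma>) (Poly_Mapping.single \<sigma> 1))) = 0"
    by (simp add: boundary_sum boundary_scale)
  then show ?thesis using chain_as_sum[of c] by simp
qed

lemma boundaries_subset_cycles: "real_boundaries 1 X \<subseteq> real_cycles 1 X"
proof
  fix c assume "c \<in> real_boundaries 1 X"
  then obtain d where d: "real_singular_chain 2 X d" "c = real_chain_boundary 2 d"
    unfolding real_boundaries_def by (auto simp: numeral_2_eq_2)
  have "Poly_Mapping.keys c \<subseteq> singular_simplex_set 1 X"
  proof
    fix \<rho> assume "\<rho> \<in> Poly_Mapping.keys c"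
    then have "\<rho> \<in> Poly_Mapping.keys (\<Sum>\<sigma>\<in>Poly_Mapping.keys d. \<Sum>k\<le>2. Poly_Mapping.single (singular_face 2 k \<sigma>) ((-1) ^ k * Poly_Mapping.lookup d \<sigma>))"
      unfolding d(2) by (subst (asm) boundary_superset[of "Poly_Mapping.keys d"]) auto
    from subsetD[OF keys_sum this] obtain \<sigma> where \<sigma>: "\<sigma> \<in> Poly_Mapping.keys d"
      "\<rho> \<in> Poly_Mapping.keys (\<Sum>k\<le>2. Poly_Mapping.single (singular_face 2 k \<sigma>) ((-1) ^ k * Poly_Mapping.lookup d \<sigma>))"
      by blast
    from subsetD[OF keys_sum \<sigma>(2)] obtain k where "k \<le> 2" "\<rho> = singular_face 2 k \<sigma>"
      by (auto split: if_splits)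
    moreover have "singular_simplex 2 X \<sigma>" using d(1) \<sigma>(1) unfolding real_singular_chain_def by blast
    ultimately show "\<rho> \<in> singular_simplex_set 1 X"
      using singular_simplex_singular_face[of 2 X \<sigma> k] by simp
  qed
  then show "c \<in> real_cycles 1 X"
    unfolding real_cycles_def real_singular_chain_def using boundary_boundary[of d] d(2) by simp
qed

lemma homology_class_zero:
  assumes h: "h \<in> real_homology 1 X" and c: "c \<in> h" "c \<in> real_boundaries 1 X"
  shows "h = real_boundaries 1 X"
proof -
  let ?B = "real_boundaries 1 X"
  obtain c0 where c0: "c0 \<in> real_cycles 1 X" "h = {d. d \<in> real_cycles 1 X \<and> c0 - d \<in> ?B}"
    using h unfolding real_homology_def quotient_def by auto
  have sub: "x - y \<in> ?B" if "x \<in> ?B" "y \<in> ?B" for x y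
    using chain_space.subspace_diff[OF subspace_boundaries that] .
  have "c0 - c \<in> ?B" using c c0 by blast
  then have "c0 \<in> ?B" using chain_space.subspace_add[OF subspace_boundaries _ c(2)] by fastforce
  show ?thesis
  proof (intro equalityI subsetI)
    fix d assume "d \<in> h"
    then have "c0 - d \<in> ?B" using c0 by blast
    from sub[OF \<open>c0 \<in> ?B\<close> this] show "d \<in> ?B" by simp
  next
    fix d assume d: "d \<in> ?B"
    then show "d \<in> h" using c0(2) sub[OF \<open>c0 \<in> ?B\<close> d] boundaries_subset_cycles by blast
  qed
qed

lemma homology_class_cycle:
  assumes "h \<in> real_homology 1 X"
  shows "(SOME c. c \<in> h) \<in> h" "c \<in> h \<Longrightarrow> c \<in> real_cycles 1 X"
proof -
  obtain c0 where c0: "c0 \<in> real_cycles 1 X" "h = {d. d \<in> real_cycles 1 X \<and> c0 - d \<in> real_boundaries 1 X}"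
    using assms unfolding real_homology_def quotient_def by auto
  have "c0 \<in> h" using c0 chain_space.subspace_0[OF subspace_boundaries] by auto
  then show "(SOME c. c \<in> h) \<in> h" by (rule someI)
  show "c \<in> h \<Longrightarrow> c \<in> real_cycles 1 X" using c0 by blast
qed

text \<open>A basis of the space of boundaries stays independent when \<open>c\<close> is added, so
  some linear functional is 1 at \<open>c\<close> and 0 on all boundaries. Evaluated on boundaries
  of single triangles, the latter is the cocycle condition.\<close>

lemma separating_cocycle:
  assumes "c \<notin> real_boundaries 1 X"
  obtains \<theta> where "chain_eval \<theta> c \<noteq> 0"
    "\<And>\<tau>. singular_simplex 2 X \<tau> \<Longrightarrow> \<theta> (singular_face 2 0 \<tau>) + \<theta> (singular_face 2 2 \<tau>) = \<theta> (singular_face 2 1 \<tau>)"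
proof -
  let ?B = "real_boundaries 1 X"
  obtain b where b: "b \<subseteq> ?B" "chain_space.independent b" "?B \<subseteq> chain_space.span b"
    by (rule chain_space.maximal_independent_subset)
  have span: "chain_space.span b \<subseteq> ?B" using chain_space.span_minimal[OF b(1) subspace_boundaries] .
  then have ind: "chain_space.independent (insert c b)"
    using assms b(2) by (intro chain_space.independent_insertI) auto
  obtain G where G: "Vector_Spaces.linear chain_scale (*) G" "\<forall>x\<in>insert c b. G x = (if x = c then 1 else (0::real))"
    using chain_functional.linear_independent_extend[OF ind, of "\<lambda>x. if x = c then 1 else 0"] by blast
  interpret G: Vector_Spaces.linear chain_scale "(*) :: real \<Rightarrow> real \<Rightarrow> real" G by fact
  have Gb: "G x = 0" if "x \<in> ?B" for x
  proof -
    have "x \<in> chain_space.span b" using b(3) that by blast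
    moreover have "G y = 0" if "y \<in> b" for y using G(2) that b(1) assms by auto
    ultimately show ?thesis using chain_functional.linear_eq_0_on_span[OF G(1)] by blast
  qed
  show ?thesis
  proof (rule that[of "\<lambda>\<sigma>. G (Poly_Mapping.single \<sigma> 1)"])
    show "chain_eval (\<lambda>\<sigma>. G (Poly_Mapping.single \<sigma> 1)) c \<noteq> 0"
      using chain_functional_eval[OF G(1), of c] G(2) by simp
    fix \<tau> assume "singular_simplex 2 X \<tau>"
    then have "real_chain_boundary 2 (Poly_Mapping.single \<tau> 1) \<in> ?B"
      unfolding real_boundaries_def real_singular_chain_def by (auto simp: numeral_2_eq_2)
    from Gb[OF this] have "G (real_chain_boundary 2 (Poly_Mapping.single \<tau> 1)) = 0" .
    moreover have "{..2} = {0, 1, 2::nat}" by auto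
    ultimately show "G (Poly_Mapping.single (singular_face 2 0 \<tau>) 1) + G (Poly_Mapping.single (singular_face 2 2 \<tau>) 1) =
        G (Poly_Mapping.single (singular_face 2 1 \<tau>) 1)"
      by (simp add: boundary_single G.add G.diff single_uminus G.neg)
  qed
qed

subsection \<open>Affine simplices\<close>

text \<open>Singular simplices are extensional functions, hence the \<open>restrict\<close>. The map
  \<open>K\<close> is defined on a vector space, so that paths and homotopy squares are both
  covered.\<close>

definition affine_edge :: "('v::real_normed_vector \<Rightarrow> 'a) \<Rightarrow> 'v \<Rightarrow> 'v \<Rightarrow> (nat \<Rightarrow> real) \<Rightarrow> 'a" where
  "affine_edge K a b = restrict (\<lambda>x. K (x 0 *\<^sub>R a + x 1 *\<^sub>R b)) (standard_simplex 1)"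

definition affine_triangle :: "('v::real_normed_vector \<Rightarrow> 'a) \<Rightarrow> 'v \<Rightarrow> 'v \<Rightarrow> 'v \<Rightarrow> (nat \<Rightarrow> real) \<Rightarrow> 'a" where
  "affine_triangle K a b c = restrict (\<lambda>x. K (x 0 *\<^sub>R a + x 1 *\<^sub>R b + x 2 *\<^sub>R c)) (standard_simplex 2)"

lemma standard_simplex_1: "x \<in> standard_simplex 1 \<Longrightarrow> 0 \<le> x 0 \<and> 0 \<le> x 1 \<and> x 0 + x 1 = 1"
  and standard_simplex_2: "x \<in> standard_simplex 2 \<Longrightarrow> 0 \<le> x 0 \<and> 0 \<le> x 1 \<and> 0 \<le> x 2 \<and> x 0 + x 1 + x 2 = 1"
  by (auto simp: standard_simplex_def numeral_2_eq_2)

lemma affine_edge_cong: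
  assumes "\<And>s t. 0 \<le> s \<Longrightarrow> 0 \<le> t \<Longrightarrow> s + t = 1 \<Longrightarrow> K (s *\<^sub>R a + t *\<^sub>R b) = K' (s *\<^sub>R a' + t *\<^sub>R b')"
  shows "affine_edge K a b = affine_edge K' a' b'"
  unfolding affine_edge_def
proof (rule restrict_ext)
  fix x :: "nat \<Rightarrow> real" assume "x \<in> standard_simplex 1"
  from standard_simplex_1[OF this] show "K (x 0 *\<^sub>R a + x 1 *\<^sub>R b) = K' (x 0 *\<^sub>R a' + x 1 *\<^sub>R b')"
    by (intro assms) auto
qed

lemma simplical_face_01:
  "simplical_face 0 x = (\<lambda>i. if i = 0 then 0 else x (i - 1))"
  "simplical_face 1 x = (\<lambda>i. if i = 0 then x 0 else if i = 1 then 0 else x (i - 1))"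
  "simplical_face 2 x = (\<lambda>i. if i < 2 then x i else if i = 2 then 0 else x (i - 1))"
  by (auto simp: simplical_face_def fun_eq_iff)

lemma faces_affine_triangle:
  "singular_face 2 0 (affine_triangle K a b c) = affine_edge K b c"
  "singular_face 2 1 (affine_triangle K a b c) = affine_edge K a c"
  "singular_face 2 2 (affine_triangle K a b c) = affine_edge K a b"
proof -
  have "singular_face 2 k (affine_triangle K a b c) =
     restrict (\<lambda>x. K (simplical_face k x 0 *\<^sub>R a + simplical_face k x 1 *\<^sub>R b + simplical_face k x 2 *\<^sub>R c)) (standard_simplex 1)"
    if "k \<le> 2" for k
    using simplical_face_in_standard_simplex[of 2 k] that
    unfolding singular_face_def affine_triangle_def by (auto simp: restrict_def fun_eq_iff)
  then show "singular_face 2 0 (affine_triangle K a b c) = affine_edge K b c"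
    "singular_face 2 1 (affine_triangle K a b c) = affine_edge K a c"
    "singular_face 2 2 (affine_triangle K a b c) = affine_edge K a b"
    by (simp_all add: affine_edge_def simplical_face_01 del: One_nat_def) (simp_all only: One_nat_def)
qed

lemma singular_simplex_affine_triangle:
  fixes K :: "'v::real_normed_vector \<Rightarrow> 'a::topological_space"
  assumes K: "continuous_on S K" and S: "convex S" "a \<in> S" "b \<in> S" "c \<in> S"
  shows "singular_simplex 2 euclidean (affine_triangle K a b c)"
proof -
  let ?P = "subtopology (powertop_real UNIV) (standard_simplex 2)"
  let ?l = "\<lambda>x::nat \<Rightarrow> real. x 0 *\<^sub>R a + x 1 *\<^sub>R b + x 2 *\<^sub>R c"
  have "continuous_on (standard_simplex 2) ?l"
    by (intro continuous_intros continuous_on_subset[OF continuous_on_product_coordinates]) auto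
  moreover have "?l ` standard_simplex 2 \<subseteq> S"
  proof (intro image_subsetI)
    fix x :: "nat \<Rightarrow> real" assume "x \<in> standard_simplex 2"
    then have x: "0 \<le> x 0" "0 \<le> x 1" "0 \<le> x 2" "x 0 + x 1 + x 2 = 1" using standard_simplex_2 by blast+
    have "(\<Sum>i\<in>{0, 1, 2::nat}. x i *\<^sub>R (if i = 0 then a else if i = 1 then b else c)) \<in> S"
      using x S by (intro convex_sum) auto
    then show "?l x \<in> S" by (simp add: add.assoc)
  qed
  ultimately have "continuous_on (standard_simplex 2) (\<lambda>x. K (?l x))"
    using continuous_on_compose2[OF K] by blast
  then have "continuous_map ?P euclidean (\<lambda>x. K (?l x))"
    by (simp add: euclidean_product_topology)
  then have "continuous_map ?P euclidean (affine_triangle K a b c)"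
    unfolding affine_triangle_def by (rule continuous_map_eq) auto
  then show ?thesis unfolding singular_simplex_def affine_triangle_def by auto
qed

subsection \<open>Functions of class C^k on the manifold\<close>

context closed_smooth_manifold
begin

lemma manifold_Ck_local:
  assumes "\<And>x. x \<in> U \<Longrightarrow> \<exists>W. open W \<and> x \<in> W \<and> manifold_Ck A k W f"
  shows "manifold_Ck A k U f"
  unfolding manifold_Ck_def
proof (intro ballI Ck_on_local)
  fix c p assume c: "c \<in> A" and p: "p \<in> snd c ` (fst c \<inter> U)"
  then obtain x where x: "x \<in> fst c" "x \<in> U" "p = snd c x" by blast
  obtain W where W: "open W" "x \<in> W" "manifold_Ck A k W f" using assms[OF x(2)] by blast
  show "\<exists>T. open T \<and> p \<in> T \<and> Ck_on k T (f \<circ> chart_inv c)"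
  proof (intro exI[of _ "snd c ` (fst c \<inter> W)"] conjI)
    show "open (snd c ` (fst c \<inter> W))" by (rule open_chart_image_Int[OF c W(1)])
    show "p \<in> snd c ` (fst c \<inter> W)" using x W by blast
    show "Ck_on k (snd c ` (fst c \<inter> W)) (f \<circ> chart_inv c)" using W(3) c unfolding manifold_Ck_def by blast
  qed
qed

lemma manifold_Ck_cong:
  assumes U: "open U" and eq: "\<And>x. x \<in> U \<Longrightarrow> f x = g x" and f: "manifold_Ck A k U f"
  shows "manifold_Ck A k U g"
  unfolding manifold_Ck_def
proof
  fix c assume c: "c \<in> A"
  then have "Ck_on k (snd c ` (fst c \<inter> U)) (f \<circ> chart_inv c)" using f unfolding manifold_Ck_def by blast
  then show "Ck_on k (snd c ` (fst c \<inter> U)) (g \<circ> chart_inv c)"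
    by (rule Ck_on_cong[OF open_chart_image_Int[OF c U], rotated]) (use c eq in auto)
qed

lemma manifold_Ck_subset: "manifold_Ck A k U f \<Longrightarrow> V \<subseteq> U \<Longrightarrow> manifold_Ck A k V f"
  unfolding manifold_Ck_def by (meson Ck_on_subset Int_mono image_mono order_refl)

lemma manifold_Ck_const: "manifold_Ck A k U (\<lambda>x. r)"
  unfolding manifold_Ck_def by (simp add: o_def Ck_on_const)

lemma manifold_Ck_mult:
  assumes "open U" "manifold_Ck A k U f" "manifold_Ck A k U g"
  shows "manifold_Ck A k U (\<lambda>x. f x * g x)"
  using assms(2,3) open_chart_image_Int[OF _ assms(1)] unfolding manifold_Ck_def
  by (auto simp: o_def intro!: Ck_on_mult)

lemma manifold_Ck_sum:
  assumes "open U" "\<And>i. i \<in> I \<Longrightarrow> manifold_Ck A k U (f i)"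
  shows "manifold_Ck A k U (\<lambda>x. \<Sum>i\<in>I. f i x)"
  using assms(2) open_chart_image_Int[OF _ assms(1)] unfolding manifold_Ck_def
  by (simp add: o_def Ck_on_sum)

lemma manifold_Ck_inverse:
  assumes "open U" "manifold_Ck A k U f" "\<And>x. x \<in> U \<Longrightarrow> f x \<noteq> 0"
  shows "manifold_Ck A k U (\<lambda>x. inverse (f x))"
  unfolding manifold_Ck_def
proof
  fix c assume c: "c \<in> A"
  have "Ck_on k (snd c ` (fst c \<inter> U)) (\<lambda>p. inverse ((f \<circ> chart_inv c) p))"
  proof (rule Ck_on_compose[OF open_chart_image_Int[OF c assms(1)] _ _ Ck_on_inverse])
    show "Ck_on k (snd c ` (fst c \<inter> U)) (f \<circ> chart_inv c)" using assms(2) c unfolding manifold_Ck_def by blast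
    show "(f \<circ> chart_inv c) ` snd c ` (fst c \<inter> U) \<subseteq> - {0}" using assms(3) c by auto
  qed auto
  then show "Ck_on k (snd c ` (fst c \<inter> U)) ((\<lambda>x. inverse (f x)) \<circ> chart_inv c)" by (simp add: o_def)
qed

lemma differential_add_local_const:
  assumes W: "open W" "x \<in> W" and f: "manifold_Ck A 1 W f" and g: "manifold_Ck A 1 W g"
    and eq: "\<And>y. y \<in> W \<Longrightarrow> f y = g y + r" and v: "v \<in> T x"
  shows "differential A f x v = differential A g x v"
proof -
  obtain c where c: "c \<in> A" "x \<in> fst c" using chart_around by blast
  have "((\<lambda>p. (g \<circ> chart_inv c) p + r) has_derivative frechet_derivative (g \<circ> chart_inv c) (at (snd c x))) (at (snd c x))"
    using manifold_C1_has_derivative[OF g c W(2)] by (rule has_derivative_add_const)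
  then have "((f \<circ> chart_inv c) has_derivative frechet_derivative (g \<circ> chart_inv c) (at (snd c x))) (at (snd c x))"
    by (rule has_derivative_transform_within_open[OF _ open_chart_image_Int[OF c(1) W(1)]])
       (use c W eq in auto)
  from frechet_derivative_at[OF this] show ?thesis
    unfolding differential_in_chart[OF f c W(2) v] differential_in_chart[OF g c W(2) v] by simp
qed

text \<open>In a coordinate ball, which is convex, the difference has zero derivative.\<close>

lemma equal_differentials_imp_local_const:
  assumes V: "open V" "x \<in> V" and f: "manifold_Ck A 1 V f" and g: "manifold_Ck A 1 V g"
    and eq: "\<And>y v. y \<in> V \<Longrightarrow> v \<in> T y \<Longrightarrow> differential A f y v = differential A g y v"
  obtains W r where "open W" "x \<in> W" "W \<subseteq> V" "\<And>y. y \<in> W \<Longrightarrow> f y - g y = r"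
proof -
  obtain c where c: "c \<in> A" "x \<in> fst c" using chart_around by blast
  have op: "open (snd c ` (fst c \<inter> V))" by (rule open_chart_image_Int[OF c(1) V(1)])
  obtain s where s: "s > 0" "ball (snd c x) s \<subseteq> snd c ` (fst c \<inter> V)"
    using openE[OF op] c V by (metis IntI imageI)
  let ?F = "\<lambda>p. (f \<circ> chart_inv c) p - (g \<circ> chart_inv c) p"
  have "\<exists>r. \<forall>p\<in>ball (snd c x) s. ?F p = r"
  proof (rule has_derivative_zero_constant[OF convex_ball])
    fix p assume p: "p \<in> ball (snd c x) s"
    then obtain y where y: "y \<in> fst c" "y \<in> V" "p = snd c y" using s(2) by blast
    have "frechet_derivative (f \<circ> chart_inv c) (at p) w = frechet_derivative (g \<circ> chart_inv c) (at p) w" for w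
      using eq[OF y(2) coord_vec_in_tangent_space[OF c(1) y(1), of w]] c(1) y
      by (simp add: differential_in_chart[OF f c(1) y(1,2)] differential_in_chart[OF g c(1) y(1,2)])
    then have "(\<lambda>w. frechet_derivative (f \<circ> chart_inv c) (at p) w - frechet_derivative (g \<circ> chart_inv c) (at p) w) = (\<lambda>w. 0)" by simp
    moreover have "(?F has_derivative (\<lambda>w. frechet_derivative (f \<circ> chart_inv c) (at p) w - frechet_derivative (g \<circ> chart_inv c) (at p) w)) (at p)"
      unfolding y(3) by (intro has_derivative_diff manifold_C1_has_derivative[OF f c(1) y(1,2)] manifold_C1_has_derivative[OF g c(1) y(1,2)])
    ultimately show "(?F has_derivative (\<lambda>w. 0)) (at p within ball (snd c x) s)"
      by (metis (no_types, lifting) has_derivative_at_withinI)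
  qed
  then obtain r where r: "\<And>p. p \<in> ball (snd c x) s \<Longrightarrow> ?F p = r" by blast
  have sub: "snd c ` (fst c \<inter> V) \<subseteq> chart_image c" by auto
  show ?thesis
  proof (rule that[of "chart_inv c ` ball (snd c x) s" r])
    show "open (chart_inv c ` ball (snd c x) s)"
      using s(2) sub by (intro open_chart_inv_image c) auto
    show "x \<in> chart_inv c ` ball (snd c x) s"
      using c s(1) by (intro image_eqI[of _ _ "snd c x"]) auto
    show "chart_inv c ` ball (snd c x) s \<subseteq> V"
    proof (intro image_subsetI)
      fix p assume "p \<in> ball (snd c x) s"
      then obtain y where y: "y \<in> fst c" "y \<in> V" "p = snd c y" using s(2) by blast
      then show "chart_inv c p \<in> V" using c by simp
    qed
    show "f y - g y = r" if "y \<in> chart_inv c ` ball (snd c x) s" for y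
      using that r by auto
  qed
qed

end

subsection \<open>A smooth partition of unity\<close>

context closed_manifold_cover
begin

text \<open>The doubled balls are open domains for the local potentials; the closed sets
  \<open>piece i\<close> inside them contain the supports of the partition of unity.\<close>

definition "big i = chart_inv (cs i) ` ball (ctr i) (2 * rad i)"

lemma ball_big_subset: "i < N \<Longrightarrow> ball (ctr i) (2 * rad i) \<subseteq> chart_image (cs i)"
  using cover_cball2 ball_subset_cball by blast

lemma open_big: "i < N \<Longrightarrow> open (big i)"
  unfolding big_def by (intro open_chart_inv_image cover_chart ball_big_subset open_ball)

lemma piece_subset_big: "i < N \<Longrightarrow> piece i \<subseteq> big i"
  unfolding piece_def big_def using cover_rad[of i] by (intro image_mono) auto

lemma big_subset: "i < N \<Longrightarrow> big i \<subseteq> fst (cs i)"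
  unfolding big_def using cover_chart ball_big_subset chart_inv_in by blast

lemma chart_big: "i < N \<Longrightarrow> x \<in> big i \<Longrightarrow> snd (cs i) x \<in> ball (ctr i) (2 * rad i)"
proof -
  assume i: "i < N" and "x \<in> big i"
  then obtain p where p: "p \<in> ball (ctr i) (2 * rad i)" "x = chart_inv (cs i) p" unfolding big_def by blast
  then have "p \<in> chart_image (cs i)" using ball_big_subset[OF i] by blast
  then show ?thesis using p chart_inv_right[OF cover_chart[OF i]] by (simp only:)
qed

lemma index_in_big: "x \<in> big (index x)"
  using index piece_subset_big by blast

text \<open>Squared distances keep the argument smooth at the centre as well; flatness of
  \<open>bump_exp 0\<close> at 0 gives smoothness across the sphere of radius
  \<open>rad i\<close>.\<close>

definition bump :: "nat \<Rightarrow> 'a \<Rightarrow> real" where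
  "bump i x = (if x \<in> fst (cs i) then bump_exp 0 ((rad i)\<^sup>2 - (norm (snd (cs i) x - ctr i))\<^sup>2) else 0)"

lemma bump_nonneg: "bump i x \<ge> 0"
  by (auto simp: bump_def bump_exp_def)

lemma bump_outside:
  assumes i: "i < N" and x: "x \<notin> piece i"
  shows "bump i x = 0"
proof (cases "x \<in> fst (cs i)")
  case True
  have "snd (cs i) x \<notin> cball (ctr i) (rad i)"
  proof
    assume "snd (cs i) x \<in> cball (ctr i) (rad i)"
    then have "chart_inv (cs i) (snd (cs i) x) \<in> piece i" unfolding piece_def by (rule imageI)
    then show False using x True cover_chart[OF i] by simp
  qed
  then have "rad i \<le> norm (snd (cs i) x - ctr i)" by (simp add: dist_norm norm_minus_commute)
  then have "(rad i)\<^sup>2 \<le> (norm (snd (cs i) x - ctr i))\<^sup>2"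
    using cover_rad[OF i] by (intro power_mono) auto
  then show ?thesis by (simp add: bump_def bump_exp_def)
qed (simp add: bump_def)

lemma bump_pos: "\<exists>i<N. bump i x > 0"
proof -
  obtain i p where i: "i < N" "p \<in> ball (ctr i) (rad i)" "x = chart_inv (cs i) p" using cover by blast
  have "p \<in> chart_image (cs i)" using cover_cball[OF i(1)] i(2) by auto
  then have x: "x \<in> fst (cs i)" "snd (cs i) x = p" using cover_chart[OF i(1)] i(3) by auto
  have "norm (p - ctr i) < rad i" using i(2) by (simp add: dist_norm norm_minus_commute)
  then have "(norm (p - ctr i))\<^sup>2 < (rad i)\<^sup>2" by (intro power_strict_mono) auto
  then show ?thesis using i(1) x by (auto simp: bump_def bump_exp_def)
qed

text \<open>Two open sets suffice: the chart domain, where the formula is a smooth composition, and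
  the complement of the closed piece, where the function is 0.\<close>

lemma bump_smooth:
  assumes i: "i < N"
  shows "manifold_Ck A k UNIV (bump i)"
proof (rule manifold_Ck_local)
  fix x
  show "\<exists>W. open W \<and> x \<in> W \<and> manifold_Ck A k W (bump i)"
  proof (cases "x \<in> fst (cs i)")
    case True
    have "manifold_Ck A k (fst (cs i)) (bump i)"
      unfolding manifold_Ck_def
    proof
      fix d assume d: "d \<in> A"
      let ?S = "snd d ` (fst d \<inter> fst (cs i))"
      have S: "open ?S" by (rule open_chart_image_Int[OF d chart_open(1)[OF cover_chart[OF i]]])
      have 1: "Ck_on k UNIV (\<lambda>q. bump_exp 0 ((rad i)\<^sup>2 - (norm (q - ctr i))\<^sup>2))"
        by (rule Ck_on_compose[OF open_UNIV open_UNIV _ Ck_on_bump_exp])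
           (auto intro!: Ck_on_diff Ck_on_const Ck_on_dist_square)
      have "Ck_on k ?S (\<lambda>q. bump_exp 0 ((rad i)\<^sup>2 - (norm ((snd (cs i) \<circ> chart_inv d) q - ctr i))\<^sup>2))"
        by (rule Ck_on_compose[OF S open_UNIV _ 1 transition_Ck[OF d cover_chart[OF i]]]) simp
      then show "Ck_on k ?S (bump i \<circ> chart_inv d)"
        by (rule Ck_on_cong[OF S, rotated]) (use d in \<open>auto simp: bump_def\<close>)
    qed
    then show ?thesis using True chart_open(1)[OF cover_chart[OF i]] by blast
  next
    case False
    have op: "open (- piece i)" using closed_piece[OF i] by auto
    have "manifold_Ck A k (- piece i) (bump i)"
      by (rule manifold_Ck_cong[OF op _ manifold_Ck_const[of _ _ 0]]) (use bump_outside[OF i] in auto)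
    then show ?thesis using False piece_subset[OF i] op by blast
  qed
qed

definition part :: "nat \<Rightarrow> 'a \<Rightarrow> real" where
  "part i x = bump i x * inverse (\<Sum>j<N. bump j x)"

lemma bump_sum_pos: "(\<Sum>j<N. bump j x) > 0"
  using bump_pos[of x] bump_nonneg by (auto intro!: sum_pos2)

lemma part_sum: "(\<Sum>i<N. part i x) = 1"
  using bump_sum_pos[of x] by (simp add: part_def sum_distrib_right[symmetric])

lemma part_outside: "i < N \<Longrightarrow> x \<notin> piece i \<Longrightarrow> part i x = 0"
  by (simp add: part_def bump_outside)

lemma part_smooth: "i < N \<Longrightarrow> manifold_Ck A k UNIV (part i)"
  unfolding part_def[abs_def]
  using bump_sum_pos by (intro manifold_Ck_mult manifold_Ck_inverse manifold_Ck_sum bump_smooth) (auto simp: less_imp_neq[symmetric])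

end

subsection \<open>The closed form of a cocycle\<close>

locale closed_manifold_cocycle = closed_manifold_cover A N cs ctr rad
  for A :: "('a::t2_space, 'e::euclidean_space) chart set"
    and N cs ctr rad +
  fixes \<theta> :: "((nat \<Rightarrow> real) \<Rightarrow> 'a) \<Rightarrow> real"
  assumes cocycle: "singular_simplex 2 euclidean \<tau> \<Longrightarrow>
    \<theta> (singular_face 2 0 \<tau>) + \<theta> (singular_face 2 2 \<tau>) = \<theta> (singular_face 2 1 \<tau>)"
begin

text \<open>Additivity along edges. With three equal points it shows that a constant edge has value
  0, which is used repeatedly.\<close>

lemma cocycle_triangle:
  fixes K :: "'v::real_normed_vector \<Rightarrow> 'a"
  assumes "continuous_on S K" "convex S" "a \<in> S" "b \<in> S" "c \<in> S"
  shows "\<theta> (affine_edge K a b) + \<theta> (affine_edge K b c) = \<theta> (affine_edge K a c)"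
  using cocycle[OF singular_simplex_affine_triangle[OF assms]] by (simp only: faces_affine_triangle)

text \<open>The Poincare lemma for cochains: evaluation along the radial segment from the centre is
  a primitive of \<open>\<theta>\<close> on \<open>big i\<close>, in the sense of
  \<open>pot_path\<close>.\<close>

definition pot :: "nat \<Rightarrow> 'a \<Rightarrow> real" where
  "pot i x = \<theta> (affine_edge (chart_inv (cs i)) (ctr i) (snd (cs i) x))"

text \<open>The square \<open>K\<close> contracts the path radially to the centre of the ball. Its
  vertical sides are radial segments, its top is the path and its bottom is constant; the two
  triangles along the diagonal from \<open>(0, a)\<close> to \<open>(1, b)\<close> give the
  formula.\<close>

lemma pot_path:
  fixes \<gamma> :: "real \<Rightarrow> 'a"
  assumes i: "i < N" and ab: "a \<le> b" and \<gamma>: "continuous_on {a..b} \<gamma>" "\<gamma> ` {a..b} \<subseteq> big i"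
  shows "\<theta> (affine_edge \<gamma> a b) = pot i (\<gamma> b) - pot i (\<gamma> a)"
proof -
  let ?c = "snd (cs i)"
  let ?l = "\<lambda>z::real \<times> real. (1 - fst z) *\<^sub>R ctr i + fst z *\<^sub>R ?c (\<gamma> (snd z))"
  define K where "K z = chart_inv (cs i) (?l z)" for z
  let ?S = "{0..1::real} \<times> {a..b}"
  have c: "cs i \<in> A" by (rule cover_chart[OF i])
  have "continuous_on {a..b} (\<lambda>s. ?c (\<gamma> s))"
    by (rule continuous_on_compose2[OF continuous_on_chart[OF c] \<gamma>(1)]) (use \<gamma>(2) big_subset[OF i] in blast)
  then have "continuous_on ?S (\<lambda>z. ?c (\<gamma> (snd z)))"
    by (rule continuous_on_compose2) (auto intro: continuous_on_snd continuous_on_id)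
  then have l: "continuous_on ?S ?l" by (intro continuous_intros)
  have l_in: "?l z \<in> ball (ctr i) (2 * rad i)" if "z \<in> ?S" for z
  proof (rule convexD_alt[OF convex_ball])
    show "ctr i \<in> ball (ctr i) (2 * rad i)" using cover_rad[OF i] by simp
    show "?c (\<gamma> (snd z)) \<in> ball (ctr i) (2 * rad i)" using that \<gamma>(2) by (intro chart_big[OF i]) auto
  qed (use that in auto)
  have K: "continuous_on ?S K"
    unfolding K_def
    by (rule continuous_on_compose2[OF continuous_on_chart_inv[OF c] l]) (use l_in ball_big_subset[OF i] in blast)
  have conv: "convex ?S" by (intro convex_Times convex_real_interval(5))
  have side: "\<theta> (affine_edge K (0, s) (1, s)) = pot i (\<gamma> s)" for s
    unfolding pot_def
  proof (intro arg_cong[where f = \<theta>] affine_edge_cong)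
    fix u v :: real assume "u + v = 1"
    then have u: "u = 1 - v" by simp
    have "u * s + v * s = s" unfolding u by (simp add: algebra_simps)
    then show "K (u *\<^sub>R (0, s) + v *\<^sub>R (1, s)) = chart_inv (cs i) (u *\<^sub>R ctr i + v *\<^sub>R ?c (\<gamma> s))"
      by (simp add: K_def u)
  qed
  have top: "affine_edge K (1, a) (1, b) = affine_edge \<gamma> a b"
  proof (rule affine_edge_cong)
    fix u v :: real assume uv: "0 \<le> u" "0 \<le> v" "u + v = 1"
    then have "u * a + v * b \<in> {a..b}"
      using convexD[OF convex_real_interval(5), of a a b b u v] ab uv by simp
    then have "\<gamma> (u * a + v * b) \<in> fst (cs i)" using \<gamma>(2) big_subset[OF i] by blast
    then show "K (u *\<^sub>R (1, a) + v *\<^sub>R (1, b)) = \<gamma> (u *\<^sub>R a + v *\<^sub>R b)"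
      using uv(3) c by (simp add: K_def)
  qed
  have "affine_edge K (0, a) (0, b) = affine_edge K (0, a) (0, a)"
    by (rule affine_edge_cong) (simp add: K_def)
  moreover have "\<theta> (affine_edge K (0, a) (0, a)) = 0"
    using cocycle_triangle[OF K conv, of "(0, a)" "(0, a)" "(0, a)"] ab by simp
  ultimately have bottom: "\<theta> (affine_edge K (0, a) (0, b)) = 0" by simp
  have "\<theta> (affine_edge K (0, a) (1, a)) + \<theta> (affine_edge K (1, a) (1, b)) = \<theta> (affine_edge K (0, a) (1, b))"
    "\<theta> (affine_edge K (0, a) (0, b)) + \<theta> (affine_edge K (0, b) (1, b)) = \<theta> (affine_edge K (0, a) (1, b))"
    using ab by (intro cocycle_triangle[OF K conv]; simp)+
  then show ?thesis unfolding side top bottom by simp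
qed

text \<open>Nearby points are joined by a coordinate segment inside both balls, and by
  \<open>pot_path\<close> each potential changes along it by the same value of
  \<open>\<theta>\<close>.\<close>

lemma pot_diff_local_const:
  assumes i: "i < N" "j < N" and x: "x \<in> big i" "x \<in> big j"
  obtains W where "open W" "x \<in> W" "W \<subseteq> big i" "W \<subseteq> big j"
    "\<And>y. y \<in> W \<Longrightarrow> pot i y - pot j y = pot i x - pot j x"
proof -
  have c: "cs i \<in> A" by (rule cover_chart[OF i(1)])
  have xc: "x \<in> fst (cs i)" using big_subset i x by blast
  have op: "open (snd (cs i) ` (fst (cs i) \<inter> (big i \<inter> big j)))"
    using i by (intro open_chart_image_Int[OF c] open_Int open_big)
  obtain s where s: "s > 0" "ball (snd (cs i) x) s \<subseteq> snd (cs i) ` (fst (cs i) \<inter> (big i \<inter> big j))"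
    using openE[OF op] xc x by (metis IntI imageI)
  let ?B = "ball (snd (cs i) x) s" and ?W = "chart_inv (cs i) ` ball (snd (cs i) x) s"
  have Bc: "?B \<subseteq> chart_image (cs i)" using s(2) by auto
  have Wsub: "?W \<subseteq> big i \<inter> big j"
  proof (intro image_subsetI)
    fix p assume "p \<in> ?B"
    then obtain y where "y \<in> fst (cs i)" "y \<in> big i \<inter> big j" "p = snd (cs i) y" using s(2) by blast
    then show "chart_inv (cs i) p \<in> big i \<inter> big j" using c by simp
  qed
  show ?thesis
  proof (rule that[of ?W])
    show "open ?W" by (rule open_chart_inv_image[OF c open_ball Bc])
    show "x \<in> ?W" using c xc s(1) by (intro image_eqI[of _ _ "snd (cs i) x"]) auto
    show "?W \<subseteq> big i" "?W \<subseteq> big j" using Wsub by blast+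
    fix y assume "y \<in> ?W"
    then obtain p where p: "p \<in> ?B" "y = chart_inv (cs i) p" by blast
    let ?l = "\<lambda>t. (1 - t) *\<^sub>R snd (cs i) x + t *\<^sub>R p"
    define \<gamma> where "\<gamma> t = chart_inv (cs i) (?l t)" for t :: real
    have l: "?l t \<in> ?B" if "t \<in> {0..1}" for t
      by (rule convexD_alt[OF convex_ball]) (use that p s in auto)
    have \<gamma>W: "\<gamma> ` {0..1} \<subseteq> ?W" using l by (auto simp: \<gamma>_def simp del: mem_ball)
    have "continuous_on {0..1} \<gamma>"
      unfolding \<gamma>_def
      by (rule continuous_on_compose2[OF continuous_on_chart_inv[OF c], of _ ?l])
         (use l Bc in \<open>auto intro!: continuous_intros simp del: mem_ball\<close>)
    moreover have "\<gamma> 0 = x" "\<gamma> 1 = y" using c xc p by (simp_all add: \<gamma>_def)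
    moreover have "\<gamma> ` {0..1} \<subseteq> big i" "\<gamma> ` {0..1} \<subseteq> big j" using \<gamma>W Wsub by blast+
    ultimately show "pot i y - pot j y = pot i x - pot j x"
      using pot_path[OF i(1), of 0 1 \<gamma>] pot_path[OF i(2), of 0 1 \<gamma>] by simp
  qed
qed

text \<open>One function is subtracted from all potentials. Their differences are therefore
  untouched, and \<open>\<theta>\<close> is altered only by the coboundary of \<open>glue\<close>,
  which is invisible on cycles.\<close>

definition glue :: "'a \<Rightarrow> real" where
  "glue x = (\<Sum>j<N. part j x * pot j x)"

text \<open>The potential \<^term>\<open>pot i\<close> of the arbitrary cocycle need not even be continuous, but the
  difference of two potentials is locally constant, so subtracting the weighted mean makes it smooth.\<close>

definition prim :: "nat \<Rightarrow> 'a \<Rightarrow> real" where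
  "prim i x = pot i x - glue x"

text \<open>Since the weights sum to 1, only differences of potentials remain, and each is
  multiplied by a weight supported where the difference is under control.\<close>

lemma prim_eq: "prim i x = (\<Sum>j<N. part j x * (pot i x - pot j x))"
proof -
  have "pot i x = (\<Sum>j<N. part j x) * pot i x" by (simp add: part_sum)
  then show ?thesis unfolding prim_def glue_def
    by (simp add: sum_distrib_right right_diff_distrib sum_subtractf)
qed

lemma prim_smooth:
  assumes i: "i < N"
  shows "manifold_Ck A k (big i) (prim i)"
proof -
  have "manifold_Ck A k (big i) (\<lambda>x. part j x * (pot i x - pot j x))" if j: "j < N" for j
  proof (rule manifold_Ck_local)
    fix x assume x: "x \<in> big i"
    show "\<exists>W. open W \<and> x \<in> W \<and> manifold_Ck A k W (\<lambda>x. part j x * (pot i x - pot j x))"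
    \<comment> \<open>Inside \<open>big j\<close> the difference is locally constant; outside, a
      neighbourhood avoids the closed set \<open>piece j\<close> and the weight vanishes.\<close>
    proof (cases "x \<in> big j")
      case True
      obtain W where W: "open W" "x \<in> W" "\<And>y. y \<in> W \<Longrightarrow> pot i y - pot j y = pot i x - pot j x"
        using pot_diff_local_const[OF i j x True] by metis
      have "manifold_Ck A k W (\<lambda>y. part j y * (pot i x - pot j x))"
        by (intro manifold_Ck_mult manifold_Ck_const W manifold_Ck_subset[OF part_smooth[OF j]] subset_UNIV)
      then have "manifold_Ck A k W (\<lambda>x. part j x * (pot i x - pot j x))"
        by (rule manifold_Ck_cong[OF W(1), rotated]) (simp add: W(3))
      then show ?thesis using W by blast
    next
      case False
      have op: "open (- piece j)" using closed_piece[OF j] by auto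
      have "manifold_Ck A k (- piece j) (\<lambda>x. part j x * (pot i x - pot j x))"
        by (rule manifold_Ck_cong[OF op _ manifold_Ck_const[of _ _ 0]]) (use part_outside[OF j] in auto)
      then show ?thesis using False piece_subset_big[OF j] op by blast
    qed
  qed
  then show ?thesis unfolding prim_eq[abs_def] by (intro manifold_Ck_sum open_big i) auto
qed

definition form :: "'a \<Rightarrow> ('a, 'e) tvec \<Rightarrow> real" where
  "form x v = differential A (prim (index x)) x v"

text \<open>Makes the choice of \<open>index x\<close> irrelevant: two primitives differ locally by
  a constant, so the local differentials fit together into one form.\<close>

lemma form_eq:
  assumes i: "i < N" and x: "x \<in> big i" and v: "v \<in> T x"
  shows "form x v = differential A (prim i) x v"
proof -
  have j: "index x < N" "x \<in> big (index x)" using index(1) index_in_big by auto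
  obtain W where W: "open W" "x \<in> W" "W \<subseteq> big (index x)" "W \<subseteq> big i"
    "\<And>y. y \<in> W \<Longrightarrow> pot (index x) y - pot i y = pot (index x) x - pot i x"
    using pot_diff_local_const[OF j(1) i j(2) x] by metis
  show ?thesis unfolding form_def
  proof (rule differential_add_local_const[OF W(1,2) _ _ _ v])
    show "manifold_Ck A 1 W (prim (index x))" "manifold_Ck A 1 W (prim i)"
      using W manifold_Ck_subset prim_smooth i j by blast+
    show "prim (index x) y = prim i y + (pot (index x) x - pot i x)" if "y \<in> W" for y
      using W(5)[OF that] by (simp add: prim_def)
  qed
qed

lemma form_coord_eq:
  assumes i: "i < N" and d: "d \<in> A" and p: "p \<in> snd d ` (fst d \<inter> big i)"
  shows "form_coord A form d w p = frechet_derivative (prim i \<circ> chart_inv d) (at p) w"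
proof -
  obtain x where x: "x \<in> fst d" "x \<in> big i" "p = snd d x" using p by blast
  have v: "coord_vec A d x w \<in> T x" using d x by simp
  have "form_coord A form d w p = form x (coord_vec A d x w)"
    using d x by (simp add: form_coord_def)
  also have "\<dots> = differential A (prim i) x (coord_vec A d x w)" by (rule form_eq[OF i x(2) v])
  also have "\<dots> = frechet_derivative (prim i \<circ> chart_inv d) (at p) w"
    using differential_in_chart[OF prim_smooth[OF i] d x(1,2) v] d x by simp
  finally show ?thesis .
qed

text \<open>Near each point the form is the differential of some \<open>prim i\<close>. Smoothness
  thus costs one derivative of the primitive, and closedness is the symmetry of its second
  derivatives.\<close>

lemma closed_form: "closed_1form A form"
  unfolding closed_1form_def smooth_1form_def smooth_on_def
proof (intro conjI allI ballI)
  fix x v w a b assume "v \<in> T x" "w \<in> T x"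
  then show "form x (\<lambda>c. a *\<^sub>R v c + b *\<^sub>R w c) = a * form x v + b * form x w"
    unfolding form_def
    by (rule differential_linear[OF prim_smooth[OF index(1)] index_in_big])
next
  fix d w k assume d: "d \<in> A"
  show "Ck_on k (chart_image d) (form_coord A form d w)"
  proof (rule Ck_on_local)
    fix p assume p: "p \<in> chart_image d"
    define i where "i = index (chart_inv d p)"
    let ?S = "snd d ` (fst d \<inter> big i)"
    have i: "i < N" unfolding i_def by (rule index(1))
    have S: "open ?S" by (rule open_chart_image_Int[OF d open_big[OF i]])
    have pS: "p \<in> ?S" using p index_in_big[of "chart_inv d p"] unfolding chart_image_Int[OF d] i_def by simp
    have "Ck_on (Suc k) ?S (prim i \<circ> chart_inv d)" using prim_smooth[OF i] d unfolding manifold_Ck_def by blast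
    then have "Ck_on k ?S (\<lambda>p. frechet_derivative (prim i \<circ> chart_inv d) (at p) w)" by simp
    then have "Ck_on k ?S (form_coord A form d w)"
      by (rule Ck_on_cong[OF S, rotated]) (simp only: form_coord_eq[OF i d])
    then show "\<exists>T. open T \<and> p \<in> T \<and> Ck_on k T (form_coord A form d w)" using S pS by blast
  qed
next
  fix d p u w assume d: "d \<in> A" and p: "p \<in> chart_image d"
  define i where "i = index (chart_inv d p)"
  let ?S = "snd d ` (fst d \<inter> big i)" and ?F = "prim i \<circ> chart_inv d"
  have i: "i < N" unfolding i_def by (rule index(1))
  have S: "open ?S" by (rule open_chart_image_Int[OF d open_big[OF i]])
  have pS: "p \<in> ?S" using p index_in_big[of "chart_inv d p"] unfolding chart_image_Int[OF d] i_def by simp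
  have C2: "Ck_on 2 ?S ?F" using prim_smooth[OF i] d unfolding manifold_Ck_def by blast
  have D: "frechet_derivative (form_coord A form d w) (at p) = frechet_derivative (\<lambda>q. frechet_derivative ?F (at q) w) (at p)" for w
  proof (rule sym, rule frechet_derivative_transform_within_open[OF _ S pS])
    have "Ck_on (Suc 0) ?S (\<lambda>q. frechet_derivative ?F (at q) w)" using C2 by (simp add: numeral_2_eq_2)
    from Ck_on_has_derivative[OF this pS] show "(\<lambda>q. frechet_derivative ?F (at q) w) differentiable at p"
      unfolding differentiable_def by blast
    show "frechet_derivative ?F (at q) w = form_coord A form d w q" if "q \<in> ?S" for q
      using form_coord_eq[OF i d that] by simp
  qed
  show "frechet_derivative (form_coord A form d w) (at p) u = frechet_derivative (form_coord A form d u) (at p) w"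
    unfolding D by (rule symmetric_second_derivative[OF C2 S pS])
qed

text \<open>A path integral value may be computed with any local primitives \<open>f\<close>, not
  just the \<open>prim i\<close>. Near each parameter \<open>f\<close> differs from some
  \<open>prim i\<close> by a constant, and Bolzano's bisection principle joins the short intervals
  by additivity of \<open>\<theta>\<close>.\<close>

lemma primitive_path:
  fixes \<gamma> :: "real \<Rightarrow> 'a"
  assumes V: "open V" and f: "manifold_Ck A 1 V f"
    and df: "\<And>x v. x \<in> V \<Longrightarrow> v \<in> T x \<Longrightarrow> form x v = differential A f x v"
    and ab: "a \<le> b" and \<gamma>: "continuous_on {a..b} \<gamma>" "\<gamma> ` {a..b} \<subseteq> V"
  shows "f (\<gamma> b) - f (\<gamma> a) = \<theta> (affine_edge \<gamma> a b) - (glue (\<gamma> b) - glue (\<gamma> a))"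
proof -
  define P where "P s t \<longleftrightarrow> (a \<le> s \<and> s \<le> t \<and> t \<le> b \<longrightarrow>
    f (\<gamma> t) - f (\<gamma> s) = \<theta> (affine_edge \<gamma> s t) - (glue (\<gamma> t) - glue (\<gamma> s)))" for s t
  have "P a b"
    using ab
  proof (induction rule: Bolzano)
    case (trans s t u)
    have "\<theta> (affine_edge \<gamma> s t) + \<theta> (affine_edge \<gamma> t u) = \<theta> (affine_edge \<gamma> s u)" if "a \<le> s" "u \<le> b"
      using that trans(3,4) by (intro cocycle_triangle[OF \<gamma>(1)]) auto
    then show ?case using trans unfolding P_def by fastforce
  next
    case (local x)
    then have x: "x \<in> {a..b}" by simp
    define i where "i = index (\<gamma> x)"
    have i: "i < N" "\<gamma> x \<in> big i" unfolding i_def using index(1) index_in_big by auto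
    have \<gamma>V: "\<gamma> x \<in> V \<inter> big i" using \<gamma>(2) x i by blast
    obtain W r where W: "open W" "\<gamma> x \<in> W" "W \<subseteq> V \<inter> big i" "\<And>y. y \<in> W \<Longrightarrow> f y - prim i y = r"
    proof (rule equal_differentials_imp_local_const[OF open_Int[OF V open_big[OF i(1)]] \<gamma>V])
      show "manifold_Ck A 1 (V \<inter> big i) f" using f by (rule manifold_Ck_subset) blast
      show "manifold_Ck A 1 (V \<inter> big i) (prim i)" using prim_smooth[OF i(1)] by (rule manifold_Ck_subset) blast
      show "differential A f y v = differential A (prim i) y v" if "y \<in> V \<inter> big i" "v \<in> T y" for y v
        using df[of y v] form_eq[OF i(1), of y v] that by simp
    qed blast
    obtain O' where O': "open O'" "O' \<inter> {a..b} = \<gamma> -` W \<inter> {a..b}"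
      using \<gamma>(1) W(1) unfolding continuous_on_open_invariant by blast
    then have "x \<in> O'" using x W(2) by blast
    then obtain d where d: "d > 0" "ball x d \<subseteq> O'" using O'(1) openE by blast
    show ?case
    proof (intro exI[of _ d] conjI allI impI d)
      fix s t assume st: "s \<le> x \<and> x \<le> t \<and> t - s < d"
      show "P s t"
        unfolding P_def
      proof
        assume ab': "a \<le> s \<and> s \<le> t \<and> t \<le> b"
        have inW: "\<gamma> ` {s..t} \<subseteq> W"
        proof
          fix y assume "y \<in> \<gamma> ` {s..t}"
          then obtain u where u: "y = \<gamma> u" "u \<in> {s..t}" by blast
          then have "u \<in> ball x d" using st by (auto simp: dist_real_def)
          then have "u \<in> O' \<inter> {a..b}" using d(2) u ab' by auto
          then show "y \<in> W" using O'(2) u(1) by blast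
        qed
        have "\<theta> (affine_edge \<gamma> s t) = pot i (\<gamma> t) - pot i (\<gamma> s)"
          using inW W(3) ab' by (intro pot_path[OF i(1)] continuous_on_subset[OF \<gamma>(1)]) auto
        moreover have "f (\<gamma> t) - prim i (\<gamma> t) = r" "f (\<gamma> s) - prim i (\<gamma> s) = r"
          using inW ab' by (auto intro!: W(4))
        ultimately show "f (\<gamma> t) - f (\<gamma> s) = \<theta> (affine_edge \<gamma> s t) - (glue (\<gamma> t) - glue (\<gamma> s))"
          by (simp add: prim_def)
      qed
    qed
  qed
  then show ?thesis using ab by (simp add: P_def)
qed

text \<open>The pieces telescope to an expression that does not mention the subdivision or the
  primitives, as the definite description in \<open>closed_form_integral\<close> requires.\<close>

lemma path_integral_unique:
  assumes \<gamma>: "continuous_on {0..1} \<gamma>" and r: "has_path_integral_value A form \<gamma> r"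
  shows "r = \<theta> (affine_edge \<gamma> 0 1) - (glue (\<gamma> 1) - glue (\<gamma> 0))"
proof -
  obtain n :: nat and t :: "nat \<Rightarrow> real" and U f where t: "t 0 = 0" "t n = 1"
    and piece: "\<And>i. i < n \<Longrightarrow> t i \<le> t (Suc i) \<and> open (U i) \<and> \<gamma> ` {t i..t (Suc i)} \<subseteq> U i \<and>
       manifold_smooth A (U i) (f i) \<and> (\<forall>x\<in>U i. \<forall>v\<in>T x. form x v = differential A (f i) x v)"
    and r': "r = (\<Sum>i<n. f i (\<gamma> (t (Suc i))) - f i (\<gamma> (t i)))"
    using r unfolding has_path_integral_value_def by blast
  have mono: "t i \<le> t j" if "i \<le> j" "j \<le> n" for i j
    using that
  proof (induction j)
    case (Suc j)
    then show ?case using piece[of j] by (cases "i = Suc j") force+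
  qed simp
  have t01: "t i \<in> {0..1}" if "i \<le> n" for i using mono[of 0 i] mono[of i n] t that by auto
  have "(\<Sum>i<k. f i (\<gamma> (t (Suc i))) - f i (\<gamma> (t i))) = \<theta> (affine_edge \<gamma> (t 0) (t k)) - (glue (\<gamma> (t k)) - glue (\<gamma> (t 0)))"
    if "k \<le> n" for k
    using that
  proof (induction k)
    case 0
    show ?case using cocycle_triangle[OF \<gamma> convex_real_interval(5), of "t 0" "t 0" "t 0"] t01[of 0] by simp
  next
    case (Suc k)
    have sub: "{t k..t (Suc k)} \<subseteq> {0..1}" using t01[of k] t01[of "Suc k"] Suc.prems by auto
    have "f k (\<gamma> (t (Suc k))) - f k (\<gamma> (t k)) = \<theta> (affine_edge \<gamma> (t k) (t (Suc k))) - (glue (\<gamma> (t (Suc k))) - glue (\<gamma> (t k)))"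
      using piece[of k] Suc.prems continuous_on_subset[OF \<gamma> sub]
      by (intro primitive_path[of "U k"]) (auto simp: manifold_smooth_def)
    moreover have "\<theta> (affine_edge \<gamma> (t 0) (t k)) + \<theta> (affine_edge \<gamma> (t k) (t (Suc k))) = \<theta> (affine_edge \<gamma> (t 0) (t (Suc k)))"
      using t01 Suc.prems by (intro cocycle_triangle[OF \<gamma> convex_real_interval(5)]) auto
    ultimately show ?case using Suc by simp
  qed
  from this[of n] show ?thesis by (simp add: r' t)
qed

text \<open>A Lebesgue number for the preimages of the sets \<open>big i\<close> yields a uniform
  subdivision whose pieces each admit one \<open>prim i\<close>.\<close>

lemma path_integral_exists:
  assumes \<gamma>: "continuous_on {0..1} \<gamma>"
  shows "\<exists>r. has_path_integral_value A form \<gamma> r"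
proof -
  have "\<exists>V. open V \<and> V \<inter> {0..1} = \<gamma> -` big i \<inter> {0..1}" if "i < N" for i
    using \<gamma> open_big[OF that] unfolding continuous_on_open_invariant by blast
  then obtain V where V: "\<And>i. i < N \<Longrightarrow> open (V i) \<and> V i \<inter> {0..1} = \<gamma> -` big i \<inter> {0..1}" by metis
  have N: "0 < N" using index(1)[of undefined] by simp
  have cov: "{0..1} \<subseteq> \<Union>(V ` {..<N})"
  proof
    fix s :: real assume "s \<in> {0..1}"
    then have "s \<in> V (index (\<gamma> s))" using V[OF index(1), of "\<gamma> s"] index_in_big[of "\<gamma> s"] by blast
    then show "s \<in> \<Union>(V ` {..<N})" using index(1)[of "\<gamma> s"] by blast
  qed
  obtain \<delta> where \<delta>: "0 < \<delta>" "\<And>S. S \<subseteq> {0..1} \<Longrightarrow> diameter S < \<delta> \<Longrightarrow> \<exists>B\<in>V ` {..<N}. S \<subseteq> B"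
  proof (rule Lebesgue_number_lemma[OF compact_Icc _ cov])
    show "V ` {..<N} \<noteq> {}" using N by auto
    show "open B" if "B \<in> V ` {..<N}" for B using that V by blast
  qed blast
  obtain n :: nat where n: "n > 0" "inverse (real n) < \<delta>" using ex_inverse_of_nat_less[OF \<delta>(1)] by blast
  define t where "t k = real k / real n" for k :: nat
  have "\<exists>i<N. \<gamma> ` {t k..t (Suc k)} \<subseteq> big i" if k: "k < n" for k
  proof -
    have le: "t k \<le> t (Suc k)" "0 \<le> t k" "t (Suc k) \<le> 1"
      using k n by (auto simp: t_def divide_right_mono field_simps)
    have "diameter {t k..t (Suc k)} = t (Suc k) - t k" using le by simp
    also have "\<dots> = inverse (real n)" using n by (simp add: t_def field_simps)
    finally have "\<exists>B\<in>V ` {..<N}. {t k..t (Suc k)} \<subseteq> B" using n(2) le by (intro \<delta>(2)) auto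
    then obtain i where i: "i < N" "{t k..t (Suc k)} \<subseteq> V i" by blast
    moreover have "{t k..t (Suc k)} \<subseteq> {0..1}" using le by auto
    ultimately have "\<gamma> ` {t k..t (Suc k)} \<subseteq> big i" using V[OF i(1)] by blast
    then show ?thesis using i(1) by blast
  qed
  then obtain idx where idx: "\<And>k. k < n \<Longrightarrow> idx k < N \<and> \<gamma> ` {t k..t (Suc k)} \<subseteq> big (idx k)" by metis
  show ?thesis
    unfolding has_path_integral_value_def
  proof (rule exI[of _ "\<Sum>k<n. prim (idx k) (\<gamma> (t (Suc k))) - prim (idx k) (\<gamma> (t k))"], rule exI[of _ n], rule exI[of _ t], rule exI[of _ "\<lambda>k. big (idx k)"],
      rule exI[of _ "\<lambda>k. prim (idx k)"], intro conjI allI impI ballI)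
    show "t 0 = 0" "t n = 1" using n by (auto simp: t_def)
    fix k assume k: "k < n"
    show "t k \<le> t (Suc k)" by (simp add: t_def divide_right_mono)
    show "open (big (idx k))" "\<gamma> ` {t k..t (Suc k)} \<subseteq> big (idx k)" "manifold_smooth A (big (idx k)) (prim (idx k))"
      using idx[OF k] open_big prim_smooth by (auto simp: manifold_smooth_def)
    show "form x v = differential A (prim (idx k)) x v" if "x \<in> big (idx k)" "v \<in> T x" for x v
      using form_eq that idx[OF k] by blast
  qed (rule refl)
qed

lemma closed_form_integral_form:
  assumes "continuous_on {0..1} \<gamma>"
  shows "closed_form_integral A form \<gamma> = \<theta> (affine_edge \<gamma> 0 1) - (glue (\<gamma> 1) - glue (\<gamma> 0))"
proof -
  obtain r where r: "has_path_integral_value A form \<gamma> r" using path_integral_exists[OF assms] by blast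
  then have "closed_form_integral A form \<gamma> = r"
    unfolding closed_form_integral_def using path_integral_unique[OF assms] by (intro the_equality) auto
  then show ?thesis using path_integral_unique[OF assms r] by simp
qed

lemma simplex_path:
  assumes "singular_simplex 1 euclidean \<sigma>"
  shows "continuous_on {0..1} (simplex_path \<sigma>)" "affine_edge (simplex_path \<sigma>) 0 1 = \<sigma>"
proof -
  have \<sigma>: "continuous_on (standard_simplex 1) \<sigma>" "\<sigma> \<in> extensional (standard_simplex 1)"
    using assms unfolding singular_simplex_def by (auto simp: euclidean_product_topology)
  show "continuous_on {0..1} (simplex_path \<sigma>)"
    unfolding simplex_path_def
  proof (rule continuous_on_compose2[OF \<sigma>(1)])
    show "continuous_on {0..1} (\<lambda>t (i::nat). if i = 0 then 1 - t else if i = 1 then t else 0 :: real)"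
    proof (rule continuous_on_coordinatewise_then_product)
      fix i :: nat
      show "continuous_on {0..1} (\<lambda>t. if i = 0 then 1 - t else if i = 1 then t else 0 :: real)"
        by (cases "i = 0"; cases "i = 1") (auto intro!: continuous_intros)
    qed
    show "(\<lambda>t i. if i = 0 then 1 - t else if i = 1 then t else 0) ` {0..1} \<subseteq> standard_simplex 1"
      by (auto simp: standard_simplex_def)
  qed
  show "affine_edge (simplex_path \<sigma>) 0 1 = \<sigma>"
  proof (rule extensionalityI[of _ "standard_simplex 1"])
    fix x :: "nat \<Rightarrow> real" assume x: "x \<in> standard_simplex 1"
    have "(\<lambda>i. if i = 0 then 1 - x 1 else if i = 1 then x 1 else 0) = x"
    proof
      fix i :: nat
      show "(if i = 0 then 1 - x 1 else if i = 1 then x 1 else 0) = x i"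
        using x standard_simplex_1[OF x] by (cases "i > 1") (auto simp: standard_simplex_def not_less le_Suc_eq)
    qed
    then show "affine_edge (simplex_path \<sigma>) 0 1 x = \<sigma> x"
      using x by (simp add: affine_edge_def simplex_path_def del: One_nat_def)
  qed (use \<sigma>(2) in \<open>auto simp: affine_edge_def\<close>)
qed

text \<open>Summed over the chain, the endpoint terms in \<open>glue\<close> are a 0-cochain
  evaluated on the boundary of \<open>c\<close>, which is 0 for a cycle.\<close>

lemma chain_integral_form:
  assumes c: "c \<in> real_cycles 1 euclidean"
  shows "chain_integral A form c = chain_eval \<theta> c"
proof -
  \<comment> \<open>The only point of the standard 0-simplex. Face 0 omits vertex 0, so its value
    there is the endpoint of the path at parameter 1, and face 1 gives the starting point.\<close>
  define pt :: "nat \<Rightarrow> real" where "pt = (\<lambda>i. if i = 0 then 1 else 0)"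
  have ptS: "pt \<in> standard_simplex 0" by (simp add: pt_def standard_simplex_0)
  have faces: "singular_face 1 0 \<sigma> pt = simplex_path \<sigma> 1" "singular_face 1 1 \<sigma> pt = simplex_path \<sigma> 0" for \<sigma> :: "(nat \<Rightarrow> real) \<Rightarrow> 'a"
    using ptS unfolding singular_face_def simplex_path_def
    by (auto simp: pt_def simplical_face_def intro!: arg_cong[of _ _ \<sigma>])
  have "{..1} = {0, 1 :: nat}" by auto
  then have "chain_eval (\<lambda>s. glue (s pt)) (real_chain_boundary 1 c) =
     (\<Sum>\<sigma>\<in>Poly_Mapping.keys c. Poly_Mapping.lookup c \<sigma> * (glue (simplex_path \<sigma> 1) - glue (simplex_path \<sigma> 0)))"
    by (simp add: real_chain_boundary_def chain_eval_sum chain_eval_add right_diff_distrib flip: faces)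
  then have zero: "(\<Sum>\<sigma>\<in>Poly_Mapping.keys c. Poly_Mapping.lookup c \<sigma> * (glue (simplex_path \<sigma> 1) - glue (simplex_path \<sigma> 0))) = 0"
    using c by (simp add: real_cycles_def)
  have "closed_form_integral A form (simplex_path \<sigma>) = \<theta> \<sigma> - (glue (simplex_path \<sigma> 1) - glue (simplex_path \<sigma> 0))"
    if "\<sigma> \<in> Poly_Mapping.keys c" for \<sigma>
  proof -
    have "singular_simplex 1 euclidean \<sigma>"
      using c that unfolding real_cycles_def real_singular_chain_def by blast
    from closed_form_integral_form[OF simplex_path(1)[OF this]] simplex_path(2)[OF this] show ?thesis by simp
  qed
  then have "chain_integral A form c = (\<Sum>\<sigma>\<in>Poly_Mapping.keys c. Poly_Mapping.lookup c \<sigma> * \<theta> \<sigma> -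
      Poly_Mapping.lookup c \<sigma> * (glue (simplex_path \<sigma> 1) - glue (simplex_path \<sigma> 0)))"
    unfolding chain_integral_def by (intro sum.cong) (auto simp: right_diff_distrib)
  then show ?thesis using zero by (simp add: sum_subtractf chain_eval_def)
qed

end

section \<open>Nondegeneracy of the pairing\<close>

context closed_smooth_manifold
begin

text \<open>One half of de Rham's theorem in degree 1: closed forms separate real homology classes
  from 0. Its purpose is to exclude minimizers of speed 0.\<close>

theorem pairing_nondegenerate:
  assumes h: "(h :: 'a real_chain set) \<in> H1" and ne: "h \<noteq> H1_zero"
  obtains \<eta> where "closed_1form A \<eta>" "pairing A \<eta> h \<noteq> 0"
proof -
  define c where "c = (SOME c. c \<in> h)"
  have c: "c \<in> h" "c \<in> real_cycles 1 euclidean"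
    using homology_class_cycle[OF h] unfolding c_def by blast+
  have "c \<notin> real_boundaries 1 euclidean" using homology_class_zero[OF h c(1)] ne by blast
  then obtain \<theta> where \<theta>: "chain_eval \<theta> c \<noteq> 0"
    "\<And>\<tau>. singular_simplex 2 euclidean \<tau> \<Longrightarrow> \<theta> (singular_face 2 0 \<tau>) + \<theta> (singular_face 2 2 \<tau>) = \<theta> (singular_face 2 1 \<tau>)"
    by (rule separating_cocycle) (rule that)
  obtain N :: nat and cs z r where cov:
    "\<And>i. i < N \<Longrightarrow> cs i \<in> A \<and> 0 < (r i :: real) \<and> cball (z i) (2 * r i) \<subseteq> chart_image (cs i)"
    "\<And>x. \<exists>i<N. x \<in> chart_inv (cs i) ` ball (z i) (r i)"
    by (rule finite_ball_cover) (rule that)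
  interpret closed_manifold_cocycle A N cs z r \<theta>
    by unfold_locales (use cov \<theta>(2) in blast)+
  show ?thesis
    by (rule that[OF closed_form]) (use \<theta>(1) chain_integral_form[OF c(2)] in \<open>simp add: pairing_def c_def[symmetric]\<close>)
qed

end

subsection \<open>Comparison of two metrics\<close>

context closed_smooth_manifold
begin

lemma unit_tangent:
  assumes g: "riemannian_metric A g"
  shows "\<exists>v\<in>T x. g x v v = 1"
proof -
  obtain v where v: "v \<in> T x" "v \<noteq> (\<lambda>c. 0)" using nonzero_tangent by blast
  let ?s = "sqrt (g x v v)"
  have pos: "g x v v > 0" by (rule metric_pos[OF g v])
  have "g x (\<lambda>c. (1 / ?s) *\<^sub>R v c) (\<lambda>c. (1 / ?s) *\<^sub>R v c) = (1 / ?s)\<^sup>2 * g x v v"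
    by (rule metric_scale[OF g v(1)])
  also have "\<dots> = 1" using pos by (simp add: power_divide)
  finally show ?thesis using scale_tangent[OF v(1)] by blast
qed

lemma metric_comparable:
  assumes g: "riemannian_metric A g" and g': "riemannian_metric A g'"
  obtains C where "C > 0" "\<And>x v. v \<in> T x \<Longrightarrow> g' x v v \<le> C * g x v v"
proof -
  obtain C where C: "C > 0" "\<And>x v. v \<in> T x \<Longrightarrow> \<bar>case (x, v) of (x, v) \<Rightarrow> g' x v v\<bar> \<le> C * sqrt (g x v v) ^ 2"
    by (rule homogeneous_growth[OF g bundle_continuous_metric[OF g'] homogeneous_metric[OF g']]) (rule that)
  have "g' x v v \<le> C * g x v v" if "v \<in> T x" for x v
    using C(2)[OF that] metric_nonneg[OF g that] by simp
  then show ?thesis using that C(1) by blast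
qed

text \<open>Comparability bounds the set in the definition and \<open>unit_tangent\<close> makes it
  nonempty, so the \<open>Sup\<close> is a genuine supremum. Scaling then passes from unit vectors
  to all nonzero ones.\<close>

lemma metric_ratio:
  assumes g1: "riemannian_metric A g1" and g2: "riemannian_metric A g2"
  shows "metric_ratio A g1 g2 > 0" "\<And>x v. v \<in> T x \<Longrightarrow> g2 x v v \<le> metric_ratio A g1 g2 * g1 x v v"
proof -
  let ?S = "{g2 x v v | x v. v \<in> T x \<and> g1 x v v = 1}"
  obtain C where C: "C > 0" "\<And>x v. v \<in> T x \<Longrightarrow> g2 x v v \<le> C * g1 x v v" using metric_comparable[OF g1 g2] by metis
  have bdd: "bdd_above ?S" using C(2) by (intro bdd_aboveI[of _ C]) fastforce
  have upper: "g2 x v v \<le> metric_ratio A g1 g2" if "v \<in> T x" "g1 x v v = 1" for x v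
    unfolding metric_ratio_def by (rule cSup_upper[OF _ bdd]) (use that in blast)
  obtain v where v: "v \<in> T undefined" "g1 undefined v v = 1" using unit_tangent[OF g1] by blast
  have "v \<noteq> (\<lambda>c. 0)" using v(2) metric_zero[OF g1, of undefined] by auto
  then show "metric_ratio A g1 g2 > 0" using metric_pos[OF g2 v(1)] upper[OF v] by simp
  fix x v assume v: "v \<in> T x"
  show "g2 x v v \<le> metric_ratio A g1 g2 * g1 x v v"
  proof (cases "v = (\<lambda>c. 0)")
    case True
    then show ?thesis by (simp add: metric_zero[OF g1] metric_zero[OF g2])
  next
    case False
    let ?s = "sqrt (g1 x v v)" and ?w = "\<lambda>c. (1 / sqrt (g1 x v v)) *\<^sub>R v c"
    have pos: "g1 x v v > 0" by (rule metric_pos[OF g1 v False])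
    have "g1 x ?w ?w = (1 / ?s)\<^sup>2 * g1 x v v" by (rule metric_scale[OF g1 v])
    also have "\<dots> = 1" using pos by (simp add: power_divide)
    finally have "g2 x ?w ?w \<le> metric_ratio A g1 g2" by (rule upper[OF scale_tangent[OF v]])
    moreover have "g2 x ?w ?w = (1 / ?s)\<^sup>2 * g2 x v v" by (rule metric_scale[OF g2 v])
    ultimately show ?thesis using pos by (simp add: power_divide divide_le_eq)
  qed
qed

section \<open>Admissible measures and their action for two metrics\<close>

lemma metric_measurable:
  assumes "riemannian_metric A g" "sets M = sets (tangent_borel A)"
  shows "(\<lambda>z. case z of (x, v) \<Rightarrow> g x v v) \<in> borel_measurable M"
  unfolding measurable_cong_sets[OF assms(2) refl]
  by (rule bundle_continuous_measurable[OF bundle_continuous_metric[OF assms(1)]])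

text \<open>The metric enters only through the first momentum, and the norms of two metrics are
  comparable. Used in both directions to identify the two classes of measures.\<close>

lemma closed_measures_mono:
  assumes g: "riemannian_metric A g" and g': "riemannian_metric A g'"
  shows "closed_measures A g \<subseteq> closed_measures A g'"
proof
  fix \<mu> assume \<mu>: "\<mu> \<in> closed_measures A g"
  have M: "sets \<mu> = sets (tangent_borel A)" using closed_measures_sets[OF \<mu>] by blast
  obtain C where C: "C > 0" "\<And>x v. v \<in> T x \<Longrightarrow> g' x v v \<le> C * g x v v" using metric_comparable[OF g g'] by metis
  have gm: "(\<lambda>z. case z of (x, v) \<Rightarrow> ennreal (sqrt (g x v v))) \<in> borel_measurable \<mu>"
    using metric_measurable[OF g M] by (simp add: case_prod_beta)
  have "(\<integral>\<^sup>+(x, v). ennreal (sqrt (g' x v v)) \<partial>\<mu>) \<le> (\<integral>\<^sup>+z. ennreal (sqrt C) * (case z of (x, v) \<Rightarrow> ennreal (sqrt (g x v v))) \<partial>\<mu>)"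
  proof (rule nn_integral_mono)
    fix z assume "z \<in> space \<mu>"
    then obtain x v where z: "z = (x, v)" "v \<in> T x"
      using sets_eq_imp_space_eq[OF M] by (auto simp: tangent_bundle_def)
    have "sqrt (g' x v v) \<le> sqrt C * sqrt (g x v v)"
      using C(2)[OF z(2)] by (simp flip: real_sqrt_mult)
    then show "(case z of (x, v) \<Rightarrow> ennreal (sqrt (g' x v v))) \<le> ennreal (sqrt C) * (case z of (x, v) \<Rightarrow> ennreal (sqrt (g x v v)))"
      using C(1) by (simp add: z ennreal_leI flip: ennreal_mult')
  qed
  also have "\<dots> = ennreal (sqrt C) * (\<integral>\<^sup>+(x, v). ennreal (sqrt (g x v v)) \<partial>\<mu>)"
    by (rule nn_integral_cmult[OF gm])
  also have "\<dots> < \<infinity>" using \<mu> unfolding closed_measures_def by (auto simp: ennreal_mult_less_top)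
  finally show "\<mu> \<in> closed_measures A g'" using \<mu> unfolding closed_measures_def by blast
qed

lemma measures_with_rotation_eq:
  assumes "riemannian_metric A g" "riemannian_metric A g'"
  shows "measures_with_rotation A g h = measures_with_rotation A g' h"
  unfolding measures_with_rotation_def using closed_measures_mono assms by blast

lemma measures_with_rotation_sets:
  "\<mu> \<in> measures_with_rotation A g h \<Longrightarrow> sets \<mu> = sets (tangent_borel A)"
  "\<mu> \<in> measures_with_rotation A g h \<Longrightarrow> prob_space \<mu>"
  unfolding measures_with_rotation_def using closed_measures_sets by blast+

lemma action_scale:
  assumes g: "riemannian_metric A g" and M: "sets M = sets (tangent_borel A)" and C: "C \<ge> 0"
  shows "(\<integral>\<^sup>+z. ennreal (C * lagrangian g z) \<partial>M) = ennreal C * action g M"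
proof -
  have "lagrangian g \<in> borel_measurable M"
    using metric_measurable[OF g M] unfolding lagrangian_def by (simp add: case_prod_beta)
  then show ?thesis using C unfolding action_def by (simp add: ennreal_mult' nn_integral_cmult)
qed

lemma lagrangian_nonneg: "riemannian_metric A g \<Longrightarrow> z \<in> TM \<Longrightarrow> lagrangian g z \<ge> 0"
  using metric_nonneg by (auto simp: lagrangian_def tangent_bundle_def)

lemma action_le:
  assumes g: "riemannian_metric A g" and M: "sets M = sets (tangent_borel A)" and C: "C \<ge> 0"
    and le: "\<And>x v. v \<in> T x \<Longrightarrow> g' x v v \<le> C * g x v v"
  shows "action g' M \<le> ennreal C * action g M"
proof -
  have "action g' M \<le> (\<integral>\<^sup>+z. ennreal (C * lagrangian g z) \<partial>M)"
    unfolding action_def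
  proof (rule nn_integral_mono)
    fix z assume "z \<in> space M"
    then obtain x v where z: "z = (x, v)" "v \<in> T x"
      using sets_eq_imp_space_eq[OF M] by (auto simp: tangent_bundle_def)
    show "ennreal (lagrangian g' z) \<le> ennreal (C * lagrangian g z)"
      using le[OF z(2)] by (intro ennreal_leI) (simp add: z lagrangian_def)
  qed
  then show ?thesis by (simp only: action_scale[OF g M C])
qed

lemma mather_beta_nonneg: "mather_beta A g h \<ge> 0"
  by (simp add: mather_beta_def)

lemma ennreal_mather_beta:
  "(INF \<mu>\<in>measures_with_rotation A g h. action g \<mu>) < \<infinity> \<Longrightarrow>
    ennreal (mather_beta A g h) = (INF \<mu>\<in>measures_with_rotation A g h. action g \<mu>)"
  by (simp add: mather_beta_def)

text \<open>By comparability, infinite action for \<open>g\<close> means infinite action for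
  \<open>g'\<close>, and \<open>enn2real\<close> sends infinity to 0. This settles classes without a
  measure of finite action.\<close>

lemma mather_beta_infinite:
  assumes g: "riemannian_metric A g" and g': "riemannian_metric A g'"
    and inf: "\<not> (INF \<mu>\<in>measures_with_rotation A g h. action g \<mu>) < \<infinity>"
  shows "mather_beta A g' h = 0"
proof -
  obtain C where C: "C > 0" "\<And>x v. v \<in> T x \<Longrightarrow> g x v v \<le> C * g' x v v" using metric_comparable[OF g' g] by metis
  have "action g' \<mu> = \<infinity>" if "\<mu> \<in> measures_with_rotation A g' h" for \<mu>
  proof -
    have \<mu>: "\<mu> \<in> measures_with_rotation A g h" using that measures_with_rotation_eq[OF g g'] by simp
    have "\<infinity> \<le> action g \<mu>" using inf INF_lower[OF \<mu>, of "action g"] by (auto simp: top.not_eq_extremum dest: top_le)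
    also have "\<dots> \<le> ennreal C * action g' \<mu>"
      using C by (intro action_le g' measures_with_rotation_sets[OF that]) auto
    finally have "ennreal C * action g' \<mu> = \<infinity>" by (simp add: top_le)
    then show ?thesis by (simp add: ennreal_mult_eq_top_iff)
  qed
  then have "(INF \<mu>\<in>measures_with_rotation A g' h. action g' \<mu>) = \<infinity>"
    by (simp add: INF_eq_const)
  then show ?thesis by (simp add: mather_beta_def)
qed

lemma mather_measureD:
  assumes "\<mu> \<in> mather_measures A g h"
  shows "\<mu> \<in> measures_with_rotation A g h" "action g \<mu> = ennreal (mather_beta A g h)"
  using assms unfolding mather_measures_def by auto

lemma mather_beta_le_action:
  assumes "\<mu> \<in> measures_with_rotation A g h" "action g \<mu> < \<infinity>"
  shows "ennreal (mather_beta A g h) \<le> action g \<mu>"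
proof -
  have "(INF \<mu>\<in>measures_with_rotation A g h. action g \<mu>) \<le> action g \<mu>" by (rule INF_lower[OF assms(1)])
  then show ?thesis using ennreal_mather_beta[of g h] assms(2) by (metis le_less_trans)
qed

lemma mather_beta_comparison:
  assumes g1: "riemannian_metric A g1" and g2: "riemannian_metric A g2"
  shows "mather_beta A g2 h \<le> metric_ratio A g1 g2 * mather_beta A g1 h"
proof (cases "(INF \<mu>\<in>measures_with_rotation A g1 h. action g1 \<mu>) < \<infinity>")
  case True
  let ?C = "metric_ratio A g1 g2"
  obtain \<mu> where \<mu>: "\<mu> \<in> mather_measures A g1 h" using mather_measure_exists[OF g1 True] by blast
  note \<mu>' = mather_measureD[OF \<mu>]
  have "action g2 \<mu> \<le> ennreal ?C * action g1 \<mu>"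
    using metric_ratio[OF g1 g2] by (intro action_le g1 measures_with_rotation_sets[OF \<mu>'(1)]) auto
  also have "\<dots> = ennreal (?C * mather_beta A g1 h)"
    using metric_ratio(1)[OF g1 g2] by (simp add: \<mu>'(2) ennreal_mult')
  finally have le: "action g2 \<mu> \<le> ennreal (?C * mather_beta A g1 h)" .
  have "ennreal (mather_beta A g2 h) \<le> action g2 \<mu>"
    using \<mu>'(1) measures_with_rotation_eq[OF g1 g2] le
    by (intro mather_beta_le_action) (auto intro: le_less_trans)
  with le have "ennreal (mather_beta A g2 h) \<le> ennreal (?C * mather_beta A g1 h)" by (rule order_trans[rotated])
  then show ?thesis
    using metric_ratio(1)[OF g1 g2] mather_beta_nonneg by (subst (asm) ennreal_le_iff) auto
next
  case False
  \<comment> \<open>The left-hand side is 0 by convention and the right-hand side is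
    nonnegative.\<close>
  then show ?thesis using mather_beta_infinite[OF g1 g2 False] metric_ratio(1)[OF g1 g2] mather_beta_nonneg by simp
qed

subsection \<open>Supports\<close>

lemma measure_supp_subset: "measure_supp A \<mu> \<subseteq> TM"
  by (auto simp: measure_supp_def)

text \<open>Upgrades an almost sure inequality to every point of the support: the set where a
  continuous \<open>q\<close> is positive is open and null, hence misses the support.\<close>

lemma supp_nonpos:
  assumes q: "bundle_continuous q" and M: "sets M = sets (tangent_borel A)"
    and ae: "AE z in M. q z \<le> 0" and z: "z \<in> measure_supp A M"
  shows "q z \<le> 0"
proof (rule ccontr)
  assume "\<not> q z \<le> 0"
  let ?W = "{z \<in> TM. q z \<in> {0<..}}"
  have W: "openin (tangent_topology A) ?W" by (rule openin_vimage_bundle_continuous[OF q]) simp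
  have "?W \<in> sets M" using sets_openin[OF W] M by simp
  moreover have "{z \<in> space M. \<not> q z \<le> 0} = ?W"
    using sets_eq_imp_space_eq[OF M] by auto
  ultimately have "emeasure M ?W = 0" using AE_iff_measurable[of ?W M "\<lambda>z. q z \<le> 0"] ae by simp
  moreover have "z \<in> ?W" using z measure_supp_subset \<open>\<not> q z \<le> 0\<close> by auto
  ultimately show False using z W unfolding measure_supp_def by fastforce
qed

text \<open>The complement of the support is a union of null open sets. Lindelof's theorem, applied
  to their preimages in Euclidean bundle coordinates, makes the union countable over each chart, and
  finitely many charts cover.\<close>

lemma AE_in_supp:
  assumes M: "sets M = sets (tangent_borel A)"
  shows "AE z in M. z \<in> measure_supp A M"
proof -
  have sp: "space M = TM" using sets_eq_imp_space_eq[OF M] by simp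
  define F where "F = {W. openin (tangent_topology A) W \<and> emeasure M W = 0}"
  have ex: "\<exists>F'. F' \<subseteq> F \<and> countable F' \<and> {z \<in> TM. fst z \<in> fst c} - measure_supp A M \<subseteq> \<Union>F'" if c: "c \<in> A" for c
  proof -
    define pre where "pre W = {q \<in> chart_image c \<times> UNIV. bundle_param A c q \<in> W}" for W
    have "open S" if "S \<in> pre ` F" for S
      using that c unfolding pre_def F_def openin_tangent_topology by blast
    from Lindelof[OF this] obtain G where G: "G \<subseteq> pre ` F" "countable G" "\<Union>G = \<Union>(pre ` F)" by blast
    then obtain F' where F': "F' \<subseteq> F" "countable F'" "G = pre ` F'"
      by (metis countable_subset_image)
    have "z \<in> \<Union>F'" if z: "z \<in> TM" "fst z \<in> fst c" "z \<notin> measure_supp A M" for z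
    proof -
      obtain W where W: "W \<in> F" "z \<in> W"
        using z(1,3) unfolding measure_supp_def F_def by (auto simp: zero_less_iff_neq_zero)
      let ?q = "(snd c (fst z), snd z c)"
      have q: "bundle_param A c ?q = z"
        using bundle_param_coordinates[of "fst z" "snd z" c] z c by simp
      have "?q \<in> pre W" using W(2) q z(2) unfolding pre_def by simp
      then have "?q \<in> \<Union>G" using G(3) W(1) by blast
      then obtain W' where "W' \<in> F'" "?q \<in> pre W'" using F'(3) by blast
      then show ?thesis using q unfolding pre_def by auto
    qed
    then show ?thesis using F' by blast
  qed
  have "\<forall>c\<in>A. \<exists>F'. F' \<subseteq> F \<and> countable F' \<and> {z \<in> TM. fst z \<in> fst c} - measure_supp A M \<subseteq> \<Union>F'"
    using ex by blast
  from bchoice[OF this] obtain F' where F'': "\<forall>c\<in>A. F' c \<subseteq> F \<and> countable (F' c) \<and>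
      {z \<in> TM. fst z \<in> fst c} - measure_supp A M \<subseteq> \<Union>(F' c)" ..
  then have F': "F' c \<subseteq> F \<and> countable (F' c) \<and> {z \<in> TM. fst z \<in> fst c} - measure_supp A M \<subseteq> \<Union>(F' c)" if "c \<in> A" for c
    using that by (rule bspec)
  obtain N :: nat and cs z r where cov:
    "\<And>i. i < N \<Longrightarrow> cs i \<in> A \<and> 0 < (r i :: real) \<and> cball (z i) (2 * r i) \<subseteq> chart_image (cs i)"
    "\<And>x. \<exists>i<N. x \<in> chart_inv (cs i) ` ball (z i) (r i)"
    by (rule finite_ball_cover) (rule that)
  interpret closed_manifold_cover A N cs z r
    by unfold_locales (use cov in blast)+
  let ?G = "\<Union>i<N. F' (cs i)"
  have null: "\<Union>?G \<in> null_sets M"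
  proof -
    have cG: "countable ?G" using F' cover_chart by (intro countable_UN) auto
    have nG: "W \<in> null_sets M" if "W \<in> ?G" for W
    proof -
      have "W \<in> F" using that F' cover_chart by blast
      then show ?thesis using sets_openin M unfolding F_def null_sets_def by auto
    qed
    have "(\<Union>W\<in>?G. W) \<in> null_sets M" by (rule null_sets_UN'[OF cG nG])
    then show ?thesis by (simp only: image_ident)
  qed
  have "{z \<in> space M. z \<notin> measure_supp A M} \<subseteq> \<Union>?G"
  proof
    fix y assume y: "y \<in> {z \<in> space M. z \<notin> measure_supp A M}"
    let ?i = "index (fst y)"
    have "fst y \<in> fst (cs ?i)" "?i < N" using index piece_subset by blast+
    then have "y \<in> \<Union>(F' (cs ?i))" using F'[OF cover_chart, of ?i] y sp by blast
    then show "y \<in> \<Union>?G" using \<open>?i < N\<close> by blast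
  qed
  with null show ?thesis by (rule AE_I')
qed

subsection \<open>The case of equality\<close>

text \<open>The \<open>g2\<close>-action of a minimizer for \<open>g1\<close> lies between
  \<open>mather_beta A g2 h\<close> and the ratio times its \<open>g1\<close>-action. If the two
  ends agree, it is a minimizer for \<open>g2\<close> and no pointwise gap between the Lagrangians
  is left.\<close>

lemma mather_beta_equality:
  assumes g1: "riemannian_metric A g1" and g2: "riemannian_metric A g2"
  shows "mather_beta A g2 h = metric_ratio A g1 g2 * mather_beta A g1 h \<longleftrightarrow>
    mather_measures A g1 h \<subseteq> mather_measures A g2 h \<and>
    (\<forall>(x, v)\<in>mather_set A g1 h. g2 x v v = metric_ratio A g1 g2 * g1 x v v)"
    (is "?L \<longleftrightarrow> ?R")
proof
  let ?C = "metric_ratio A g1 g2"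
  note C = metric_ratio[OF g1 g2]
  assume eq: ?L
  have main: "\<mu> \<in> mather_measures A g2 h \<and> (\<forall>(x, v)\<in>measure_supp A \<mu>. g2 x v v = ?C * g1 x v v)"
    if \<mu>: "\<mu> \<in> mather_measures A g1 h" for \<mu>
  proof -
    note \<mu>' = mather_measureD[OF \<mu>]
    have M: "sets \<mu> = sets (tangent_borel A)" by (rule measures_with_rotation_sets(1)[OF \<mu>'(1)])
    have S2: "\<mu> \<in> measures_with_rotation A g2 h" using \<mu>'(1) measures_with_rotation_eq[OF g1 g2] by simp
    have act: "ennreal ?C * action g1 \<mu> = ennreal (mather_beta A g2 h)"
      using C(1) by (simp add: \<mu>'(2) eq ennreal_mult')
    have le: "action g2 \<mu> \<le> ennreal (mather_beta A g2 h)"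
      unfolding act[symmetric] by (rule action_le[OF g1 M]) (use C in auto)
    then have "ennreal (mather_beta A g2 h) \<le> action g2 \<mu>"
      by (intro mather_beta_le_action[OF S2]) (auto intro: le_less_trans)
    with le have act2: "action g2 \<mu> = ennreal (mather_beta A g2 h)" by (rule antisym)
    have lm: "lagrangian g1 \<in> borel_measurable \<mu>" "lagrangian g2 \<in> borel_measurable \<mu>"
      using metric_measurable[OF g1 M] metric_measurable[OF g2 M] unfolding lagrangian_def by (simp_all add: case_prod_beta)
    let ?d = "\<lambda>z. ?C * lagrangian g1 z - lagrangian g2 z"
    have d0: "?d z \<ge> 0" if "z \<in> TM" for z
      using C(2) that by (auto simp: lagrangian_def tangent_bundle_def)
    have sp: "space \<mu> = TM" using sets_eq_imp_space_eq[OF M] by simp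
    have "ennreal ?C * action g1 \<mu> = (\<integral>\<^sup>+z. ennreal (?C * lagrangian g1 z) \<partial>\<mu>)"
      using C(1) by (simp add: action_scale[OF g1 M])
    also have "\<dots> = (\<integral>\<^sup>+z. ennreal (lagrangian g2 z) + ennreal (?d z) \<partial>\<mu>)"
      by (intro nn_integral_cong, subst ennreal_plus[symmetric])
         (use d0 lagrangian_nonneg[OF g2] sp in auto)
    also have "\<dots> = action g2 \<mu> + (\<integral>\<^sup>+z. ennreal (?d z) \<partial>\<mu>)"
      unfolding action_def using lm by (intro nn_integral_add) auto
    finally have "ennreal (mather_beta A g2 h) + 0 = ennreal (mather_beta A g2 h) + (\<integral>\<^sup>+z. ennreal (?d z) \<partial>\<mu>)"
      unfolding act act2 by simp
    \<comment> \<open>Cancellation is legitimate because the common summand is finite.\<close>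
    from this[unfolded ennreal_add_left_cancel] have "(\<integral>\<^sup>+z. ennreal (?d z) \<partial>\<mu>) = 0" by simp
    then have "AE z in \<mu>. ennreal (?d z) = 0"
      using lm by (subst (asm) nn_integral_0_iff_AE) auto
    then have ae: "AE z in \<mu>. ?C * (case z of (x, v) \<Rightarrow> g1 x v v) - (case z of (x, v) \<Rightarrow> g2 x v v) \<le> 0"
      by eventually_elim (simp add: ennreal_eq_0_iff lagrangian_def case_prod_beta)
    have "g2 x v v = ?C * g1 x v v" if xv: "(x, v) \<in> measure_supp A \<mu>" for x v
    proof -
      have "?C * (case (x, v) of (x, v) \<Rightarrow> g1 x v v) - (case (x, v) of (x, v) \<Rightarrow> g2 x v v) \<le> 0"
        by (rule supp_nonpos[OF _ M ae xv])
           (intro bundle_continuous_diff bundle_continuous_mult bundle_continuous_const bundle_continuous_metric g1 g2)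
      moreover have "v \<in> T x" using xv measure_supp_subset by (auto simp: tangent_bundle_def)
      ultimately show ?thesis using C(2)[of v x] by simp
    qed
    moreover have "\<mu> \<in> mather_measures A g2 h" using S2 act2 unfolding mather_measures_def by blast
    ultimately show ?thesis by blast
  qed
  show ?R
  proof (intro conjI subsetI ballI)
    show "\<mu> \<in> mather_measures A g2 h" if "\<mu> \<in> mather_measures A g1 h" for \<mu>
      using main[OF that] by (rule conjunct1)
    fix z assume "z \<in> mather_set A g1 h"
    then obtain \<mu> where "\<mu> \<in> mather_measures A g1 h" "z \<in> measure_supp A \<mu>"
      unfolding mather_set_def by (rule UN_E)
    from main[OF this(1), THEN conjunct2] this(2)
    show "case z of (x, v) \<Rightarrow> g2 x v v = ?C * g1 x v v" by (rule bspec)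
  qed
next
  let ?C = "metric_ratio A g1 g2"
  note C = metric_ratio[OF g1 g2]
  assume R: ?R
  show ?L
  proof (cases "(INF \<mu>\<in>measures_with_rotation A g1 h. action g1 \<mu>) < \<infinity>")
    case False
    \<comment> \<open>Both values of the function are 0 by the convention for infinite
      action.\<close>
    then show ?thesis using mather_beta_infinite[OF g1 g2 False] mather_beta_infinite[OF g1 g1 False] by simp
  next
    case True
    obtain \<mu> where \<mu>: "\<mu> \<in> mather_measures A g1 h" using mather_measure_exists[OF g1 True] by blast
    note \<mu>1 = mather_measureD[OF \<mu>]
    have \<mu>2: "action g2 \<mu> = ennreal (mather_beta A g2 h)" using R \<mu> mather_measureD by blast
    have M: "sets \<mu> = sets (tangent_borel A)" by (rule measures_with_rotation_sets(1)[OF \<mu>1(1)])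
    have "action g2 \<mu> = (\<integral>\<^sup>+z. ennreal (?C * lagrangian g1 z) \<partial>\<mu>)"
      unfolding action_def
    \<comment> \<open>The pointwise identity is known on the support only, which has full
      measure.\<close>
    proof (rule nn_integral_cong_AE, use AE_in_supp[OF M] in eventually_elim)
      fix z assume "z \<in> measure_supp A \<mu>"
      then have "z \<in> mather_set A g1 h" using \<mu> unfolding mather_set_def by blast
      then show "ennreal (lagrangian g2 z) = ennreal (?C * lagrangian g1 z)"
        using R by (auto simp: lagrangian_def)
    qed
    also have "\<dots> = ennreal ?C * action g1 \<mu>" using C(1) by (simp add: action_scale[OF g1 M])
    finally have "ennreal (mather_beta A g2 h) = ennreal (?C * mather_beta A g1 h)"
      using C(1) by (simp add: \<mu>2 \<mu>1(2) ennreal_mult')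
    then show ?thesis using C(1) mather_beta_nonneg by (subst (asm) ennreal_inj) auto
  qed
qed

subsection \<open>Mather measures live on a sphere bundle\<close>

lemma homogeneous_zero: "fibre_homogeneous 1 q \<Longrightarrow> q (x, \<lambda>c. 0) = 0"
proof -
  assume "fibre_homogeneous 1 q"
  from this[unfolded fibre_homogeneous_def, rule_format, OF zero_tangent, of x 0]
  show ?thesis by simp
qed

text \<open>On the zero section the junk value \<open>l / 0 = 0\<close> makes this map the identity.\<close>

definition reparam :: "('a \<Rightarrow> ('a, 'e) tvec \<Rightarrow> ('a, 'e) tvec \<Rightarrow> real) \<Rightarrow> real \<Rightarrow> 'a \<times> ('a, 'e) tvec \<Rightarrow> 'a \<times> ('a, 'e) tvec" where
  "reparam g l = (\<lambda>(x, v). (x, \<lambda>c. (l / sqrt (g x v v)) *\<^sub>R v c))"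

lemma bundle_continuous_norm:
  assumes "riemannian_metric A g"
  shows "bundle_continuous (\<lambda>z. sqrt (case z of (x, v) \<Rightarrow> g x v v))"
  by (rule bundle_continuous_compose[OF bundle_continuous_metric[OF assms]]) (intro continuous_intros)

text \<open>The map need not be continuous at the zero section, so the preimage is split: an open
  part where the speed is positive, and the closed remainder, where the map is the identity.\<close>

lemma reparam_measurable:
  assumes g: "riemannian_metric A g"
  shows "reparam g l \<in> measurable (tangent_borel A) (tangent_borel A)"
proof (rule measurable_into_tangent_borel)
  let ?s = "\<lambda>z. sqrt (case z of (x, v) \<Rightarrow> g x v v)"
  show "reparam g l \<in> space (tangent_borel A) \<rightarrow> TM"
    using scale_tangent by (auto simp: reparam_def tangent_bundle_def)
  fix W assume W: "openin (tangent_topology A) W"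
  have s: "bundle_continuous ?s" by (rule bundle_continuous_norm[OF g])
  have spos: "{z \<in> TM. ?s z \<in> {0<..}} \<in> sets (tangent_borel A)"
    by (intro sets_openin openin_vimage_bundle_continuous s) simp
  have zero: "reparam g l z = z" if "z \<in> TM" "\<not> ?s z > 0" for z
  proof -
    obtain x v where z: "z = (x, v)" "v \<in> T x" using \<open>z \<in> TM\<close> by (auto simp: tangent_bundle_def)
    have "v = (\<lambda>c. 0)" using metric_pos[OF g z(2)] that(2) by (auto simp: z)
    then show ?thesis by (simp add: z reparam_def)
  qed
  have op: "openin (tangent_topology A) {z \<in> TM. ?s z > 0 \<and> reparam g l z \<in> W}"
    unfolding openin_tangent_topology
  proof (intro conjI ballI)
    fix c assume c: "c \<in> A"
    let ?D = "(chart_image c \<times> UNIV) \<inter> (\<lambda>q. ?s (bundle_param A c q)) -` {0<..}"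
    let ?f = "\<lambda>q. (fst q, (l / ?s (bundle_param A c q)) *\<^sub>R snd q)"
    have cont: "continuous_on (chart_image c \<times> UNIV) (\<lambda>q. ?s (bundle_param A c q))"
      using s c unfolding bundle_continuous_def by blast
    have D: "open ?D"
      using chart_open(2)[OF c] by (intro continuous_open_preimage[OF cont] open_Times) auto
    have "continuous_on ?D (\<lambda>q. ?s (bundle_param A c q))"
      by (rule continuous_on_subset[OF cont]) blast
    then have f: "continuous_on ?D ?f"
      by (intro continuous_on_Pair continuous_on_fst continuous_on_snd continuous_on_id continuous_on_scaleR continuous_on_divide continuous_on_const) auto
    have "open (?D \<inter> ?f -` {q \<in> chart_image c \<times> UNIV. bundle_param A c q \<in> W})"
      using W c unfolding openin_tangent_topology by (intro continuous_open_preimage[OF f D]) blast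
    moreover have rep: "reparam g l (bundle_param A c q) = bundle_param A c (?f q)" if q: "q \<in> chart_image c \<times> UNIV" for q
    proof -
      obtain p w where q': "q = (p, w)" "p \<in> chart_image c" using q by auto
      have "coord_vec A c (chart_inv c p) (t *\<^sub>R w + 0 *\<^sub>R w) = (\<lambda>d. t *\<^sub>R coord_vec A c (chart_inv c p) w d)" for t
        unfolding coord_vec_combination[OF c chart_inv_in[OF c q'(2)]] by simp
      then show ?thesis by (simp add: q' reparam_def bundle_param_def)
    qed
    have "{q \<in> chart_image c \<times> UNIV. bundle_param A c q \<in> {z \<in> TM. ?s z > 0 \<and> reparam g l z \<in> W}} =
        ?D \<inter> ?f -` {q \<in> chart_image c \<times> UNIV. bundle_param A c q \<in> W}" (is "?L = ?R")
    proof (rule Set.set_eqI)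
      fix q
      show "q \<in> ?L \<longleftrightarrow> q \<in> ?R"
      proof (cases "q \<in> chart_image c \<times> UNIV")
        case True
        then have "bundle_param A c q \<in> TM" "?f q \<in> chart_image c \<times> UNIV" using bundle_param_in[OF c] by auto
        then show ?thesis using True rep[OF True] by simp
      qed simp
    qed
    ultimately show "open {q \<in> chart_image c \<times> UNIV. bundle_param A c q \<in> {z \<in> TM. ?s z > 0 \<and> reparam g l z \<in> W}}"
      by simp
  qed auto
  have "reparam g l -` W \<inter> space (tangent_borel A) =
     {z \<in> TM. ?s z > 0 \<and> reparam g l z \<in> W} \<union> (W - {z \<in> TM. ?s z \<in> {0<..}})"
  proof (intro Set.set_eqI iffI)
    fix z assume "z \<in> reparam g l -` W \<inter> space (tangent_borel A)"
    then show "z \<in> {z \<in> TM. ?s z > 0 \<and> reparam g l z \<in> W} \<union> (W - {z \<in> TM. ?s z \<in> {0<..}})"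
      using zero[of z] by (cases "?s z > 0") auto
  next
    fix z assume z: "z \<in> {z \<in> TM. ?s z > 0 \<and> reparam g l z \<in> W} \<union> (W - {z \<in> TM. ?s z \<in> {0<..}})"
    have "W \<subseteq> TM" using W unfolding openin_tangent_topology by blast
    then show "z \<in> reparam g l -` W \<inter> space (tangent_borel A)"
      using z zero[of z] by (cases "?s z > 0") auto
  qed
  also have "\<dots> \<in> sets (tangent_borel A)"
    using sets_openin[OF op] sets_openin[OF W] spos by (intro sets.Un sets.Diff)
  finally show "reparam g l -` W \<inter> space (tangent_borel A) \<in> sets (tangent_borel A)" .
qed

text \<open>Replacing a measure by its image under the normalization of all velocities to the mean speed
  \<open>l\<close>, with density proportional to the speed, changes no integral of a 1-form and lowers the action
  to \<open>l\<^sup>2 / 2\<close>; so the speed of a minimizer is constant by Cauchy-Schwarz.\<close>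

lemma mather_measure_speed:
  assumes g: "riemannian_metric A g" and h: "h \<in> H1" "h \<noteq> H1_zero" and \<mu>: "\<mu> \<in> mather_measures A g h"
  obtains l where "l > 0" "AE z in \<mu>. sqrt (case z of (x, v) \<Rightarrow> g x v v) = l"
proof -
  let ?q = "\<lambda>z. case z of (x, v) \<Rightarrow> g x v v"
  define s where "s z = sqrt (?q z)" for z
  note \<mu>' = mather_measureD[OF \<mu>]
  have M: "sets \<mu> = sets (tangent_borel A)" "prob_space \<mu>" using measures_with_rotation_sets[OF \<mu>'(1)] by auto
  interpret prob_space \<mu> by (rule M(2))
  have sp: "space \<mu> = TM" using sets_eq_imp_space_eq[OF M(1)] by simp
  have meas: "f \<in> measurable \<mu> K" if "f \<in> measurable (tangent_borel A) K" for f :: "_ \<Rightarrow> 'c" and K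
    using that by (simp add: measurable_cong_sets[OF M(1) refl])
  have sc: "bundle_continuous s" unfolding s_def[abs_def] by (rule bundle_continuous_norm[OF g])
  have sm[measurable]: "s \<in> borel_measurable \<mu>" by (rule meas[OF bundle_continuous_measurable[OF sc]])
  have s0: "s z \<ge> 0" and s2: "(s z)\<^sup>2 = ?q z" if "z \<in> TM" for z
    using that metric_nonneg[OF g] by (auto simp: s_def tangent_bundle_def)
  define \<beta> where "\<beta> = mather_beta A g h"
  have qint: "(\<integral>\<^sup>+z. ennreal (?q z) \<partial>\<mu>) = ennreal (2 * \<beta>)"
    unfolding action_eq[OF g M(1)] \<mu>'(2) \<beta>_def by (simp add: ennreal_mult')
  have s2int: "integrable \<mu> (\<lambda>z. (s z)\<^sup>2)" and s2val: "(LINT z|\<mu>. (s z)\<^sup>2) = 2 * \<beta>"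
  proof -
    have "(\<integral>\<^sup>+z. ennreal ((s z)\<^sup>2) \<partial>\<mu>) = ennreal (2 * \<beta>)"
      using qint s2 by (subst nn_integral_cong[of \<mu> _ "\<lambda>z. ennreal (?q z)"]) (auto simp: sp)
    moreover have "0 \<le> 2 * \<beta>" using mather_beta_nonneg by (simp add: \<beta>_def)
    ultimately show "integrable \<mu> (\<lambda>z. (s z)\<^sup>2)" "(LINT z|\<mu>. (s z)\<^sup>2) = 2 * \<beta>"
      using nn_integral_eq_integrable[of "\<lambda>z. (s z)\<^sup>2" \<mu> "2 * \<beta>"] by auto
  qed
  have sint: "integrable \<mu> s"
    by (rule square_integrable_imp_integrable[OF sm s2int])
  define l where "l = (LINT z|\<mu>. s z)"
  have l0: "l \<ge> 0" unfolding l_def by (rule integral_nonneg_AE) (use s0 sp in \<open>auto intro!: AE_I2\<close>)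
  \<comment> \<open>Mean speed 0 would put the measure on the zero section, where all 1-forms
    vanish; then every pairing with \<open>h\<close> would be 0, against nondegeneracy.\<close>
  have l: "l > 0"
  proof (rule ccontr)
    assume "\<not> l > 0"
    then have "l = 0" using l0 by simp
    moreover have "AE z in \<mu>. 0 \<le> s z" using s0 sp by (auto intro!: AE_I2)
    ultimately have ae: "AE z in \<mu>. s z = 0"
      using integral_nonneg_eq_0_iff_AE[OF sint] unfolding l_def by simp
    have "pairing A \<eta> h = 0" if \<eta>: "closed_1form A \<eta>" for \<eta>
    proof -
      have \<eta>': "smooth_1form A \<eta>" using \<eta> by (simp add: closed_1form_def)
      have "AE z in \<mu>. (case z of (x, v) \<Rightarrow> \<eta> x v) = 0"
        using ae AE_space
      proof eventually_elim
        fix z assume z: "s z = 0" "z \<in> space \<mu>"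
        then obtain x v where xv: "z = (x, v)" "v \<in> T x" by (auto simp: sp tangent_bundle_def)
        have "v = (\<lambda>c. 0)" using metric_pos[OF g xv(2)] z(1) by (auto simp: s_def xv)
        then show "(case z of (x, v) \<Rightarrow> \<eta> x v) = 0"
          using homogeneous_zero[OF bundle_continuous_form(2)[OF \<eta>'], of x] by (simp add: xv)
      qed
      then have "(LINT (x, v)|\<mu>. \<eta> x v) = 0" by (rule integral_eq_zero_AE)
      then show ?thesis
        using \<mu>'(1) \<eta> unfolding measures_with_rotation_def has_rotation_vector_def by auto
    qed
    then show False using pairing_nondegenerate[OF h] by metis
  qed
  let ?R = "reparam g l"
  have R: "?R \<in> measurable (tangent_borel A) (tangent_borel A)" by (rule reparam_measurable[OF g])
  define dens where "dens = density \<mu> (\<lambda>z. ennreal (s z / l))"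
  define \<mu>1 where "\<mu>1 = distr dens (tangent_borel A) ?R"
  have Rd: "?R \<in> measurable dens (tangent_borel A)" unfolding dens_def using meas[OF R] by simp
  have M1: "sets \<mu>1 = sets (tangent_borel A)" by (simp add: \<mu>1_def)
  \<comment> \<open>The speed in the density cancels the denominator of the reparametrization; on
    zero vectors both sides vanish.\<close>
  have homog: "s z * q (?R z) = l * q z" if q: "fibre_homogeneous 1 q" and z: "z \<in> TM" for q z
  proof -
    obtain x v where xv: "z = (x, v)" "v \<in> T x" using z by (auto simp: tangent_bundle_def)
    have "q (?R z) = (l / s z) * q z"
      using q xv unfolding fibre_homogeneous_def by (simp add: reparam_def s_def)
    moreover have "q z = 0" if "s z = 0"
    proof -
      have "v = (\<lambda>c. 0)" using metric_pos[OF g xv(2)] that by (auto simp: s_def xv)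
      then show ?thesis using homogeneous_zero[OF q, of x] by (simp add: xv)
    qed
    ultimately show ?thesis by (cases "s z = 0") auto
  qed
  have "prob_space \<mu>1"
    unfolding \<mu>1_def
  proof (rule prob_space.prob_space_distr[OF _ Rd])
    show "prob_space dens"
    proof
      have "emeasure dens (space dens) = (\<integral>\<^sup>+z. ennreal (s z / l) \<partial>\<mu>)"
        unfolding dens_def using sm by (subst emeasure_density) (auto intro!: nn_integral_cong)
      also have "\<dots> = ennreal (LINT z|\<mu>. s z / l)"
        using sint s0 l sp by (intro nn_integral_eq_integral) (auto intro!: AE_I2)
      also have "\<dots> = 1" using l by (simp add: l_def[symmetric])
      finally show "emeasure dens (space dens) = 1" .
    qed
  qed
  have qR: "s z * ?q (?R z) = l\<^sup>2 * s z" if z: "z \<in> TM" for z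
  proof -
    obtain x v where xv: "z = (x, v)" "v \<in> T x" using z by (auto simp: tangent_bundle_def)
    have "?q (?R z) = (l / s z)\<^sup>2 * ?q z"
      using metric_scale[OF g xv(2), of "l / s z"] by (simp add: xv reparam_def s_def)
    then show ?thesis using s2[OF z] by (cases "s z = 0") (auto simp: power_divide)
  qed
  have q1: "(\<integral>\<^sup>+z. ennreal (?q z) \<partial>\<mu>1) = ennreal (l\<^sup>2)"
  proof -
    have qm: "?q \<in> borel_measurable (tangent_borel A)" by (rule bundle_continuous_measurable[OF bundle_continuous_metric[OF g]])
    have "(\<integral>\<^sup>+z. ennreal (?q z) \<partial>\<mu>1) = (\<integral>\<^sup>+z. ennreal (?q (?R z)) \<partial>dens)"
      unfolding \<mu>1_def using qm by (intro nn_integral_distr[OF Rd]) auto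
    also have "\<dots> = (\<integral>\<^sup>+z. ennreal (s z / l) * ennreal (?q (?R z)) \<partial>\<mu>)"
      unfolding dens_def using measurable_compose[OF meas[OF R] qm] by (intro nn_integral_density) auto
    also have "\<dots> = (\<integral>\<^sup>+z. ennreal (l * s z) \<partial>\<mu>)"
    proof (rule nn_integral_cong)
      fix z assume "z \<in> space \<mu>"
      then have z: "z \<in> TM" by (simp add: sp)
      have "s z / l * ?q (?R z) = l * s z" using qR[OF z] l by (simp add: field_simps power2_eq_square)
      then show "ennreal (s z / l) * ennreal (?q (?R z)) = ennreal (l * s z)"
        using s0[OF z] l by (simp flip: ennreal_mult')
    qed
    also have "\<dots> = ennreal (LINT z|\<mu>. l * s z)"
      using sint s0 l sp by (intro nn_integral_eq_integral) (auto intro!: AE_I2)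
    also have "\<dots> = ennreal (l\<^sup>2)" by (simp add: l_def[symmetric] power2_eq_square)
    finally show ?thesis .
  qed
  have lin: "(LINT z|\<mu>1. q z) = (LINT z|\<mu>. q z)" if q: "bundle_continuous q" "fibre_homogeneous 1 q" for q
  proof -
    have qm: "q \<in> borel_measurable (tangent_borel A)" by (rule bundle_continuous_measurable[OF q(1)])
    have "(LINT z|\<mu>1. q z) = (LINT z|dens. q (?R z))"
      unfolding \<mu>1_def by (rule integral_distr[OF Rd qm])
    also have "\<dots> = (LINT z|\<mu>. (s z / l) *\<^sub>R q (?R z))"
      unfolding dens_def using measurable_compose[OF meas[OF R] qm] s0 l sp
      by (intro integral_density) (auto intro!: AE_I2)
    also have "\<dots> = (LINT z|\<mu>. q z)"
      using homog[OF q(2)] l by (intro Bochner_Integration.integral_cong) (auto simp: sp field_simps)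
    finally show ?thesis .
  qed
  have "\<mu>1 \<in> measures_with_rotation A g h"
    unfolding measures_with_rotation_def closed_measures_def has_rotation_vector_def
  proof (intro CollectI conjI allI impI M1 h(1) \<open>prob_space \<mu>1\<close>)
    show "(\<integral>\<^sup>+(x, v). ennreal (sqrt (g x v v)) \<partial>\<mu>1) < \<infinity>"
      by (rule sqrt_metric_integral_finite[OF g M1 \<open>prob_space \<mu>1\<close>]) (simp add: q1)
    fix f assume f: "manifold_Ck A 1 UNIV f"
    then have "(LINT (x, v)|\<mu>. differential A f x v) = 0"
      using \<mu>'(1) unfolding measures_with_rotation_def closed_measures_def by blast
    then show "(LINT (x, v)|\<mu>1. differential A f x v) = 0"
      using lin[OF bundle_continuous_differential[OF f]] by simp
  next
    fix \<eta> assume \<eta>: "closed_1form A \<eta>"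
    then have "pairing A \<eta> h = (LINT (x, v)|\<mu>. \<eta> x v)"
      using \<mu>'(1) unfolding measures_with_rotation_def has_rotation_vector_def by blast
    moreover have "smooth_1form A \<eta>" using \<eta> by (simp add: closed_1form_def)
    ultimately show "pairing A \<eta> h = (LINT (x, v)|\<mu>1. \<eta> x v)"
      using lin[OF bundle_continuous_form] by simp
  qed
  moreover have act1: "2 * action g \<mu>1 = ennreal (l\<^sup>2)" using q1 action_eq[OF g M1] by simp
  moreover have "action g \<mu>1 < \<infinity>"
    using act1 by (cases "action g \<mu>1 = \<infinity>") (auto simp: less_top ennreal_mult_top)
  ultimately have "ennreal \<beta> \<le> action g \<mu>1" unfolding \<beta>_def by (intro mather_beta_le_action)
  then have "2 * ennreal \<beta> \<le> ennreal (l\<^sup>2)" unfolding act1[symmetric] by (rule mult_left_mono) simp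
  then have "ennreal (2 * \<beta>) \<le> ennreal (l\<^sup>2)" by (simp add: ennreal_mult')
  then have \<beta>l: "2 * \<beta> \<le> l\<^sup>2" by (simp add: ennreal_le_iff)
  \<comment> \<open>The variance of the speed is \<open>2 * \<beta> - l\<^sup>2\<close>, and
    minimality has just shown that this is at most 0.\<close>
  have int: "integrable \<mu> (\<lambda>z. (s z)\<^sup>2 - 2 * l * s z + l\<^sup>2)"
    using s2int sint by (intro Bochner_Integration.integrable_add Bochner_Integration.integrable_diff) auto
  have "(LINT z|\<mu>. (s z)\<^sup>2 - 2 * l * s z + l\<^sup>2) = 2 * \<beta> - 2 * l * l + l\<^sup>2"
    using s2int sint s2val prob_space by (simp add: l_def[symmetric])
  then have le0: "(LINT z|\<mu>. (s z - l)\<^sup>2) \<le> 0"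
    using \<beta>l by (simp add: power2_diff power2_eq_square algebra_simps)
  have int': "integrable \<mu> (\<lambda>z. (s z - l)\<^sup>2)"
    using int by (simp add: power2_diff algebra_simps)
  have "0 \<le> (LINT z|\<mu>. (s z - l)\<^sup>2)" by (rule integral_nonneg_AE) simp
  with le0 have "(LINT z|\<mu>. (s z - l)\<^sup>2) = 0" by simp
  then have "AE z in \<mu>. (s z - l)\<^sup>2 = 0"
    using integral_nonneg_eq_0_iff_AE[OF int'] by simp
  then have "AE z in \<mu>. sqrt (?q z) = l" unfolding s_def by simp
  with l show ?thesis by (rule that)
qed

text \<open>The continuous inequality \<open>l \<le> sqrt (g x v v)\<close> passes from almost every
  point to the whole support, which keeps the closed support away from the zero section.\<close>

lemma mather_set_nonzero:
  assumes g: "riemannian_metric A g" and h: "h \<in> H1" "h \<noteq> H1_zero" and xv: "(x, v) \<in> mather_set A g h"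
  shows "g x v v > 0" "v \<in> T x"
proof -
  obtain \<mu> where \<mu>: "\<mu> \<in> mather_measures A g h" "(x, v) \<in> measure_supp A \<mu>"
    using xv unfolding mather_set_def by blast
  have M: "sets \<mu> = sets (tangent_borel A)" by (rule measures_with_rotation_sets(1)[OF mather_measureD(1)[OF \<mu>(1)]])
  obtain l where l: "l > 0" "AE z in \<mu>. sqrt (case z of (x, v) \<Rightarrow> g x v v) = l"
    using mather_measure_speed[OF g h \<mu>(1)] by blast
  have "l - sqrt (case (x, v) of (x, v) \<Rightarrow> g x v v) \<le> 0"
  proof (rule supp_nonpos[OF _ M _ \<mu>(2)])
    show "bundle_continuous (\<lambda>z. l - sqrt (case z of (x, v) \<Rightarrow> g x v v))"
      by (intro bundle_continuous_diff bundle_continuous_const bundle_continuous_norm g)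
    show "AE z in \<mu>. l - sqrt (case z of (x, v) \<Rightarrow> g x v v) \<le> 0" using l(2) by eventually_elim simp
  qed
  then have "l \<le> sqrt (g x v v)" by simp
  with l(1) have "0 < sqrt (g x v v)" by (rule less_le_trans)
  then show "g x v v > 0" by simp
  show "v \<in> T x" using \<mu>(2) measure_supp_subset by (auto simp: tangent_bundle_def)
qed

text \<open>Each fibre contains a unit vector for \<open>g1\<close>, and on it \<open>g2\<close>
  takes the value of the conformal factor.\<close>

lemma metric_ratio_conformal:
  assumes g1: "riemannian_metric A g1"
    and \<phi>: "\<And>x v. v \<in> T x \<Longrightarrow> g2 x v v = \<phi> x * g1 x v v"
  shows "metric_ratio A g1 g2 = (SUP x. \<phi> x)"
proof -
  have "{g2 x v v | x v. v \<in> T x \<and> g1 x v v = 1} = range \<phi>"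
  proof (intro equalityI subsetI)
    fix r assume "r \<in> range \<phi>"
    then obtain x where x: "r = \<phi> x" by blast
    obtain v where "v \<in> T x" "g1 x v v = 1" using unit_tangent[OF g1] by blast
    then show "r \<in> {g2 x v v | x v. v \<in> T x \<and> g1 x v v = 1}" using \<phi> x by force
  qed (use \<phi> in auto)
  then show ?thesis by (simp add: metric_ratio_def)
qed

end

subsection \<open>The theorem\<close>

theorem mainTheorem1:
  fixes A :: "('a::t2_space, 'e::euclidean_space) chart set"
    and g1 g2 :: "'a \<Rightarrow> ('a, 'e) tvec \<Rightarrow> ('a, 'e) tvec \<Rightarrow> real"
  assumes M: "closed_manifold A"
    and g1: "riemannian_metric A g1"
    and g2: "riemannian_metric A g2"
  shows
    "(\<forall>h\<in>H1. mather_beta A g2 h \<le> metric_ratio A g1 g2 * mather_beta A g1 h) \<and>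
     (\<forall>h\<in>H1 - {H1_zero}.
        mather_beta A g2 h = metric_ratio A g1 g2 * mather_beta A g1 h \<longleftrightarrow>
        (mather_measures A g1 h \<subseteq> mather_measures A g2 h \<and>
         mather_set A g1 h \<subseteq> mather_set A g2 h \<and>
         (\<forall>(x, v)\<in>mather_set A g1 h. g2 x v v = metric_ratio A g1 g2 * g1 x v v))) \<and>
     (\<forall>\<phi> :: 'a \<Rightarrow> real.
        manifold_smooth A UNIV \<phi> \<and> (\<forall>x. \<phi> x > 0) \<and>
        (\<forall>x. \<forall>v\<in>tangent_space A x. \<forall>w\<in>tangent_space A x. g2 x v w = \<phi> x * g1 x v w) \<longrightarrow>
        (let m = (SUP x. \<phi> x) in
          (\<forall>h\<in>H1. mather_beta A g2 h \<le> m * mather_beta A g1 h) \<and>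
          (\<forall>h\<in>H1 - {H1_zero}.
             mather_beta A g2 h = m * mather_beta A g1 h \<longleftrightarrow>
             (mather_measures A g1 h \<subseteq> mather_measures A g2 h \<and>
              projected_mather_set A g1 h \<subseteq> projected_mather_set A g2 h \<and>
              (\<forall>x\<in>projected_mather_set A g1 h. \<phi> x = m)))))"
proof -
  interpret closed_smooth_manifold A by unfold_locales (rule M)
  let ?C = "metric_ratio A g1 g2"
  have i: "mather_beta A g2 h \<le> ?C * mather_beta A g1 h" for h
    by (rule mather_beta_comparison[OF g1 g2])
  \<comment> \<open>The Mather sets are unions of supports over the minimizers, so their inclusion
    follows from that of the measures.\<close>
  have sub: "mather_set A g1 h \<subseteq> mather_set A g2 h" if "mather_measures A g1 h \<subseteq> mather_measures A g2 h" for h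
    using that unfolding mather_set_def by blast
  have ii: "mather_beta A g2 h = ?C * mather_beta A g1 h \<longleftrightarrow>
      (mather_measures A g1 h \<subseteq> mather_measures A g2 h \<and> mather_set A g1 h \<subseteq> mather_set A g2 h \<and>
       (\<forall>(x, v)\<in>mather_set A g1 h. g2 x v v = ?C * g1 x v v))" for h
    unfolding mather_beta_equality[OF g1 g2] using sub by blast
  have iii: "(\<forall>h\<in>H1. mather_beta A g2 h \<le> m * mather_beta A g1 h) \<and>
      (\<forall>h\<in>H1 - {H1_zero}.
         mather_beta A g2 h = m * mather_beta A g1 h \<longleftrightarrow>
         (mather_measures A g1 h \<subseteq> mather_measures A g2 h \<and>
          projected_mather_set A g1 h \<subseteq> projected_mather_set A g2 h \<and>
          (\<forall>x\<in>projected_mather_set A g1 h. \<phi> x = m)))"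
    if \<phi>: "\<forall>x. \<forall>v\<in>T x. \<forall>w\<in>T x. g2 x v w = \<phi> x * g1 x v w" and m: "m = (SUP x. \<phi> x)" for \<phi> m
  proof (intro conjI ballI)
    have m': "m = ?C" unfolding m by (rule metric_ratio_conformal[OF g1, symmetric]) (use \<phi> in blast)
    show "mather_beta A g2 h \<le> m * mather_beta A g1 h" for h unfolding m' by (rule i)
    fix h :: "'a real_chain set" assume h: "h \<in> H1 - {H1_zero}"
    \<comment> \<open>Cancelling \<open>g1 x v v\<close> requires a nonzero vector; this is where
      the class has to be nonzero.\<close>
    have "g2 x v v = ?C * g1 x v v \<longleftrightarrow> \<phi> x = m" if "(x, v) \<in> mather_set A g1 h" for x v
      using mather_set_nonzero[OF g1 _ _ that] h \<phi> unfolding m' by auto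
    then have "(\<forall>(x, v)\<in>mather_set A g1 h. g2 x v v = ?C * g1 x v v) \<longleftrightarrow> (\<forall>x\<in>projected_mather_set A g1 h. \<phi> x = m)"
      unfolding projected_mather_set_def by force
    moreover have "projected_mather_set A g1 h \<subseteq> projected_mather_set A g2 h"
      if "mather_measures A g1 h \<subseteq> mather_measures A g2 h"
      using sub[OF that] unfolding projected_mather_set_def by (rule image_mono)
    ultimately show "mather_beta A g2 h = m * mather_beta A g1 h \<longleftrightarrow>
         (mather_measures A g1 h \<subseteq> mather_measures A g2 h \<and>
          projected_mather_set A g1 h \<subseteq> projected_mather_set A g2 h \<and>
          (\<forall>x\<in>projected_mather_set A g1 h. \<phi> x = m))"
      unfolding m' mather_beta_equality[OF g1 g2] by blast
  qed
  show ?thesis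
    using i ii iii by (simp only: Let_def) blast
qed

end
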